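(* Suppose that $R$ is a left perfect ring with no nontrivial central idempotents and that $M$ is an $(R,R)$-bimodule. If $R$ is simple artinian, then $R\propto M$ is morphic if and only if either $M=0$ or $M\cong R(\sigma)$ (as $(R,R)$-bimodules) for some ring automorphism $\sigma$ of $R$. If $R$ is not simple artinian, then $R\propto M$ is morphic if and only if $R$ is an artinian principal ring and $M=0$.
   Context: All rings are associative with identity. For a ring $R$ and an $(R,R)$-bimodule $M$, the trivial extension $R\propto M$ is the set of pairs $(r,m)$ with $r\in R$, $m\in M$, with componentwise addition and multiplication $(r,m)(s,n)=(rs,rn+ms)$. For a ring endomorphism $\sigma$ of $R$, $R(\sigma)$ is the $(R,R)$-bimodule which equals ${}_RR$ as a left module and has right multiplication $s\cdot r=s\sigma(r)$ for $s\in R(\sigma)$, $r\in R$. An element $a$ of a ring $S$ is left morphic if $S/Sa\cong \{x\in S: xa=0\}$ as left $S$-modules; $S$ is left morphic if every element of $S$ is left morphic. Right morphic is defined symmetrically, and a ring is morphic if it is both left and right morphic. A principal ring is a ring in which every left ideal and every right ideal is principal. A ring $R$ with Jacobson radical $J$ is left perfect if $R/J$ is semisimple and $J$ is left T-nilpotent, i.e. for every sequence $r_1,r_2,\dots$ in $J$ there is $n$ with $r_1r_2\cdots r_n=0$. *)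

theory Defs
  imports "HOL-Algebra.Module" "HOL-Algebra.QuotRing"
begin

text \<open>
  The locale \<^locale>\<open>module\<close> requires a commutative ring of scalars.  As there, modules are given
  by records extending \<^typ>\<open>'b ring\<close>, whose multiplication and unit fields are
  ignored.
\<close>

locale left_module = R?: ring R + M?: abelian_group M for R (structure) and M (structure) +
  assumes lsmult_closed:
      "\<lbrakk>r \<in> carrier R; x \<in> carrier M\<rbrakk> \<Longrightarrow> r \<odot>\<^bsub>M\<^esub> x \<in> carrier M"
    and lsmult_l_distr:
      "\<lbrakk>r \<in> carrier R; s \<in> carrier R; x \<in> carrier M\<rbrakk>
        \<Longrightarrow> (r \<oplus> s) \<odot>\<^bsub>M\<^esub> x = r \<odot>\<^bsub>M\<^esub> x \<oplus>\<^bsub>M\<^esub> s \<odot>\<^bsub>M\<^esub> x"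
    and lsmult_r_distr:
      "\<lbrakk>r \<in> carrier R; x \<in> carrier M; y \<in> carrier M\<rbrakk>
        \<Longrightarrow> r \<odot>\<^bsub>M\<^esub> (x \<oplus>\<^bsub>M\<^esub> y) = r \<odot>\<^bsub>M\<^esub> x \<oplus>\<^bsub>M\<^esub> r \<odot>\<^bsub>M\<^esub> y"
    and lsmult_assoc:
      "\<lbrakk>r \<in> carrier R; s \<in> carrier R; x \<in> carrier M\<rbrakk>
        \<Longrightarrow> (r \<otimes> s) \<odot>\<^bsub>M\<^esub> x = r \<odot>\<^bsub>M\<^esub> (s \<odot>\<^bsub>M\<^esub> x)"
    and lsmult_one:
      "x \<in> carrier M \<Longrightarrow> \<one> \<odot>\<^bsub>M\<^esub> x = x"

record ('a, 'b) bimodule = "('a, 'b) module" +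
  rsmult :: "['b, 'a] \<Rightarrow> 'b" (infixl \<open>\<odot>\<^sub>r\<index>\<close> 70)

locale bimodule = left_module R M for R (structure) and M (structure) +
  assumes rsmult_closed:
      "\<lbrakk>x \<in> carrier M; r \<in> carrier R\<rbrakk> \<Longrightarrow> x \<odot>\<^sub>r\<^bsub>M\<^esub> r \<in> carrier M"
    and rsmult_r_distr:
      "\<lbrakk>x \<in> carrier M; r \<in> carrier R; s \<in> carrier R\<rbrakk>
        \<Longrightarrow> x \<odot>\<^sub>r\<^bsub>M\<^esub> (r \<oplus> s) = x \<odot>\<^sub>r\<^bsub>M\<^esub> r \<oplus>\<^bsub>M\<^esub> x \<odot>\<^sub>r\<^bsub>M\<^esub> s"
    and rsmult_l_distr:
      "\<lbrakk>x \<in> carrier M; y \<in> carrier M; r \<in> carrier R\<rbrakk>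
        \<Longrightarrow> (x \<oplus>\<^bsub>M\<^esub> y) \<odot>\<^sub>r\<^bsub>M\<^esub> r = x \<odot>\<^sub>r\<^bsub>M\<^esub> r \<oplus>\<^bsub>M\<^esub> y \<odot>\<^sub>r\<^bsub>M\<^esub> r"
    and rsmult_assoc:
      "\<lbrakk>x \<in> carrier M; r \<in> carrier R; s \<in> carrier R\<rbrakk>
        \<Longrightarrow> x \<odot>\<^sub>r\<^bsub>M\<^esub> (r \<otimes> s) = (x \<odot>\<^sub>r\<^bsub>M\<^esub> r) \<odot>\<^sub>r\<^bsub>M\<^esub> s"
    and rsmult_one:
      "x \<in> carrier M \<Longrightarrow> x \<odot>\<^sub>r\<^bsub>M\<^esub> \<one> = x"
    and smult_rsmult_assoc:
      "\<lbrakk>r \<in> carrier R; x \<in> carrier M; s \<in> carrier R\<rbrakk>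
        \<Longrightarrow> (r \<odot>\<^bsub>M\<^esub> x) \<odot>\<^sub>r\<^bsub>M\<^esub> s = r \<odot>\<^bsub>M\<^esub> (x \<odot>\<^sub>r\<^bsub>M\<^esub> s)"

definition left_module_iso ::
  "('a, 'r) ring_scheme \<Rightarrow> ('a, 'b, 'm) module_scheme \<Rightarrow> ('a, 'c, 'n) module_scheme \<Rightarrow> ('b \<Rightarrow> 'c) set"
  where "left_module_iso R M N =
    {f \<in> iso (add_monoid M) (add_monoid N).
      \<forall>r\<in>carrier R. \<forall>x\<in>carrier M. f (r \<odot>\<^bsub>M\<^esub> x) = r \<odot>\<^bsub>N\<^esub> f x}"

definition bimodule_iso ::
  "('a, 'r) ring_scheme \<Rightarrow> ('a, 'b, 'm) bimodule_scheme \<Rightarrow> ('a, 'c, 'n) bimodule_scheme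
    \<Rightarrow> ('b \<Rightarrow> 'c) set"
  where "bimodule_iso R M N =
    {f \<in> left_module_iso R M N.
      \<forall>x\<in>carrier M. \<forall>r\<in>carrier R. f (x \<odot>\<^sub>r\<^bsub>M\<^esub> r) = f x \<odot>\<^sub>r\<^bsub>N\<^esub> r}"

definition regular_module :: "('a, 'r) ring_scheme \<Rightarrow> ('a, 'a) module"
  where "regular_module R =
    \<lparr>carrier = carrier R, mult = mult R, one = one R, zero = zero R, add = add R, smult = mult R\<rparr>"

text \<open>The carrier of M/N consists of the additive cosets N + x, with r(N + x) = N + rx.\<close>

definition quotient_module :: "('a, 'b, 'm) module_scheme \<Rightarrow> 'b set \<Rightarrow> ('a, 'b set) module"
  where "quotient_module M N =
    \<lparr>carrier = a_rcosets\<^bsub>M\<^esub> N, mult = (\<lambda>X Y. undefined), one = undefined,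
     zero = N, add = (\<lambda>X Y. X <+>\<^bsub>M\<^esub> Y),
     smult = (\<lambda>r X. \<Union>x\<in>X. N +>\<^bsub>M\<^esub> (r \<odot>\<^bsub>M\<^esub> x))\<rparr>"

text \<open>
  Right-sided notions for R are the corresponding left-sided notions for the opposite
  ring: right R-modules are left modules over the opposite ring.
\<close>

definition opposite_ring :: "('a, 'r) ring_scheme \<Rightarrow> ('a, 'r) ring_scheme"
  where "opposite_ring R = R\<lparr>mult := (\<lambda>x y. y \<otimes>\<^bsub>R\<^esub> x)\<rparr>"

definition left_ideal :: "'a set \<Rightarrow> ('a, 'r) ring_scheme \<Rightarrow> bool"
  where "left_ideal I R \<longleftrightarrow>
    additive_subgroup I R \<and> (\<forall>r\<in>carrier R. \<forall>x\<in>I. r \<otimes>\<^bsub>R\<^esub> x \<in> I)"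

text \<open>Also over a noncommutative ring, \<^const>\<open>cgenideal\<close> is the left ideal Ra.\<close>

definition left_principal_ring :: "('a, 'r) ring_scheme \<Rightarrow> bool"
  where "left_principal_ring R \<longleftrightarrow>
    (\<forall>I. left_ideal I R \<longrightarrow> (\<exists>a\<in>carrier R. I = PIdl\<^bsub>R\<^esub> a))"

definition principal_ring :: "('a, 'r) ring_scheme \<Rightarrow> bool"
  where "principal_ring R \<longleftrightarrow> left_principal_ring R \<and> left_principal_ring (opposite_ring R)"

definition left_artinian :: "('a, 'r) ring_scheme \<Rightarrow> bool"
  where "left_artinian R \<longleftrightarrow>
    (\<forall>I :: nat \<Rightarrow> 'a set. (\<forall>n. left_ideal (I n) R) \<and> (\<forall>n. I (Suc n) \<subseteq> I n)
      \<longrightarrow> (\<exists>N. \<forall>n\<ge>N. I n = I N))"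

definition artinian_ring :: "('a, 'r) ring_scheme \<Rightarrow> bool"
  where "artinian_ring R \<longleftrightarrow> left_artinian R \<and> left_artinian (opposite_ring R)"

definition simple_ring :: "('a, 'r) ring_scheme \<Rightarrow> bool"
  where "simple_ring R \<longleftrightarrow>
    carrier R \<noteq> {\<zero>\<^bsub>R\<^esub>} \<and> (\<forall>I. ideal I R \<longrightarrow> I = {\<zero>\<^bsub>R\<^esub>} \<or> I = carrier R)"

definition simple_artinian :: "('a, 'r) ring_scheme \<Rightarrow> bool"
  where "simple_artinian R \<longleftrightarrow> simple_ring R \<and> artinian_ring R"

definition maximal_left_ideal :: "'a set \<Rightarrow> ('a, 'r) ring_scheme \<Rightarrow> bool"
  where "maximal_left_ideal I R \<longleftrightarrow>
    left_ideal I R \<and> I \<noteq> carrier R \<and>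
    (\<forall>K. left_ideal K R \<and> I \<subseteq> K \<longrightarrow> K = I \<or> K = carrier R)"

text \<open>Intersecting with the carrier matters only for the zero ring, where J is the whole ring.\<close>

definition jacobson_radical :: "('a, 'r) ring_scheme \<Rightarrow> 'a set"
  where "jacobson_radical R = carrier R \<inter> \<Inter>{I. maximal_left_ideal I R}"

text \<open>A ring is semisimple if every submodule of its left regular module is a direct summand.\<close>

definition semisimple_ring :: "('a, 'r) ring_scheme \<Rightarrow> bool"
  where "semisimple_ring R \<longleftrightarrow>
    (\<forall>I. left_ideal I R \<longrightarrow>
      (\<exists>K. left_ideal K R \<and> I \<inter> K = {\<zero>\<^bsub>R\<^esub>} \<and> I <+>\<^bsub>R\<^esub> K = carrier R))"

definition left_T_nilpotent :: "'a set \<Rightarrow> ('a, 'r) ring_scheme \<Rightarrow> bool"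
  where "left_T_nilpotent J R \<longleftrightarrow>
    (\<forall>r :: nat \<Rightarrow> 'a. (\<forall>i. r i \<in> J) \<longrightarrow>
      (\<exists>n. foldr (mult R) (map r [0..<n]) \<one>\<^bsub>R\<^esub> = \<zero>\<^bsub>R\<^esub>))"

definition left_perfect :: "('a, 'r) ring_scheme \<Rightarrow> bool"
  where "left_perfect R \<longleftrightarrow>
    semisimple_ring (R Quot (jacobson_radical R)) \<and> left_T_nilpotent (jacobson_radical R) R"

definition no_nontrivial_central_idempotents :: "('a, 'r) ring_scheme \<Rightarrow> bool"
  where "no_nontrivial_central_idempotents R \<longleftrightarrow>
    (\<forall>e\<in>carrier R. e \<otimes>\<^bsub>R\<^esub> e = e \<and> (\<forall>x\<in>carrier R. e \<otimes>\<^bsub>R\<^esub> x = x \<otimes>\<^bsub>R\<^esub> e)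
      \<longrightarrow> e = \<zero>\<^bsub>R\<^esub> \<or> e = \<one>\<^bsub>R\<^esub>)"

definition left_annihilator :: "('a, 'r) ring_scheme \<Rightarrow> 'a \<Rightarrow> 'a set"
  where "left_annihilator S a = {x \<in> carrier S. x \<otimes>\<^bsub>S\<^esub> a = \<zero>\<^bsub>S\<^esub>}"

definition left_morphic_element :: "('a, 'r) ring_scheme \<Rightarrow> 'a \<Rightarrow> bool"
  where "left_morphic_element S a \<longleftrightarrow>
    left_module_iso S
      (quotient_module (regular_module S) (PIdl\<^bsub>S\<^esub> a))
      ((regular_module S)\<lparr>carrier := left_annihilator S a\<rparr>) \<noteq> {}"

definition left_morphic :: "('a, 'r) ring_scheme \<Rightarrow> bool"
  where "left_morphic S \<longleftrightarrow> (\<forall>a\<in>carrier S. left_morphic_element S a)"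

definition morphic_ring :: "('a, 'r) ring_scheme \<Rightarrow> bool"
  where "morphic_ring S \<longleftrightarrow> left_morphic S \<and> left_morphic (opposite_ring S)"

definition trivial_extension ::
  "('a, 'r) ring_scheme \<Rightarrow> ('a, 'b, 'm) bimodule_scheme \<Rightarrow> ('a \<times> 'b) ring"  (infixl \<open>\<propto>\<close> 65)
  where "R \<propto> M =
    \<lparr>carrier = carrier R \<times> carrier M,
     mult = (\<lambda>(r, m) (s, n). (r \<otimes>\<^bsub>R\<^esub> s, r \<odot>\<^bsub>M\<^esub> n \<oplus>\<^bsub>M\<^esub> m \<odot>\<^sub>r\<^bsub>M\<^esub> s)),
     one = (\<one>\<^bsub>R\<^esub>, \<zero>\<^bsub>M\<^esub>),
     zero = (\<zero>\<^bsub>R\<^esub>, \<zero>\<^bsub>M\<^esub>),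
     add = (\<lambda>(r, m) (s, n). (r \<oplus>\<^bsub>R\<^esub> s, m \<oplus>\<^bsub>M\<^esub> n))\<rparr>"

definition twisted_bimodule :: "('a, 'r) ring_scheme \<Rightarrow> ('a \<Rightarrow> 'a) \<Rightarrow> ('a, 'a) bimodule"
  where "twisted_bimodule R \<sigma> =
    \<lparr>carrier = carrier R, mult = mult R, one = one R, zero = zero R, add = add R,
     smult = mult R, rsmult = (\<lambda>s r. s \<otimes>\<^bsub>R\<^esub> \<sigma> r)\<rparr>"

end

theory Submission
  imports Defs "HOL-Algebra.Multiplicative_Group"
begin

text \<open>
  Let \<open>J\<close> be the Jacobson radical of \<open>R\<close> and \<open>S = R \<propto> M\<close>; then \<open>J \<propto> M\<close> is the radical of \<open>S\<close>.
  If \<open>S\<close> is morphic, annihilators give an order-reversing bijection between the principal left and the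
  principal right ideals of \<open>S\<close>, and finite sums and intersections of principal left ideals are principal.
  Together with T-nilpotence this makes the radical nilpotent and \<open>S\<close> an artinian principal ring.  Without
  nontrivial central idempotents, \<open>S\<close> then has radical \<open>Sp = pS\<close> for some nilpotent \<open>p\<close>, with simple
  quotient \<open>S / Sp\<close>.  Comparing the ideal \<open>0 \<propto> M\<close> with \<open>Sp\<close> forces \<open>J = 0\<close> or \<open>M = 0\<close>; if \<open>J = 0\<close>
  and \<open>M \<noteq> 0\<close>, then \<open>p = (0, c)\<close> and \<open>M = Rc = cR\<close> with zero annihilators, and \<open>cr = \<sigma>(r)c\<close> defines the
  automorphism \<open>\<sigma>\<close>.

  Conversely, suppose the radical of a ring is \<open>Sp = pS\<close> with \<open>p\<close> nilpotent and simple artinian quotient.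
  Over a decomposition of \<open>1\<close> into orthogonal primitive idempotents every element can be diagonalised by
  elementary transformations, and the one-sided ideals of each diagonal entry are determined by the
  power of the radical it belongs to, so that the element is morphic.
\<close>

section \<open>Left ideals, opposite rings and morphic elements\<close>

text \<open>The Jacobson radical of \<open>R \<propto> M\<close> is never computed. What matters
  about an ideal is that it is two-sided, T-nilpotent and has a quotient that is semisimple on both
  sides. These properties pass from \<open>J\<close> to \<open>J \<times> carrier M\<close>, so the
  structural lemmas are stated for such an ideal and serve \<open>R\<close> and
  \<open>R \<propto> M\<close> alike. Right-hand statements are left-hand ones applied to
  \<open>opposite_ring R\<close>. The obstacle is that T-nilpotence is given for products in one
  order only. Hence the radical must first be shown to be principal as a left ideal: its generator
  is nilpotent, which yields T-nilpotence in the other order, and only then can the argument be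
  repeated on the other side. For the converse, a classical route would identify the ring with
  matrices over a local ring. Here the matrix entries are the products
  \<open>e \<otimes> (a \<otimes> d)\<close> with idempotents of one fixed ring, so that neither
  matrix rings nor an isomorphism theorem are involved.\<close>

lemma opposite_ring_simps [simp]:
  "carrier (opposite_ring R) = carrier R"
  "x \<otimes>\<^bsub>opposite_ring R\<^esub> y = y \<otimes>\<^bsub>R\<^esub> x"
  "\<one>\<^bsub>opposite_ring R\<^esub> = \<one>\<^bsub>R\<^esub>"
  "\<zero>\<^bsub>opposite_ring R\<^esub> = \<zero>\<^bsub>R\<^esub>"
  "add (opposite_ring R) = add R"
  "opposite_ring (opposite_ring R) = R"
  by (simp_all add: opposite_ring_def)

lemma add_monoid_opposite [simp]: "add_monoid (opposite_ring R) = add_monoid R"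
  by (simp add: opposite_ring_def)

lemma a_inv_opposite [simp]: "a_inv (opposite_ring R) = a_inv R"
  by (simp add: a_inv_def fun_eq_iff m_inv_def)

lemma a_minus_opposite [simp]: "a_minus (opposite_ring R) = a_minus R"
  by (simp add: a_minus_def fun_eq_iff)

lemma additive_subgroup_opposite [simp]:
  "additive_subgroup I (opposite_ring R) = additive_subgroup I R"
  by (simp add: additive_subgroup_def)

lemma set_add_opposite [simp]: "set_add (opposite_ring R) = set_add R"
  by (simp add: set_add_def fun_eq_iff)

lemma a_r_coset_opposite [simp]: "a_r_coset (opposite_ring R) = a_r_coset R"
  by (simp add: a_r_coset_def fun_eq_iff)

lemma mem_cgenideal: "x \<in> PIdl\<^bsub>R\<^esub> a \<longleftrightarrow> (\<exists>r\<in>carrier R. x = r \<otimes>\<^bsub>R\<^esub> a)"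
  by (auto simp: cgenideal_def)

lemma mem_left_annihilator:
  "x \<in> left_annihilator R a \<longleftrightarrow> x \<in> carrier R \<and> x \<otimes>\<^bsub>R\<^esub> a = \<zero>\<^bsub>R\<^esub>"
  by (simp add: left_annihilator_def)

lemma left_ideal_carrier: "left_ideal I R \<Longrightarrow> x \<in> I \<Longrightarrow> x \<in> carrier R"
  by (auto simp: left_ideal_def dest: additive_subgroup.a_subset)

lemma left_ideal_zero: "left_ideal I R \<Longrightarrow> \<zero>\<^bsub>R\<^esub> \<in> I"
  by (auto simp: left_ideal_def dest: additive_subgroup.zero_closed)

lemma left_ideal_add: "left_ideal I R \<Longrightarrow> x \<in> I \<Longrightarrow> y \<in> I \<Longrightarrow> x \<oplus>\<^bsub>R\<^esub> y \<in> I"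
  by (auto simp: left_ideal_def dest: additive_subgroup.a_closed)

lemma left_ideal_mult: "left_ideal I R \<Longrightarrow> r \<in> carrier R \<Longrightarrow> x \<in> I \<Longrightarrow> r \<otimes>\<^bsub>R\<^esub> x \<in> I"
  by (auto simp: left_ideal_def)

context ring
begin

lemma ring_opposite: "ring (opposite_ring R)"
proof (rule ringI)
  show "abelian_group (opposite_ring R)"
  proof (rule abelian_groupI)
    fix x assume "x \<in> carrier (opposite_ring R)"
    thus "\<exists>y\<in>carrier (opposite_ring R). y \<oplus>\<^bsub>opposite_ring R\<^esub> x = \<zero>\<^bsub>opposite_ring R\<^esub>"
      by (intro bexI[of _ "\<ominus> x"]) (simp_all add: l_neg)
  qed (simp_all add: a_ac)
  show "monoid (opposite_ring R)" by (rule monoidI) (simp_all add: m_assoc)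
qed (simp_all add: l_distr r_distr)

lemma nat_pow_opposite [simp]:
  "x \<in> carrier R \<Longrightarrow> x [^]\<^bsub>opposite_ring R\<^esub> (n::nat) = x [^] n"
proof (induction n)
  case (Suc n)
  then show ?case using nat_pow_Suc2[of x n] by (simp del: nat_pow_Suc add: monoid.nat_pow_Suc[OF ring.is_monoid[OF ring_opposite]])
qed simp

lemma left_idealI:
  assumes sub: "I \<subseteq> carrier R" and zero: "\<zero> \<in> I"
    and add: "\<And>x y. x \<in> I \<Longrightarrow> y \<in> I \<Longrightarrow> x \<oplus> y \<in> I"
    and mult: "\<And>r x. r \<in> carrier R \<Longrightarrow> x \<in> I \<Longrightarrow> r \<otimes> x \<in> I"
  shows "left_ideal I R"
proof -
  have neg: "\<ominus> x \<in> I" if "x \<in> I" for x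
  proof -
    have "\<ominus> \<one> \<otimes> x \<in> I" by (rule mult[OF _ that]) simp
    moreover have "x \<in> carrier R" using that sub by blast
    ultimately show ?thesis by (simp add: l_minus)
  qed
  have "subgroup I (add_monoid R)"
    by (rule subgroup.intro) (simp_all add: sub zero add neg flip: a_inv_def)
  thus ?thesis using mult by (auto simp: left_ideal_def additive_subgroup_def)
qed

lemma left_ideal_minus:
  assumes "left_ideal I R" "x \<in> I" "y \<in> I" shows "x \<ominus> y \<in> I"
proof -
  have "\<ominus> y \<in> I"
    using assms additive_subgroup.a_inv_closed by (auto simp: left_ideal_def)
  thus ?thesis using assms by (simp add: minus_eq left_ideal_add)
qed

lemma left_ideal_minus_iff:
  assumes I: "left_ideal I R" and y: "y \<in> I" and x: "x \<in> carrier R"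
  shows "x \<ominus> y \<in> I \<longleftrightarrow> x \<in> I"
proof
  have yc: "y \<in> carrier R" by (rule left_ideal_carrier[OF I y])
  assume "x \<ominus> y \<in> I"
  from left_ideal_add[OF I this y] have "(x \<ominus> y) \<oplus> y \<in> I" .
  moreover have "(x \<ominus> y) \<oplus> y = x" using x yc by algebra
  ultimately show "x \<in> I" by simp
qed (rule left_ideal_minus[OF I _ y])

lemma left_ideal_cgenideal:
  assumes a: "a \<in> carrier R" shows "left_ideal (PIdl a) R"
proof (rule left_idealI)
  show "PIdl a \<subseteq> carrier R" using a by (auto simp: mem_cgenideal)
  show "\<zero> \<in> PIdl a" using a by (auto simp: mem_cgenideal intro!: bexI[of _ "\<zero>"])
next
  fix x y assume "x \<in> PIdl a" "y \<in> PIdl a"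
  then obtain r s where "r \<in> carrier R" "x = r \<otimes> a" "s \<in> carrier R" "y = s \<otimes> a"
    by (auto simp: mem_cgenideal)
  thus "x \<oplus> y \<in> PIdl a"
    using a by (auto simp: mem_cgenideal l_distr intro!: bexI[of _ "r \<oplus> s"])
next
  fix r x assume r: "r \<in> carrier R" and "x \<in> PIdl a"
  then obtain s where "s \<in> carrier R" "x = s \<otimes> a"
    by (auto simp: mem_cgenideal)
  thus "r \<otimes> x \<in> PIdl a"
    using a r by (auto simp: mem_cgenideal m_assoc intro!: bexI[of _ "r \<otimes> s"])
qed

lemma left_ideal_left_annihilator: "a \<in> carrier R \<Longrightarrow> left_ideal (left_annihilator R a) R"
  by (rule left_idealI) (auto simp: mem_left_annihilator l_distr m_assoc)

lemma left_ideal_carrier_R: "left_ideal (carrier R) R"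
  by (rule left_idealI) auto

lemma left_ideal_set_add:
  assumes "left_ideal I R" "left_ideal K R" shows "left_ideal (I <+>\<^bsub>R\<^esub> K) R"
proof (rule left_idealI, goal_cases)
  case 1
  then show ?case using assms by (auto simp: set_add_def' dest: left_ideal_carrier)
next
  case 2
  then show ?case using left_ideal_zero[OF assms(1)] left_ideal_zero[OF assms(2)]
    by (force simp: set_add_def')
next
  case (3 x y)
  then obtain a b c d where "a \<in> I" "b \<in> K" "c \<in> I" "d \<in> K" "x = a \<oplus> b" "y = c \<oplus> d"
    by (auto simp: set_add_def')
  moreover from this have "x \<oplus> y = (a \<oplus> c) \<oplus> (b \<oplus> d)"
    using left_ideal_carrier[OF assms(1)] left_ideal_carrier[OF assms(2)] by (simp add: a_ac)
  moreover have "a \<oplus> c \<in> I" "b \<oplus> d \<in> K"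
    using calculation left_ideal_add[OF assms(1)] left_ideal_add[OF assms(2)] by blast+
  ultimately show ?case unfolding set_add_def' by blast
next
  case (4 r x)
  then obtain a b where "a \<in> I" "b \<in> K" "x = a \<oplus> b" by (auto simp: set_add_def')
  moreover from this have "r \<otimes> x = r \<otimes> a \<oplus> r \<otimes> b"
    using left_ideal_carrier[OF assms(1)] left_ideal_carrier[OF assms(2)] 4 by (simp add: r_distr)
  moreover have "r \<otimes> a \<in> I" "r \<otimes> b \<in> K"
    using calculation left_ideal_mult[OF assms(1) 4(1)] left_ideal_mult[OF assms(2) 4(1)] by blast+
  ultimately show ?case unfolding set_add_def' by blast
qed

lemma mem_set_add: "x \<in> I <+>\<^bsub>R\<^esub> K \<longleftrightarrow> (\<exists>i\<in>I. \<exists>k\<in>K. x = i \<oplus> k)"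
  by (auto simp: set_add_def')

lemma subset_set_add:
  assumes "left_ideal I R" "left_ideal K R" shows "I \<subseteq> I <+>\<^bsub>R\<^esub> K" "K \<subseteq> I <+>\<^bsub>R\<^esub> K"
proof -
  show "I \<subseteq> I <+>\<^bsub>R\<^esub> K"
    using left_ideal_zero[OF assms(2)] left_ideal_carrier[OF assms(1)]
    by (force simp: mem_set_add)
  show "K \<subseteq> I <+>\<^bsub>R\<^esub> K"
    using left_ideal_zero[OF assms(1)] left_ideal_carrier[OF assms(2)]
    by (force simp: mem_set_add)
qed

lemma set_add_subset:
  assumes "left_ideal L R" "I \<subseteq> L" "K \<subseteq> L" shows "I <+>\<^bsub>R\<^esub> K \<subseteq> L"
  using assms(2,3) left_ideal_add[OF assms(1)] unfolding set_add_def' by blast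

lemma cgenideal_subset_iff:
  assumes "left_ideal I R" "a \<in> carrier R" shows "PIdl a \<subseteq> I \<longleftrightarrow> a \<in> I"
proof
  show "PIdl a \<subseteq> I \<Longrightarrow> a \<in> I" using cgenideal_self[OF assms(2)] by blast
  show "a \<in> I \<Longrightarrow> PIdl a \<subseteq> I"
    using left_ideal_mult[OF assms(1)] by (auto simp: mem_cgenideal)
qed

lemma left_ideal_eq_carrier_iff: "left_ideal I R \<Longrightarrow> I = carrier R \<longleftrightarrow> \<one> \<in> I"
proof
  assume *: "left_ideal I R" "\<one> \<in> I"
  have "x \<in> I" if "x \<in> carrier R" for x using left_ideal_mult[OF *(1) that *(2)] that by simp
  thus "I = carrier R" using left_ideal_carrier[OF *(1)] by auto
qed auto

lemma ideal_iff_left_ideal: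
  "ideal I R \<longleftrightarrow> left_ideal I R \<and> left_ideal I (opposite_ring R)"
proof
  assume "ideal I R"
  then interpret ideal I R .
  show "left_ideal I R \<and> left_ideal I (opposite_ring R)"
    by (auto simp: left_ideal_def I_l_closed I_r_closed is_additive_subgroup)
next
  assume *: "left_ideal I R \<and> left_ideal I (opposite_ring R)"
  show "ideal I R"
    using * by (intro idealI ring_axioms)
      (auto simp: left_ideal_def additive_subgroup_def)
qed

lemma ideal_intro:
  assumes "I \<subseteq> carrier R" "\<zero> \<in> I" "\<And>x y. x \<in> I \<Longrightarrow> y \<in> I \<Longrightarrow> x \<oplus> y \<in> I"
    "\<And>r x. r \<in> carrier R \<Longrightarrow> x \<in> I \<Longrightarrow> r \<otimes> x \<in> I"
    "\<And>r x. r \<in> carrier R \<Longrightarrow> x \<in> I \<Longrightarrow> x \<otimes> r \<in> I"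
  shows "ideal I R"
  unfolding ideal_iff_left_ideal
  using left_idealI[of I] ring.left_idealI[OF ring_opposite, of I] assms by simp

lemma ideal_opposite: "ideal I R \<Longrightarrow> ideal I (opposite_ring R)"
  using ideal_iff_left_ideal ring.ideal_iff_left_ideal[OF ring_opposite] by simp

text \<open>A module map out of \<open>R/Ra\<close> is right multiplication by the image
  \<open>b\<close> of the coset of one. Injectivity says that \<open>Ra\<close> is the left
  annihilator of \<open>b\<close>, surjectivity that the left annihilator of \<open>a\<close> is
  \<open>Rb\<close>. Later work uses this elementwise criterion in place of quotient
  modules.\<close>

lemma left_morphic_element_iff:
  assumes a: "a \<in> carrier R"
  shows "left_morphic_element R a \<longleftrightarrow>
    (\<exists>b\<in>carrier R. PIdl a = left_annihilator R b \<and> left_annihilator R a = PIdl b)"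
proof -
  define L where "L = PIdl a"
  have L: "left_ideal L R" unfolding L_def by (rule left_ideal_cgenideal[OF a])
  interpret L: abelian_subgroup L R
    using L by (intro abelian_subgroupI3) (auto simp: left_ideal_def is_abelian_group)
  note Lc = left_ideal_carrier[OF L]
  define Q where "Q = quotient_module (regular_module R) L"
  define N where "N = (regular_module R)\<lparr>carrier := left_annihilator R a\<rparr>"
  have coset: "a_r_coset (regular_module R) = a_r_coset R"
    by (simp add: fun_eq_iff a_r_coset_def' regular_module_def)
  have carQ: "carrier Q = (\<lambda>x. L +> x) ` carrier R"
    by (auto simp: Q_def quotient_module_def A_RCOSETS_def' regular_module_def a_r_coset_def')
  have addQ: "(L +> x) \<oplus>\<^bsub>Q\<^esub> (L +> y) = L +> (x \<oplus> y)" if "x \<in> carrier R" "y \<in> carrier R" for x y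
  proof -
    have "set_add (regular_module R) = set_add R"
      by (simp add: fun_eq_iff set_add_def' regular_module_def)
    thus ?thesis using that by (simp add: Q_def quotient_module_def L.a_rcos_sum)
  qed
  have eq_coset: "L +> x = L +> y \<longleftrightarrow> x \<ominus> y \<in> L" if "x \<in> carrier R" "y \<in> carrier R" for x y
  proof
    assume "L +> x = L +> y"
    moreover have "x \<in> L +> x" using that left_ideal_zero[OF L] by (force simp: a_r_coset_def')
    ultimately obtain l where l: "l \<in> L" "x = l \<oplus> y" by (auto simp: a_r_coset_def')
    have "x \<ominus> y = l" unfolding l(2) using that Lc[OF l(1)] by algebra
    thus "x \<ominus> y \<in> L" using l by simp
  next
    have sub: "L +> u \<subseteq> L +> v" if "u \<in> carrier R" "v \<in> carrier R" "u \<ominus> v \<in> L" for u v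
    proof
      fix z assume "z \<in> L +> u"
      then obtain l where l: "l \<in> L" "z = l \<oplus> u" by (auto simp: a_r_coset_def')
      have "z = (l \<oplus> (u \<ominus> v)) \<oplus> v" unfolding l(2) using that(1,2) Lc[OF l(1)] by algebra
      thus "z \<in> L +> v" using left_ideal_add[OF L l(1) that(3)] by (auto simp: a_r_coset_def')
    qed
    assume xy: "x \<ominus> y \<in> L"
    have "\<zero> \<ominus> (x \<ominus> y) \<in> L" by (rule left_ideal_minus[OF L left_ideal_zero[OF L] xy])
    moreover have "\<zero> \<ominus> (x \<ominus> y) = y \<ominus> x" using that by algebra
    ultimately show "L +> x = L +> y" using sub[of x y] sub[of y x] that xy by simp
  qed
  have smQ: "r \<odot>\<^bsub>Q\<^esub> (L +> x) = L +> (r \<otimes> x)" if r: "r \<in> carrier R" and x: "x \<in> carrier R" for r x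
  proof -
    have "L +> (r \<otimes> y) = L +> (r \<otimes> x)" if y: "y \<in> L +> x" for y
    proof -
      obtain l where l: "l \<in> L" "y = l \<oplus> x" using y by (auto simp: a_r_coset_def')
      have "r \<otimes> y \<ominus> r \<otimes> x = r \<otimes> l" unfolding l(2) using Lc[OF l(1)] r x by algebra
      thus ?thesis using left_ideal_mult[OF L r l(1)] r x l Lc by (subst eq_coset) auto
    qed
    moreover have "x \<in> L +> x" using x L.a_rcos_self by blast
    ultimately have "(\<Union>y\<in>L +> x. L +> (r \<otimes> y)) = L +> (r \<otimes> x)" by blast
    thus ?thesis by (simp add: Q_def quotient_module_def coset) (simp add: regular_module_def)
  qed
  have N: "carrier N = left_annihilator R a" "\<And>x y. x \<oplus>\<^bsub>N\<^esub> y = x \<oplus> y" "\<And>r x. r \<odot>\<^bsub>N\<^esub> x = r \<otimes> x"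
    by (auto simp: N_def regular_module_def)
  have "left_module_iso R Q N \<noteq> {} \<longleftrightarrow>
    (\<exists>b\<in>carrier R. L = left_annihilator R b \<and> left_annihilator R a = PIdl b)"
  proof
    assume "left_module_iso R Q N \<noteq> {}"
    then obtain f where f: "f \<in> iso (add_monoid Q) (add_monoid N)"
      and f_sm: "\<And>r x. r \<in> carrier R \<Longrightarrow> x \<in> carrier Q \<Longrightarrow> f (r \<odot>\<^bsub>Q\<^esub> x) = r \<otimes> f x"
      by (auto simp: left_module_iso_def N)
    have bij: "bij_betw f (carrier Q) (left_annihilator R a)"
      using f by (simp add: iso_def N)
    define b where "b = f (L +> \<one>)"
    have b: "b \<in> carrier R"
      using bij carQ by (auto simp: b_def bij_betw_def mem_left_annihilator)
    have fb: "f (L +> x) = x \<otimes> b" if "x \<in> carrier R" for x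
      using f_sm[OF that, of "L +> \<one>"] smQ[OF that, of \<one>] that carQ by (simp add: b_def)
    have "left_annihilator R a = f ` (carrier Q)" using bij by (simp add: bij_betw_def)
    also have "\<dots> = PIdl b" using fb by (auto simp: carQ mem_cgenideal image_iff)
    finally have 1: "left_annihilator R a = PIdl b" .
    have "x \<in> L \<longleftrightarrow> x \<otimes> b = \<zero>" if x: "x \<in> carrier R" for x
    proof -
      have "x \<otimes> b = \<zero> \<longleftrightarrow> f (L +> x) = f (L +> \<zero>)" using x fb b by simp
      also have "\<dots> \<longleftrightarrow> L +> x = L +> \<zero>"
        using bij x carQ by (auto simp: bij_betw_def dest: inj_onD)
      also have "\<dots> \<longleftrightarrow> x \<in> L" using eq_coset[OF x zero_closed] x by (simp add: minus_eq)
      finally show ?thesis by simp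
    qed
    hence "L = left_annihilator R b" using Lc unfolding left_annihilator_def by blast
    thus "\<exists>b\<in>carrier R. L = left_annihilator R b \<and> left_annihilator R a = PIdl b"
      using 1 b by blast
  next
    assume "\<exists>b\<in>carrier R. L = left_annihilator R b \<and> left_annihilator R a = PIdl b"
    then obtain b where b: "b \<in> carrier R" "L = left_annihilator R b" "left_annihilator R a = PIdl b"
      by blast
    \<comment> \<open>As \<open>L\<close> annihilates \<open>b\<close>, right multiplication by
      \<open>b\<close> is constant on each coset of \<open>L\<close>; \<open>the_elem\<close> picks
      out the single value.\<close>
    define f where "f = (\<lambda>C. the_elem ((\<lambda>x. x \<otimes> b) ` C))"
    have fb: "f (L +> x) = x \<otimes> b" if x: "x \<in> carrier R" for x
    proof -
      have "y \<otimes> b = x \<otimes> b" if y: "y \<in> L +> x" for y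
      proof -
        obtain l where l: "l \<in> L" "y = l \<oplus> x" using y by (auto simp: a_r_coset_def')
        moreover have "l \<otimes> b = \<zero>" using l(1) b(2) by (simp add: mem_left_annihilator)
        ultimately show ?thesis using x b(1) Lc[OF l(1)] by (simp add: l_distr)
      qed
      moreover have "x \<in> L +> x" using x L.a_rcos_self by blast
      ultimately have "(\<lambda>x. x \<otimes> b) ` (L +> x) = {x \<otimes> b}" by blast
      thus ?thesis by (simp add: f_def)
    qed
    have "f \<in> hom (add_monoid Q) (add_monoid N)"
    proof (rule homI)
      fix C assume "C \<in> carrier (add_monoid Q)"
      thus "f C \<in> carrier (add_monoid N)" using fb by (auto simp: carQ N b(3) mem_cgenideal)
    next
      fix C D assume "C \<in> carrier (add_monoid Q)" "D \<in> carrier (add_monoid Q)"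
      thus "f (C \<otimes>\<^bsub>add_monoid Q\<^esub> D) = f C \<otimes>\<^bsub>add_monoid N\<^esub> f D"
        using fb b(1) by (auto simp: carQ N addQ l_distr)
    qed
    moreover have "bij_betw f (carrier Q) (carrier N)"
    proof (rule bij_betw_imageI)
      show "inj_on f (carrier Q)"
      proof (rule inj_onI)
        fix C D assume "C \<in> carrier Q" "D \<in> carrier Q" and eq: "f C = f D"
        then obtain x y where xy: "x \<in> carrier R" "y \<in> carrier R" "C = L +> x" "D = L +> y"
          by (auto simp: carQ)
        hence "(x \<ominus> y) \<otimes> b = x \<otimes> b \<ominus> y \<otimes> b" using b(1) by algebra
            also have "\<dots> = \<zero>" using xy eq fb b(1) by (simp add: minus_eq r_neg)
        finally have "x \<ominus> y \<in> L" using xy(1,2) unfolding b(2) mem_left_annihilator by simp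
        thus "C = D" using xy eq_coset by simp
      qed
      show "f ` carrier Q = carrier N"
        using fb by (auto simp: carQ N b(3) mem_cgenideal image_iff)
    qed
    moreover have "f (r \<odot>\<^bsub>Q\<^esub> C) = r \<odot>\<^bsub>N\<^esub> f C" if "r \<in> carrier R" "C \<in> carrier Q" for r C
      using that b(1) by (auto simp: carQ smQ fb N m_assoc)
    ultimately have "f \<in> left_module_iso R Q N"
      by (auto simp: left_module_iso_def iso_def)
    thus "left_module_iso R Q N \<noteq> {}" by blast
  qed
  thus ?thesis by (simp add: left_morphic_element_def Q_def N_def L_def)
qed

lemma left_morphicI:
  assumes "\<And>a. a \<in> carrier R \<Longrightarrow> \<exists>b\<in>carrier R.
    (\<forall>x\<in>carrier R. x \<in> PIdl a \<longleftrightarrow> x \<otimes> b = \<zero>) \<and> (\<forall>x\<in>carrier R. x \<in> PIdl b \<longleftrightarrow> x \<otimes> a = \<zero>)"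
  shows "left_morphic R"
  unfolding left_morphic_def
proof
  fix a assume a: "a \<in> carrier R"
  obtain b where b: "b \<in> carrier R" "\<forall>x\<in>carrier R. x \<in> PIdl a \<longleftrightarrow> x \<otimes> b = \<zero>"
    "\<forall>x\<in>carrier R. x \<in> PIdl b \<longleftrightarrow> x \<otimes> a = \<zero>" using assms[OF a] by blast
  have "PIdl a = left_annihilator R b" "left_annihilator R a = PIdl b"
    using b left_ideal_carrier[OF left_ideal_cgenideal[OF a]] left_ideal_carrier[OF left_ideal_cgenideal[OF b(1)]]
    unfolding left_annihilator_def by blast+
  thus "left_morphic_element R a" unfolding left_morphic_element_iff[OF a] using b(1) by blast
qed

end

section \<open>Semisimplicity modulo an ideal\<close>

text \<open>Elementwise form of: every left ideal of \<open>R/J\<close> is generated by an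
  idempotent, namely the image of \<open>e\<close>. Staying inside \<open>R\<close> lets one
  predicate serve \<open>R\<close>, its opposite and \<open>R \<propto> M\<close> without handling
  cosets.\<close>

definition left_semisimple_mod :: "'a set \<Rightarrow> ('a, 'r) ring_scheme \<Rightarrow> bool"
  where "left_semisimple_mod J R \<longleftrightarrow>
    (\<forall>I. left_ideal I R \<and> J \<subseteq> I \<longrightarrow> (\<exists>e\<in>I. \<forall>x\<in>I. x \<ominus>\<^bsub>R\<^esub> x \<otimes>\<^bsub>R\<^esub> e \<in> J))"

lemma left_semisimple_modE:
  assumes "left_semisimple_mod J R" "left_ideal I R" "J \<subseteq> I"
  obtains e where "e \<in> I" "\<And>x. x \<in> I \<Longrightarrow> x \<ominus>\<^bsub>R\<^esub> x \<otimes>\<^bsub>R\<^esub> e \<in> J"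
  using assms unfolding left_semisimple_mod_def by blast

text \<open>Left and right semisimplicity are compared inside \<open>R Quot J\<close>, while the
  right-hand conclusion is wanted for the opposite of \<open>R\<close>.\<close>

lemma opposite_FactRing: "opposite_ring (R Quot J) = opposite_ring R Quot J"
proof -
  have "rcoset_mult (opposite_ring R) J = (\<lambda>X Y. rcoset_mult R J Y X)"
    by (auto simp: fun_eq_iff rcoset_mult_def)
  thus ?thesis by (simp add: FactRing_def A_RCOSETS_def) (simp add: opposite_ring_def)
qed

context ring
begin

text \<open>Decompose one as \<open>e \<oplus> k\<close> along \<open>I\<close> and a complement
  \<open>K\<close>; for \<open>x\<close> in \<open>I\<close> the difference
  \<open>x \<ominus> x \<otimes> e\<close> equals \<open>x \<otimes> k\<close> and lies in
  both.\<close>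

lemma semisimple_ring_imp_mod_zero:
  assumes "semisimple_ring R" shows "left_semisimple_mod {\<zero>} R"
  unfolding left_semisimple_mod_def
proof (intro allI impI)
  fix I assume "left_ideal I R \<and> {\<zero>} \<subseteq> I"
  hence I: "left_ideal I R" by simp
  then obtain K where K: "left_ideal K R" "I \<inter> K = {\<zero>}" "I <+>\<^bsub>R\<^esub> K = carrier R"
    using assms unfolding semisimple_ring_def by blast
  have "\<one> \<in> I <+>\<^bsub>R\<^esub> K" using K(3) by simp
  then obtain e k where e: "e \<in> I" and k: "k \<in> K" and 1: "\<one> = e \<oplus> k"
    unfolding set_add_def' by blast
  note c = left_ideal_carrier[OF I] left_ideal_carrier[OF K(1)]
  have "x \<ominus> x \<otimes> e = \<zero>" if x: "x \<in> I" for x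
  proof -
    have "x \<ominus> x \<otimes> e = x \<otimes> \<one> \<ominus> x \<otimes> e" using c(1)[OF x] by simp
    also have "\<dots> = x \<otimes> k"
      unfolding 1 using c(1)[OF x] c(1)[OF e] c(2)[OF k] by algebra
    finally have *: "x \<ominus> x \<otimes> e = x \<otimes> k" .
    have "x \<otimes> k \<in> K" by (rule left_ideal_mult[OF K(1) c(1)[OF x] k])
    moreover have "x \<ominus> x \<otimes> e \<in> I"
      by (rule left_ideal_minus[OF I x left_ideal_mult[OF I c(1)[OF x] e]])
    ultimately show ?thesis using K(2) * by auto
  qed
  thus "\<exists>e\<in>I. \<forall>x\<in>I. x \<ominus> x \<otimes> e \<in> {\<zero>}" using e by auto
qed

lemma left_semisimple_mod_quotient:
  assumes J: "ideal J R" and Q: "left_semisimple_mod {\<zero>\<^bsub>R Quot J\<^esub>} (R Quot J)"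
  shows "left_semisimple_mod J R"
  unfolding left_semisimple_mod_def
proof (intro allI impI)
  fix I assume "left_ideal I R \<and> J \<subseteq> I"
  hence I: "left_ideal I R" by simp
  interpret J: ideal J R by (rule J)
  interpret Q: ring "R Quot J" by (rule J.quotient_is_ring)
  have h: "(+>) J \<in> ring_hom R (R Quot J)" by (rule J.rcos_ring_hom)
  note c = left_ideal_carrier[OF I]
  have carQ: "carrier (R Quot J) = (+>) J ` carrier R"
    by (auto simp: FactRing_def A_RCOSETS_def' )
  have zeroQ: "\<zero>\<^bsub>R Quot J\<^esub> = J" by (simp add: FactRing_def)
  have I': "left_ideal ((+>) J ` I) (R Quot J)"
  proof (rule Q.left_idealI)
    show "(+>) J ` I \<subseteq> carrier (R Quot J)" using c carQ by auto
    have "J +> \<zero> = J" by (simp add: J.a_rcos_const)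
    thus "\<zero>\<^bsub>R Quot J\<^esub> \<in> (+>) J ` I"
      using left_ideal_zero[OF I] zeroQ by (auto intro!: image_eqI[of _ _ "\<zero>"])
  next
    fix X Y assume "X \<in> (+>) J ` I" "Y \<in> (+>) J ` I"
    then obtain x y where xy: "x \<in> I" "y \<in> I" "X = J +> x" "Y = J +> y" by blast
    thus "X \<oplus>\<^bsub>R Quot J\<^esub> Y \<in> (+>) J ` I"
      using ring_hom_add[OF h c c, OF xy(1,2), symmetric] left_ideal_add[OF I xy(1,2)] by simp
  next
    fix X Y assume "X \<in> carrier (R Quot J)" "Y \<in> (+>) J ` I"
    then obtain x y where xy: "x \<in> carrier R" "y \<in> I" "X = J +> x" "Y = J +> y"
      using carQ by blast
    thus "X \<otimes>\<^bsub>R Quot J\<^esub> Y \<in> (+>) J ` I"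
      using ring_hom_mult[OF h xy(1) c, OF xy(2), symmetric] left_ideal_mult[OF I xy(1,2)] by simp
  qed
  obtain E where E: "E \<in> (+>) J ` I"
    "\<And>X. X \<in> (+>) J ` I \<Longrightarrow> X \<ominus>\<^bsub>R Quot J\<^esub> X \<otimes>\<^bsub>R Quot J\<^esub> E \<in> {\<zero>\<^bsub>R Quot J\<^esub>}"
    using left_semisimple_modE[OF Q I'] left_ideal_zero[OF I'] by blast
  then obtain e where e: "e \<in> I" "E = J +> e" by blast
  have "x \<ominus> x \<otimes> e \<in> J" if x: "x \<in> I" for x
  proof -
    have xe: "x \<otimes> e \<in> carrier R" using c x e by simp
    have in1: "J +> x \<in> carrier (R Quot J)" "J +> (x \<otimes> e) \<in> carrier (R Quot J)"
      using carQ c[OF x] xe by auto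
    have "(J +> x) \<ominus>\<^bsub>R Quot J\<^esub> (J +> (x \<otimes> e)) = \<zero>\<^bsub>R Quot J\<^esub>"
      using E(2)[of "J +> x"] x e ring_hom_mult[OF h c c, OF x e(1)] by simp
    hence "J +> x = J +> (x \<otimes> e)" using in1 by simp
    thus ?thesis using quotient_eq_iff_same_a_r_cos[OF J c[OF x] xe] by simp
  qed
  thus "\<exists>e\<in>I. \<forall>x\<in>I. x \<ominus> x \<otimes> e \<in> J" using e by blast
qed

text \<open>The union of an ascending chain is a left ideal, and the element \<open>e\<close> that
  generates it modulo \<open>J\<close> already occurs at a finite stage, where the chain stops.
  Larger ideals are the smaller elements of the relation, so its minimal elements are maximal
  ideals.\<close>

lemma left_acc_mod:
  assumes J: "left_ideal J R" and ss: "left_semisimple_mod J R"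
  shows "wf {(K, I). left_ideal K R \<and> left_ideal I R \<and> J \<subseteq> I \<and> I \<subset> K}"
  unfolding wf_iff_no_infinite_down_chain
proof
  assume "\<exists>f. \<forall>i. (f (Suc i), f i) \<in> {(K, I). left_ideal K R \<and> left_ideal I R \<and> J \<subseteq> I \<and> I \<subset> K}"
  then obtain f where
    f': "\<forall>i. (f (Suc i), f i) \<in> {(K, I). left_ideal K R \<and> left_ideal I R \<and> J \<subseteq> I \<and> I \<subset> K}"
    ..
  have f: "left_ideal (f i) R" "J \<subseteq> f i" "f i \<subset> f (Suc i)" for i
    using f'[rule_format, of i] by simp_all
  have mono: "i \<le> j \<Longrightarrow> f i \<subseteq> f j" for i j
  proof (rule lift_Suc_mono_le)
    show "f n \<subseteq> f (Suc n)" for n using f(3)[of n] by blast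
  qed
  define U where "U = (\<Union>i. f i)"
  have "left_ideal U R"
  proof (rule left_idealI)
    show "U \<subseteq> carrier R" using left_ideal_carrier[OF f(1)] by (auto simp: U_def)
    show "\<zero> \<in> U" using left_ideal_zero[OF f(1)] by (auto simp: U_def)
    show "r \<otimes> x \<in> U" if "r \<in> carrier R" "x \<in> U" for r x
      using that left_ideal_mult[OF f(1)] by (auto simp: U_def)
    show "x \<oplus> y \<in> U" if xy: "x \<in> U" "y \<in> U" for x y
    proof -
      obtain i j where "x \<in> f i" "y \<in> f j" using xy by (auto simp: U_def)
      hence "x \<in> f (max i j)" "y \<in> f (max i j)"
        using mono[of i "max i j"] mono[of j "max i j"] by auto
      thus ?thesis using left_ideal_add[OF f(1)] by (auto simp: U_def)
    qed
  qed
  moreover have "J \<subseteq> U" using f(2)[of 0] by (auto simp: U_def)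
  ultimately obtain e where e: "e \<in> U" "\<And>x. x \<in> U \<Longrightarrow> x \<ominus> x \<otimes> e \<in> J"
    using left_semisimple_modE[OF ss] by blast
  then obtain N where N: "e \<in> f N" by (auto simp: U_def)
  have "f (Suc N) \<subseteq> f N"
  proof
    fix x assume x: "x \<in> f (Suc N)"
    hence "x \<ominus> x \<otimes> e \<in> f N" using e(2)[of x] f(2)[of N] by (auto simp: U_def)
    thus "x \<in> f N"
      using left_ideal_minus_iff[OF f(1)] left_ideal_mult[OF f(1) _ N] left_ideal_carrier[OF f(1) x]
      by blast
  qed
  thus False using f(3)[of N] by blast
qed

text \<open>Among the idempotents \<open>g\<close> of the right ideal \<open>I\<close> choose one
  with \<open>Rg\<close> maximal. If \<open>z = x - gx\<close> were nonzero for some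
  \<open>x\<close> in \<open>I\<close>, then von Neumann regularity gives \<open>z = zyz\<close>,
  and \<open>zy\<close> is an idempotent of \<open>I\<close> killed by \<open>g\<close> from the
  left. From it an idempotent of \<open>I\<close> with a larger left ideal than \<open>Rg\<close>
  can be built.\<close>

lemma left_semisimple_zero_opposite:
  assumes ss: "left_semisimple_mod {\<zero>} R"
  shows "left_semisimple_mod {\<zero>} (opposite_ring R)"
  unfolding left_semisimple_mod_def
proof (intro allI impI)
  fix I assume "left_ideal I (opposite_ring R) \<and> {\<zero>} \<subseteq> I"
  hence I: "left_ideal I (opposite_ring R)" by simp
  note c = left_ideal_carrier[OF I, simplified]
  note Iadd = left_ideal_add[OF I, simplified] and Imult = left_ideal_mult[OF I, simplified]
    and Iminus = ring.left_ideal_minus[OF ring_opposite I, simplified]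
  have zero: "left_ideal {\<zero>} R" by (rule left_idealI) auto
  define G where "G = {PIdl g | g. g \<in> I \<and> g \<otimes> g = g}"
  have "PIdl \<zero> \<in> G" using left_ideal_zero[OF I] unfolding G_def by auto
  then obtain P where P: "P \<in> G"
    and P_max: "\<And>K. (K, P) \<in> {(K, I). left_ideal K R \<and> left_ideal I R \<and> {\<zero>} \<subseteq> I \<and> I \<subset> K} \<Longrightarrow> K \<notin> G"
    by (rule wfE_min[OF left_acc_mod[OF zero ss]]) blast
  obtain g where g: "P = PIdl g" "g \<in> I" "g \<otimes> g = g" using P unfolding G_def by blast
  note gc = c[OF g(2)]
  have "x = g \<otimes> x" if x: "x \<in> I" for x
  proof -
    note xc = c[OF x]
    define z where "z = x \<ominus> g \<otimes> x"
    have zI: "z \<in> I" unfolding z_def by (intro Iminus x Imult g xc)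
    note zc = c[OF zI]
    have "g \<otimes> z = g \<otimes> x \<ominus> (g \<otimes> g) \<otimes> x" unfolding z_def using gc xc by algebra
    hence gz: "g \<otimes> z = \<zero>" using g(3) gc xc by simp
    have "left_ideal (PIdl z) R" by (rule left_ideal_cgenideal[OF zc])
    then obtain e where e: "e \<in> PIdl z" "\<And>x. x \<in> PIdl z \<Longrightarrow> x \<ominus> x \<otimes> e \<in> {\<zero>}"
      using left_semisimple_modE[OF ss] left_ideal_zero by blast
    then obtain y where y: "y \<in> carrier R" "e = y \<otimes> z" by (auto simp: mem_cgenideal)
    have zyz: "z \<otimes> (y \<otimes> z) = z" using e(2)[OF cgenideal_self[OF zc]] y zc by simp
    define h where "h = z \<otimes> y"
    have hI: "h \<in> I" unfolding h_def by (intro Imult y zI)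
    note hc = c[OF hI]
    have hh: "h \<otimes> h = h" unfolding h_def using zyz zc y(1) by (metis m_assoc m_closed)
    have gh: "g \<otimes> h = \<zero>" unfolding h_def using gz zc y(1) gc by (metis m_assoc l_null)
    \<comment> \<open>\<open>g\<close> is known to annihilate \<open>h\<close> from the left only.
      Subtracting \<open>h \<otimes> g\<close> gives orthogonality on both sides and keeps
      \<open>k\<close> idempotent, so that \<open>g \<oplus> k\<close> is an idempotent above
      \<open>g\<close>.\<close>
    define k where "k = h \<ominus> h \<otimes> g"
    have kI: "k \<in> I" unfolding k_def by (intro Iminus hI Imult gc)
    note kc = c[OF kI]
    have "k \<otimes> g = h \<otimes> g \<ominus> h \<otimes> (g \<otimes> g)" unfolding k_def using hc gc by algebra
    hence kg: "k \<otimes> g = \<zero>" using g(3) hc gc by simp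
    have "g \<otimes> k = g \<otimes> h \<ominus> (g \<otimes> h) \<otimes> g" unfolding k_def using hc gc by algebra
    hence gk: "g \<otimes> k = \<zero>" using gh gc by (simp add: minus_eq)
    have "k \<otimes> k = h \<otimes> h \<ominus> (h \<otimes> h) \<otimes> g \<ominus> h \<otimes> (g \<otimes> h) \<oplus> h \<otimes> (g \<otimes> h) \<otimes> g"
      unfolding k_def using hc gc by algebra
    hence kk: "k \<otimes> k = k" unfolding gh hh using hc gc by (simp add: minus_eq k_def)
    define g' where "g' = g \<oplus> k"
    have g'I: "g' \<in> I" unfolding g'_def by (rule Iadd[OF g(2) kI])
    note g'c = c[OF g'I]
    have "g' \<otimes> g' = g \<otimes> g \<oplus> g \<otimes> k \<oplus> (k \<otimes> g \<oplus> k \<otimes> k)"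
      unfolding g'_def using gc kc by algebra
    hence "g' \<otimes> g' = g'" unfolding g(3) gk kg kk g'_def using gc kc by simp
    hence g'G: "PIdl g' \<in> G" unfolding G_def using g'I by blast
    have "g \<otimes> g' = g" "k \<otimes> g' = k"
      unfolding g'_def using g(3) gk kg kk gc kc by (simp_all add: r_distr)
    hence mem: "g \<in> PIdl g'" "k \<in> PIdl g'" unfolding mem_cgenideal using gc kc by metis+
    have "PIdl g \<subseteq> PIdl g'"
      using cgenideal_subset_iff[OF left_ideal_cgenideal[OF g'c] gc] mem(1) by simp
    hence "PIdl g = PIdl g'"
      using P_max[of "PIdl g'"] g'G left_ideal_cgenideal[OF g'c] left_ideal_cgenideal[OF gc] g(1)
        left_ideal_zero[OF left_ideal_cgenideal[OF gc]] by auto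
    hence "k \<in> PIdl g" using mem(2) by simp
    then obtain r where "r \<in> carrier R" "k = r \<otimes> g" unfolding mem_cgenideal by blast
    hence "k = k \<otimes> g" using g(3) gc by (simp add: m_assoc)
    hence "k = \<zero>" using kg by simp
    hence "h = h \<otimes> g" unfolding k_def using hc gc by simp
    hence "h = h \<otimes> g \<otimes> h" using hh by simp
    hence "h = \<zero>" using gh hc gc by (simp add: m_assoc)
    hence "z = \<zero>" using zyz zc y(1) unfolding h_def by (metis m_assoc l_null)
    thus ?thesis unfolding z_def using xc gc by simp
  qed
  hence "\<forall>x\<in>I. x \<ominus> g \<otimes> x = \<zero>" using c gc by (metis m_closed r_right_minus_eq)
  thus "\<exists>e\<in>I. \<forall>x\<in>I. x \<ominus>\<^bsub>opposite_ring R\<^esub> x \<otimes>\<^bsub>opposite_ring R\<^esub> e \<in> {\<zero>}"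
    using g(2) by auto
qed

text \<open>\<open>N'\<close> is the kernel of the map \<open>r \<mapsto> rs + N\<close> into the
  simple module \<open>R/N\<close>, so it is maximal unless this map vanishes. This is what makes
  the intersection of all maximal left ideals a right ideal as well.\<close>

lemma maximal_left_ideal_colon:
  assumes N: "maximal_left_ideal N R" and s: "s \<in> carrier R"
  defines "N' \<equiv> {y \<in> carrier R. y \<otimes> s \<in> N}"
  shows "N' = carrier R \<or> maximal_left_ideal N' R"
proof -
  have Nl: "left_ideal N R" using N by (simp add: maximal_left_ideal_def)
  have N'l: "left_ideal N' R"
    by (rule left_idealI)
      (use left_ideal_zero[OF Nl] left_ideal_add[OF Nl] left_ideal_mult[OF Nl] s in
        \<open>auto simp: N'_def l_distr m_assoc\<close>)
  have "K = carrier R" if K: "left_ideal K R" "N' \<subseteq> K" "K \<noteq> N'" for K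
  proof -
    obtain k where k: "k \<in> K" "k \<notin> N'" using K by blast
    note kc = left_ideal_carrier[OF K(1) k(1)]
    have P: "left_ideal (PIdl (k \<otimes> s)) R" using kc s by (intro left_ideal_cgenideal) auto
    have S: "left_ideal (N <+>\<^bsub>R\<^esub> PIdl (k \<otimes> s)) R" by (rule left_ideal_set_add[OF Nl P])
    have "k \<otimes> s \<in> N <+>\<^bsub>R\<^esub> PIdl (k \<otimes> s)"
      using subset_set_add(2)[OF Nl P] cgenideal_self[of "k \<otimes> s"] kc s by auto
    moreover have "k \<otimes> s \<notin> N" using k kc by (simp add: N'_def)
    ultimately have full: "N <+>\<^bsub>R\<^esub> PIdl (k \<otimes> s) = carrier R"
      using N S subset_set_add(1)[OF Nl P] unfolding maximal_left_ideal_def by blast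
    have "y \<in> K" if y: "y \<in> carrier R" for y
    proof -
      have "y \<otimes> s \<in> N <+>\<^bsub>R\<^esub> PIdl (k \<otimes> s)" using full y s by simp
      then obtain n q where n: "n \<in> N" and q: "q \<in> PIdl (k \<otimes> s)" and "y \<otimes> s = n \<oplus> q"
        unfolding mem_set_add by blast
      moreover obtain r where r: "r \<in> carrier R" "q = r \<otimes> (k \<otimes> s)"
        using q unfolding mem_cgenideal by blast
      ultimately have eq: "y \<otimes> s = n \<oplus> r \<otimes> (k \<otimes> s)" by simp
      note nc = left_ideal_carrier[OF Nl n]
      have "(y \<ominus> r \<otimes> k) \<otimes> s = y \<otimes> s \<ominus> r \<otimes> (k \<otimes> s)" using y r(1) kc s by algebra
      also have "\<dots> = n" unfolding eq using nc r(1) kc s by algebra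
      finally have "y \<ominus> r \<otimes> k \<in> N'" using n y r(1) kc by (simp add: N'_def)
      hence "y \<ominus> r \<otimes> k \<in> K" using K(2) by blast
      thus ?thesis
        using left_ideal_minus_iff[OF K(1) left_ideal_mult[OF K(1) r(1) k(1)] y] by simp
    qed
    thus ?thesis using left_ideal_carrier[OF K(1)] by blast
  qed
  thus ?thesis using N'l unfolding maximal_left_ideal_def by blast
qed

lemma ideal_jacobson_radical: "ideal (jacobson_radical R) R"
  unfolding ideal_iff_left_ideal
proof
  let ?J = "jacobson_radical R"
  have mem: "x \<in> ?J \<longleftrightarrow> x \<in> carrier R \<and> (\<forall>N. maximal_left_ideal N R \<longrightarrow> x \<in> N)" for x
    by (auto simp: jacobson_radical_def)
  have l: "left_ideal N R" if "maximal_left_ideal N R" for N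
    using that by (simp add: maximal_left_ideal_def)
  show left: "left_ideal ?J R"
  proof (rule left_idealI)
    show "?J \<subseteq> carrier R" by (auto simp: mem)
    show "\<zero> \<in> ?J" using left_ideal_zero[OF l] by (simp add: mem)
    show "x \<oplus> y \<in> ?J" if "x \<in> ?J" "y \<in> ?J" for x y
      using that left_ideal_add[OF l] by (simp add: mem)
    show "r \<otimes> x \<in> ?J" if "r \<in> carrier R" "x \<in> ?J" for r x
      using that left_ideal_mult[OF l] by (simp add: mem)
  qed
  show "left_ideal ?J (opposite_ring R)"
  proof (rule ring.left_idealI[OF ring_opposite]; simp?)
    show "?J \<subseteq> carrier R" by (auto simp: mem)
    show "\<zero> \<in> ?J" by (rule left_ideal_zero[OF left])
    show "x \<oplus> y \<in> ?J" if "x \<in> ?J" "y \<in> ?J" for x y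
      by (rule left_ideal_add[OF left that])
    fix s x assume s: "s \<in> carrier R" and x: "x \<in> ?J"
    have "x \<otimes> s \<in> N" if N: "maximal_left_ideal N R" for N
      using maximal_left_ideal_colon[OF N s] x by (auto simp: mem)
    thus "x \<otimes> s \<in> ?J" using s x by (simp add: mem)
  qed
qed

end

section \<open>Rings whose radical has a normal generator\<close>

context ring
begin

text \<open>Sending \<open>I\<close> to the right ideal of all \<open>x\<close> with
  \<open>Ix\<close> inside \<open>J\<close> reverses inclusions strictly. So the ascending chain
  condition for right ideals above \<open>J\<close> yields the descending one for left
  ideals.\<close>

lemma left_dcc_mod:
  assumes J: "ideal J R" and lss: "left_semisimple_mod J R"
    and rss: "left_semisimple_mod J (opposite_ring R)"
  shows "wf {(K, I). left_ideal K R \<and> left_ideal I R \<and> J \<subseteq> K \<and> K \<subset> I}"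
proof (rule wf_subset[OF wf_inv_image])
  have Jl: "left_ideal J R" and Jr: "left_ideal J (opposite_ring R)"
    using J ideal_iff_left_ideal by blast+
  define ann where "ann I = {x \<in> carrier R. \<forall>y\<in>I. y \<otimes> x \<in> J}" for I
  have ann: "left_ideal (ann I) (opposite_ring R)" "J \<subseteq> ann I" if I: "left_ideal I R" for I
  proof -
    note c = left_ideal_carrier[OF I]
    show "left_ideal (ann I) (opposite_ring R)"
    proof (rule ring.left_idealI[OF ring_opposite]; simp?)
      show "ann I \<subseteq> carrier R" by (auto simp: ann_def)
      show "\<zero> \<in> ann I" using left_ideal_zero[OF Jl] c by (simp add: ann_def)
      show "x \<oplus> y \<in> ann I" if "x \<in> ann I" "y \<in> ann I" for x y
        using that left_ideal_add[OF Jl] c by (simp add: ann_def r_distr)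
      show "x \<otimes> r \<in> ann I" if "r \<in> carrier R" "x \<in> ann I" for r x
      proof -
        have "y \<otimes> (x \<otimes> r) \<in> J" if y: "y \<in> I" for y
        proof -
          have "(y \<otimes> x) \<otimes> r \<in> J"
            using left_ideal_mult[OF Jr, of r "y \<otimes> x"] \<open>r \<in> carrier R\<close> \<open>x \<in> ann I\<close> y
            by (simp add: ann_def)
          thus ?thesis using \<open>r \<in> carrier R\<close> \<open>x \<in> ann I\<close> c[OF y] by (simp add: ann_def m_assoc)
        qed
        thus ?thesis using that by (simp add: ann_def)
      qed
    qed
    show "J \<subseteq> ann I"
    proof
      fix x assume x: "x \<in> J"
      have "y \<otimes> x \<in> J" if "y \<in> I" for y by (rule left_ideal_mult[OF Jl c[OF that] x])
      thus "x \<in> ann I" using left_ideal_carrier[OF Jl x] by (simp add: ann_def)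
    qed
  qed
  show "wf {(K, I). left_ideal K (opposite_ring R) \<and> left_ideal I (opposite_ring R) \<and> J \<subseteq> I \<and> I \<subset> K}"
    by (rule ring.left_acc_mod[OF ring_opposite Jr rss])
  have "ann I \<subset> ann K" if K: "left_ideal K R" "J \<subseteq> K" and I: "left_ideal I R" and KI: "K \<subset> I" for K I
  proof
    show "ann I \<subseteq> ann K" using KI by (auto simp: ann_def)
    obtain e where e: "e \<in> K" "\<And>x. x \<in> K \<Longrightarrow> x \<ominus> x \<otimes> e \<in> J"
      using left_semisimple_modE[OF lss K] by blast
    note ec = left_ideal_carrier[OF K(1) e(1)]
    have "x \<otimes> (\<one> \<ominus> e) \<in> J" if x: "x \<in> K" for x
    proof -
      note xc = left_ideal_carrier[OF K(1) x]
      have "x \<otimes> (\<one> \<ominus> e) = x \<ominus> x \<otimes> e" using xc ec by (simp add: minus_eq r_distr r_minus)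
      thus ?thesis using e(2)[OF x] by simp
    qed
    \<comment> \<open>The element \<open>\<one> \<ominus> e\<close> separates the two annihilators:
      it sends \<open>K\<close> into \<open>J\<close>, but an \<open>x\<close> outside
      \<open>K\<close> to an element outside \<open>K\<close>, hence outside
      \<open>J\<close>.\<close>
    hence in_K: "\<one> \<ominus> e \<in> ann K" using ec by (simp add: ann_def)
    obtain x where x: "x \<in> I" "x \<notin> K" using KI by blast
    note xc = left_ideal_carrier[OF I x(1)]
    have "x \<ominus> x \<otimes> e \<notin> K"
      using left_ideal_minus_iff[OF K(1) left_ideal_mult[OF K(1) xc e(1)] xc] x(2) by simp
    moreover have "x \<otimes> (\<one> \<ominus> e) = x \<ominus> x \<otimes> e" using xc ec by (simp add: minus_eq r_distr r_minus)
    ultimately have "x \<otimes> (\<one> \<ominus> e) \<notin> J" using K(2) by auto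
    hence "\<one> \<ominus> e \<notin> ann I" using x(1) by (auto simp: ann_def)
    thus "ann I \<noteq> ann K" using in_K by blast
  qed
  note strict = this
  show "{(K, I). left_ideal K R \<and> left_ideal I R \<and> J \<subseteq> K \<and> K \<subset> I} \<subseteq>
    inv_image {(K, I). left_ideal K (opposite_ring R) \<and> left_ideal I (opposite_ring R) \<and> J \<subseteq> I \<and> I \<subset> K} ann"
  proof
    fix z assume "z \<in> {(K, I). left_ideal K R \<and> left_ideal I R \<and> J \<subseteq> K \<and> K \<subset> I}"
    then obtain K I where z: "z = (K, I)"
      and h: "left_ideal K R" "left_ideal I R" "J \<subseteq> K" "K \<subset> I"
      by (cases z) simp
    show "z \<in> inv_image {(K, I). left_ideal K (opposite_ring R) \<and> left_ideal I (opposite_ring R) \<and>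
      J \<subseteq> I \<and> I \<subset> K} ann"
      unfolding z in_inv_image
      using ann(1)[OF h(1)] ann(1)[OF h(2)] ann(2)[OF h(2)] strict[OF h(1,3,2,4)] by simp
  qed
qed

section \<open>Nilpotent and normal elements\<close>

lemma cgenideal_one [simp]: "PIdl \<one> = carrier R"
  by (auto simp: mem_cgenideal)

text \<open>Partial sums of the geometric series. The induction also carries that \<open>v\<close>
  commutes with \<open>j\<close>, which turns the right inverse of \<open>\<one> \<ominus> j\<close>
  into a two-sided one.\<close>

lemma one_minus_nilpotent:
  assumes j: "j \<in> carrier R" "j [^] (n::nat) = \<zero>"
  obtains v where "v \<in> carrier R" "v \<otimes> (\<one> \<ominus> j) = \<one>" "(\<one> \<ominus> j) \<otimes> v = \<one>"
proof -
  have "\<exists>v\<in>carrier R. v \<otimes> j = j \<otimes> v \<and> (\<one> \<ominus> j) \<otimes> v = \<one> \<ominus> j [^] n" for n :: nat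
  proof (induction n)
    case 0
    show ?case using j(1) by (intro bexI[of _ \<zero>]) (simp_all add: minus_eq r_neg)
  next
    case (Suc n)
    then obtain v where v: "v \<in> carrier R" "v \<otimes> j = j \<otimes> v" "(\<one> \<ominus> j) \<otimes> v = \<one> \<ominus> j [^] n" by blast
    have "(\<one> \<oplus> j \<otimes> v) \<otimes> j = j \<oplus> j \<otimes> (v \<otimes> j)" using v(1) j(1) by algebra
    also have "\<dots> = j \<otimes> (\<one> \<oplus> j \<otimes> v)" unfolding v(2) using v(1) j(1) by (simp add: r_distr)
    finally have 1: "(\<one> \<oplus> j \<otimes> v) \<otimes> j = j \<otimes> (\<one> \<oplus> j \<otimes> v)" .
    have "(\<one> \<ominus> j) \<otimes> (\<one> \<oplus> j \<otimes> v) = \<one> \<ominus> j \<oplus> j \<otimes> ((\<one> \<ominus> j) \<otimes> v)" using v(1) j(1) by (simp add: ring_simprules)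
    also have "j \<otimes> ((\<one> \<ominus> j) \<otimes> v) = j \<ominus> j \<otimes> j [^] n"
      unfolding v(3) using j(1) by (simp add: minus_eq r_distr r_minus)
    also have "\<one> \<ominus> j \<oplus> (j \<ominus> j \<otimes> j [^] n) = \<one> \<ominus> j \<otimes> j [^] n"
      using j(1) nat_pow_closed[OF j(1), of n] by algebra
    also have "\<dots> = \<one> \<ominus> j [^] Suc n" using nat_pow_Suc2[OF j(1)] by simp
    finally show ?case using 1 v(1) j(1) by (intro bexI[of _ "\<one> \<oplus> j \<otimes> v"]) simp_all
  qed
  then obtain v where v: "v \<in> carrier R" "v \<otimes> j = j \<otimes> v" "(\<one> \<ominus> j) \<otimes> v = \<one> \<ominus> j [^] n" by blast
  have "v \<otimes> (\<one> \<ominus> j) = v \<ominus> v \<otimes> j" using v(1) j(1) by (simp add: minus_eq r_distr r_minus)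
  also have "\<dots> = (\<one> \<ominus> j) \<otimes> v" unfolding v(2) using v(1) j(1) by (simp add: minus_eq l_distr l_minus)
  finally show thesis using that[OF v(1)] v(3) j(2) by (simp add: minus_eq)
qed

text \<open>Takes the place of Nakayama's lemma: \<open>\<one> \<ominus> j\<close> is invertible and
  kills \<open>x\<close>.\<close>

lemma nilpotent_fixes_zero:
  assumes "j \<in> carrier R" "j [^] (n::nat) = \<zero>" "x \<in> carrier R" "x = j \<otimes> x"
  shows "x = \<zero>"
proof -
  obtain v where v: "v \<in> carrier R" "v \<otimes> (\<one> \<ominus> j) = \<one>"
    using one_minus_nilpotent[OF assms(1,2)] by blast
  have "(\<one> \<ominus> j) \<otimes> x = x \<ominus> j \<otimes> x" using assms(1,3) by algebra
  hence "(\<one> \<ominus> j) \<otimes> x = \<zero>" using assms(3,4) by simp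
  hence "v \<otimes> (\<one> \<ominus> j) \<otimes> x = \<zero>" using v(1) assms by (simp add: m_assoc)
  thus ?thesis using v assms(3) by simp
qed

text \<open>The hypothesis says that \<open>Ra\<close> lies in \<open>aR\<close>; the factor
  \<open>s\<close> is pushed past one copy of \<open>a\<close> at a time.\<close>

lemma normal_pow:
  assumes a: "a \<in> carrier R" and normal: "\<And>s. s \<in> carrier R \<Longrightarrow> \<exists>t\<in>carrier R. s \<otimes> a = a \<otimes> t"
  shows "s \<in> carrier R \<Longrightarrow> \<exists>t\<in>carrier R. s \<otimes> a [^] (k::nat) = a [^] k \<otimes> t"
proof (induction k arbitrary: s)
  case 0
  then show ?case by auto
next
  case (Suc k)
  then obtain t where t: "t \<in> carrier R" "s \<otimes> a [^] k = a [^] k \<otimes> t" by blast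
  obtain u where u: "u \<in> carrier R" "t \<otimes> a = a \<otimes> u" using normal[OF t(1)] by blast
  have "s \<otimes> a [^] Suc k = (s \<otimes> a [^] k) \<otimes> a" using Suc.prems a by (simp add: m_assoc)
  also have "\<dots> = a [^] k \<otimes> (t \<otimes> a)" unfolding t(2) using t(1) a by (simp add: m_assoc)
  also have "\<dots> = a [^] Suc k \<otimes> u" unfolding u(2) using u(1) a by (simp add: m_assoc)
  finally show ?case using u(1) by blast
qed

lemma normal_generator_swap:
  assumes "PIdl a = PIdl\<^bsub>opposite_ring R\<^esub> a" "s \<in> carrier R"
  shows "\<exists>t\<in>carrier R. s \<otimes> a = a \<otimes> t" "\<exists>t\<in>carrier R. a \<otimes> s = t \<otimes> a"
proof -
  have "s \<otimes> a \<in> PIdl a" "a \<otimes> s \<in> PIdl\<^bsub>opposite_ring R\<^esub> a" using assms(2) by (auto simp: mem_cgenideal)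
  hence "s \<otimes> a \<in> PIdl\<^bsub>opposite_ring R\<^esub> a" "a \<otimes> s \<in> PIdl a" using assms(1) by auto
  thus "\<exists>t\<in>carrier R. s \<otimes> a = a \<otimes> t" "\<exists>t\<in>carrier R. a \<otimes> s = t \<otimes> a"
    by (auto simp: mem_cgenideal)
qed

end

text \<open>Indecomposable artinian principal rings are of this form, with \<open>J\<close> the Jacobson radical.\<close>

locale special_ring = ring R for R (structure) +
  fixes J :: "'a set" and p :: 'a
  assumes J: "ideal J R"
    and p: "p \<in> carrier R"
    and J_left: "J = PIdl p"
    and J_right: "J = PIdl\<^bsub>opposite_ring R\<^esub> p"
    and nilp: "\<exists>n::nat. p [^] n = \<zero>"
    and one: "\<one> \<notin> J"
    and simple: "\<And>I. ideal I R \<Longrightarrow> J \<subseteq> I \<Longrightarrow> I = J \<or> I = carrier R"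
    and lss: "left_semisimple_mod J R"
    and rss: "left_semisimple_mod J (opposite_ring R)"
begin

lemma opposite: "special_ring (opposite_ring R) J p"
proof -
  have "ideal I R" if "ideal I (opposite_ring R)" for I
    using ring.ideal_opposite[OF ring_opposite that] by simp
  thus ?thesis
    using J p J_left J_right nilp one simple lss rss
    by (intro special_ring.intro special_ring_axioms.intro ring_opposite)
       (auto intro: ideal_opposite)
qed

lemma Jl: "left_ideal J R" and Jr: "left_ideal J (opposite_ring R)"
  using J ideal_iff_left_ideal by blast+

lemma J_carrier: "x \<in> J \<Longrightarrow> x \<in> carrier R"
  by (rule left_ideal_carrier[OF Jl])

lemma J_lmult: "r \<in> carrier R \<Longrightarrow> x \<in> J \<Longrightarrow> r \<otimes> x \<in> J"
  by (rule left_ideal_mult[OF Jl])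

lemma J_rmult: "r \<in> carrier R \<Longrightarrow> x \<in> J \<Longrightarrow> x \<otimes> r \<in> J"
  using left_ideal_mult[OF Jr] by simp

lemma p_in_J: "p \<in> J"
  using cgenideal_self[OF p] J_left by simp

section \<open>Powers of the radical and their annihilators\<close>

definition nil_index :: nat where "nil_index = (LEAST n. p [^] n = \<zero>)"

text \<open>This is the power \<open>J^r\<close>: as \<open>p\<close> is normal, \<open>p^r\<close>
  generates it from either side.\<close>

abbreviation Jpow :: "nat \<Rightarrow> 'a set" where "Jpow r \<equiv> PIdl (p [^] r)"

lemma p_pow_nil_index: "p [^] nil_index = \<zero>"
  unfolding nil_index_def using nilp by (rule LeastI_ex)

lemma p_pow_less_nil_index: "k < nil_index \<Longrightarrow> p [^] k \<noteq> \<zero>"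
  unfolding nil_index_def by (rule not_less_Least)

lemma pc: "p [^] (r::nat) \<in> carrier R"
  using p by simp

lemma normal_left: "s \<in> carrier R \<Longrightarrow> \<exists>t\<in>carrier R. s \<otimes> p [^] (r::nat) = p [^] r \<otimes> t"
  by (rule normal_pow[OF p normal_generator_swap(1)[OF trans[OF J_left[symmetric] J_right]]])

lemma normal_right: "s \<in> carrier R \<Longrightarrow> \<exists>t\<in>carrier R. p [^] (r::nat) \<otimes> s = t \<otimes> p [^] r"
  using special_ring.normal_left[OF opposite, of s r] p by simp

lemma mem_Jpow_right: "x \<in> Jpow r \<longleftrightarrow> (\<exists>s\<in>carrier R. x = p [^] r \<otimes> s)"
  unfolding mem_cgenideal using normal_left normal_right by metis

lemma Jpow_opposite: "PIdl\<^bsub>opposite_ring R\<^esub> (p [^] r) = Jpow r"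
  by (auto simp: mem_Jpow_right mem_cgenideal[of _ "opposite_ring R"])

lemma Jpow_left_ideal: "left_ideal (Jpow r) R"
  by (rule left_ideal_cgenideal[OF pc])

lemma Jpow_right_ideal: "left_ideal (Jpow r) (opposite_ring R)"
  using ring.left_ideal_cgenideal[OF ring_opposite, of "p [^] r"] p by (simp add: Jpow_opposite)

lemma Jpow_carrier: "x \<in> Jpow r \<Longrightarrow> x \<in> carrier R"
  by (rule left_ideal_carrier[OF Jpow_left_ideal])

lemma Jpow_lmult: "s \<in> carrier R \<Longrightarrow> x \<in> Jpow r \<Longrightarrow> s \<otimes> x \<in> Jpow r"
  by (rule left_ideal_mult[OF Jpow_left_ideal])

lemma Jpow_rmult: "s \<in> carrier R \<Longrightarrow> x \<in> Jpow r \<Longrightarrow> x \<otimes> s \<in> Jpow r"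
  using left_ideal_mult[OF Jpow_right_ideal] by simp

lemma Jpow_mult:
  assumes "x \<in> Jpow i" "y \<in> Jpow k" shows "x \<otimes> y \<in> Jpow (i + k)"
proof -
  obtain s t where s: "s \<in> carrier R" "x = s \<otimes> p [^] i" and t: "t \<in> carrier R" "y = p [^] k \<otimes> t"
    using assms unfolding mem_Jpow_right[of _ k] mem_cgenideal[of _ _ "p [^] i"] by blast
  have "x \<otimes> y = s \<otimes> (p [^] i \<otimes> p [^] k) \<otimes> t" unfolding s t using s t p by (simp add: m_assoc)
  also have "\<dots> = s \<otimes> p [^] (i + k) \<otimes> t" using p by (simp add: nat_pow_mult)
  finally show ?thesis
    using Jpow_rmult[OF t(1)] s(1) unfolding mem_cgenideal by auto
qed

lemma Jpow_0: "Jpow 0 = carrier R"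
  using cgenideal_one by simp

lemma Jpow_1: "Jpow (Suc 0) = J"
  using J_left p by simp

lemma Jpow_nil_index: "Jpow nil_index = {\<zero>}"
  unfolding p_pow_nil_index by (auto simp: mem_cgenideal intro!: exI[of _ \<zero>])

lemma J_Jpow: "x \<in> J \<Longrightarrow> y \<in> Jpow k \<Longrightarrow> x \<otimes> y \<in> Jpow (Suc k)"
  using Jpow_mult[of x "Suc 0" y k] Jpow_1 by simp

lemma Jpow_J: "y \<in> J \<Longrightarrow> x \<in> Jpow k \<Longrightarrow> x \<otimes> y \<in> Jpow (Suc k)"
  using Jpow_mult[of x k y "Suc 0"] Jpow_1 by simp

lemma J_nilpotent: assumes "j \<in> J" shows "j [^] nil_index = \<zero>"
proof -
  have "j [^] n \<in> Jpow n" for n :: nat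
  proof (induction n)
    case 0
    then show ?case by (simp add: Jpow_0)
  next
    case (Suc n)
    then show ?case using Jpow_J[OF assms] by simp
  qed
  thus ?thesis using Jpow_nil_index by blast
qed

text \<open>This is how the simplicity of \<open>R/J\<close> is exploited: a statement about
  elements outside \<open>J\<close> is proved by exhibiting a suitable two-sided \<open>H\<close>,
  which is then comaximal with \<open>J\<close>.\<close>

lemma ideal_not_le_J:
  assumes H: "ideal H R" "x \<in> H" "x \<notin> J"
  obtains h j where "h \<in> H" "j \<in> J" "\<one> = h \<oplus> j"
proof -
  have Hl: "left_ideal H R" using H ideal_iff_left_ideal by blast
  have "ideal (H <+>\<^bsub>R\<^esub> J) R" by (rule add_ideals[OF H(1) J])
  hence "H <+>\<^bsub>R\<^esub> J = carrier R"
    using simple subset_set_add[OF Hl Jl] H(2,3) by blast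
  hence "\<one> \<in> H <+>\<^bsub>R\<^esub> J" by simp
  thus thesis using that unfolding mem_set_add by blast
qed

text \<open>Since \<open>p^k\<close> is normal, its left annihilator is a two-sided ideal. If it is
  not inside \<open>J\<close>, writing one as \<open>h \<oplus> j\<close> with \<open>h\<close> in
  it gives \<open>p^k = j p^k\<close> with \<open>j\<close> nilpotent.\<close>

lemma annihilates_p_pow:
  assumes s: "s \<in> carrier R" "s \<notin> J" "s \<otimes> p [^] (k::nat) = \<zero>"
  shows "p [^] k = \<zero>"
proof -
  define H where "H = {t \<in> carrier R. t \<otimes> p [^] k = \<zero>}"
  have "ideal H R"
    unfolding ideal_iff_left_ideal
  proof
    show "left_ideal H R"
      using left_ideal_left_annihilator[OF pc[of k]] by (simp add: H_def left_annihilator_def)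
    show "left_ideal H (opposite_ring R)"
    proof (rule ring.left_idealI[OF ring_opposite]; simp?)
      show "H \<subseteq> carrier R" by (auto simp: H_def)
      show "\<zero> \<in> H" using pc by (simp add: H_def)
      show "x \<oplus> y \<in> H" if "x \<in> H" "y \<in> H" for x y
        using that pc by (simp add: H_def l_distr)
      show "x \<otimes> r \<in> H" if r: "r \<in> carrier R" and x: "x \<in> H" for r x
      proof -
        obtain t where t: "t \<in> carrier R" "r \<otimes> p [^] k = p [^] k \<otimes> t" using normal_left[OF r] by blast
        have xc: "x \<in> carrier R" and x0: "x \<otimes> p [^] k = \<zero>" using x by (auto simp: H_def)
        have "x \<otimes> r \<otimes> p [^] k = x \<otimes> (p [^] k \<otimes> t)"
          unfolding t(2)[symmetric] using xc r pc by (simp add: m_assoc)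
        also have "\<dots> = (x \<otimes> p [^] k) \<otimes> t" using xc t(1) pc by (simp add: m_assoc)
        also have "\<dots> = \<zero>" unfolding x0 using t(1) by simp
        finally have "x \<otimes> r \<otimes> p [^] k = \<zero>" .
        thus ?thesis using x r t by (simp add: H_def)
      qed
    qed
  qed
  moreover have "s \<in> H" using s by (simp add: H_def)
  ultimately obtain h j where h: "h \<in> H" "j \<in> J" "\<one> = h \<oplus> j"
    using ideal_not_le_J s(2) by blast
  have jc: "j \<in> carrier R" by (rule J_carrier[OF h(2)])
  have "p [^] k = (h \<oplus> j) \<otimes> p [^] k" using pc h(3)[symmetric] by simp
  also have "\<dots> = j \<otimes> p [^] k" using h(1) jc pc by (simp add: H_def l_distr)
  finally show ?thesis using nilpotent_fixes_zero[OF jc J_nilpotent[OF h(2)] pc] by blast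
qed

text \<open>Climb through the powers of the radical: if \<open>x = s p^i\<close> annihilates
  \<open>p^k\<close> and \<open>p^(i+k)\<close> is nonzero, then \<open>s\<close> lies in
  \<open>J\<close>, so \<open>x\<close> lies in \<open>J^(i+1)\<close>.\<close>

lemma annihilator_p_pow:
  assumes x: "x \<in> carrier R" "x \<otimes> p [^] k = \<zero>" and k: "k \<le> nil_index"
  shows "x \<in> Jpow (nil_index - k)"
proof -
  have "i \<le> nil_index - k \<Longrightarrow> x \<in> Jpow i" for i
  proof (induction i)
    case 0
    then show ?case using x(1) by (simp add: Jpow_0)
  next
    case (Suc i)
    then obtain s where s: "s \<in> carrier R" "x = s \<otimes> p [^] i" by (auto simp: mem_cgenideal)
    have "s \<otimes> p [^] (i + k) = \<zero>"
      using x(2) s p by (simp add: m_assoc nat_pow_mult)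
    moreover have "p [^] (i + k) \<noteq> \<zero>" using Suc.prems k by (intro p_pow_less_nil_index) simp
    ultimately have "s \<in> J" using annihilates_p_pow[OF s(1)] by blast
    thus ?case unfolding s(2) by (intro J_Jpow cgenideal_self pc)
  qed
  thus ?thesis by simp
qed

text \<open>The last clause says that the corner ring \<open>eRe\<close> is local, with
  \<open>J\<close> cutting out its maximal ideal. Stated this way, primitivity directly provides the
  inverses that elimination with a pivot requires.\<close>

definition prim :: "'a \<Rightarrow> bool" where
  "prim e \<longleftrightarrow> e \<in> carrier R \<and> e \<otimes> e = e \<and> e \<notin> J \<and>
    (\<forall>x\<in>carrier R. e \<otimes> x = x \<and> x \<otimes> e = x \<and> x \<notin> J \<longrightarrow>
      (\<exists>y\<in>carrier R. e \<otimes> y = y \<and> y \<otimes> e = y \<and> x \<otimes> y = e \<and> y \<otimes> x = e))"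

lemma prim_opposite: "special_ring.prim (opposite_ring R) J e = prim e"
  unfolding prim_def special_ring.prim_def[OF opposite] by auto

lemma nil_index_opposite: "special_ring.nil_index (opposite_ring R) p = nil_index"
  unfolding nil_index_def special_ring.nil_index_def[OF opposite] using p by simp

text \<open>Since \<open>R/J\<close> is simple, \<open>eRx\<close> is not contained in
  \<open>J\<close>, so \<open>eux\<close> lies outside \<open>J\<close> for some \<open>u\<close>.
  It belongs to \<open>eRe\<close> because \<open>x = xe\<close>, hence it is invertible
  there.\<close>

lemma prim_left:
  assumes e: "prim e" and x: "x \<in> carrier R" "x \<otimes> e = x" "x \<notin> J"
  obtains t where "t \<in> carrier R" "t \<otimes> x = e"
proof -
  have ec: "e \<in> carrier R" and ee: "e \<otimes> e = e" and eJ: "e \<notin> J" using e by (auto simp: prim_def)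
  define H where "H = {s \<in> carrier R. \<forall>u\<in>carrier R. s \<otimes> (u \<otimes> x) \<in> J}"
  have H: "ideal H R"
  proof (rule ideal_intro)
    show "H \<subseteq> carrier R" by (auto simp: H_def)
    show "\<zero> \<in> H" using left_ideal_zero[OF Jl] x by (simp add: H_def)
    show "y \<oplus> z \<in> H" if "y \<in> H" "z \<in> H" for y z
      using that x left_ideal_add[OF Jl] by (simp add: H_def l_distr)
    show "r \<otimes> y \<in> H" if "r \<in> carrier R" "y \<in> H" for r y
      using that x J_lmult by (simp add: H_def m_assoc)
    show "y \<otimes> r \<in> H" if r: "r \<in> carrier R" and y: "y \<in> H" for r y
    proof -
      have "y \<otimes> r \<otimes> (u \<otimes> x) \<in> J" if u: "u \<in> carrier R" for u
      proof -
        have "y \<otimes> ((r \<otimes> u) \<otimes> x) \<in> J" using y r u by (simp add: H_def)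
        thus ?thesis using y r u x(1) by (simp add: H_def m_assoc)
      qed
      thus ?thesis using y r by (simp add: H_def)
    qed
  qed
  have "e \<notin> H"
  proof
    assume "e \<in> H"
    then obtain h j where h: "h \<in> H" "j \<in> J" "\<one> = h \<oplus> j" using ideal_not_le_J[OF H] eJ by blast
    have "h \<otimes> (\<one> \<otimes> x) \<in> J" using h(1) by (simp add: H_def)
    hence "h \<otimes> x \<oplus> j \<otimes> x \<in> J" using J_rmult[OF x(1) h(2)] left_ideal_add[OF Jl] x(1) by simp
    moreover have "h \<otimes> x \<oplus> j \<otimes> x = (h \<oplus> j) \<otimes> x"
      using h J_carrier x(1) by (simp add: H_def l_distr)
    ultimately show False using x h(3)[symmetric] by simp
  qed
  then obtain u where u: "u \<in> carrier R" "e \<otimes> (u \<otimes> x) \<notin> J" using ec by (auto simp: H_def)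
  have 1: "e \<otimes> (e \<otimes> (u \<otimes> x)) = e \<otimes> (u \<otimes> x)" using ee ec u(1) x(1) by (metis m_assoc m_closed)
  have 2: "e \<otimes> (u \<otimes> x) \<otimes> e = e \<otimes> (u \<otimes> x)" using x ec u(1) by (simp add: m_assoc)
  obtain y where y: "y \<in> carrier R" "y \<otimes> (e \<otimes> (u \<otimes> x)) = e"
    using e u 1 2 x(1) unfolding prim_def by (metis m_closed)
  have "(y \<otimes> (e \<otimes> u)) \<otimes> x = e" using y ec u x(1) by (simp add: m_assoc)
  thus thesis using that[of "y \<otimes> (e \<otimes> u)"] y(1) ec u(1) by simp
qed

lemma prim_right:
  assumes e: "prim e" and x: "x \<in> carrier R" "e \<otimes> x = x" "x \<notin> J"
  obtains t where "t \<in> carrier R" "x \<otimes> t = e"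
  using special_ring.prim_left[OF opposite, of e x] assms prim_opposite by auto

text \<open>The \<open>J\<close>-adic order of \<open>q\<close>. The guard gives zero, and nothing
  else, the order \<open>nil_index\<close>; zero lies in every power of \<open>J\<close> and would
  otherwise have no order.\<close>

definition ord :: "nat \<Rightarrow> 'a \<Rightarrow> bool" where
  "ord r q \<longleftrightarrow> r \<le> nil_index \<and> q \<in> Jpow r \<and> (r < nil_index \<longrightarrow> q \<notin> Jpow (Suc r))"

lemma ord_opposite: "special_ring.ord (opposite_ring R) p r q = ord r q"
  unfolding ord_def special_ring.ord_def[OF opposite] nil_index_opposite nat_pow_opposite[OF p] Jpow_opposite ..

text \<open>Uniseriality of the left module \<open>Re\<close>: an element of order \<open>r\<close>
  generates all of \<open>J^r e\<close>. Write \<open>q = p^r y\<close> with \<open>ye\<close>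
  outside \<open>J\<close>; \<open>prim_left\<close> reduces \<open>ye\<close> to \<open>e\<close>,
  and the multiplier used for this is carried past \<open>p^r\<close> by normality.\<close>

lemma prim_generates_left:
  assumes e: "prim e" and q: "ord r q" "q \<otimes> e = q" and x: "x \<in> Jpow r" "x \<otimes> e = x"
  obtains s where "s \<in> carrier R" "x = s \<otimes> q"
proof (cases "r < nil_index")
  case False
  hence "r = nil_index" using q(1) by (simp add: ord_def)
  hence "x = \<zero>" "q = \<zero>" using x(1) q(1) Jpow_nil_index by (auto simp: ord_def)
  thus thesis using that[of \<zero>] by simp
next
  case True
  have ec: "e \<in> carrier R" using e by (simp add: prim_def)
  obtain y where y: "y \<in> carrier R" "q = p [^] r \<otimes> y"
    using q(1) unfolding ord_def mem_Jpow_right by blast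
  have qy: "q = p [^] r \<otimes> (y \<otimes> e)" using q(2) y ec pc by (metis m_assoc)
  have "y \<otimes> e \<notin> J"
  proof
    assume "y \<otimes> e \<in> J"
    hence "q \<in> Jpow (Suc r)" unfolding qy by (rule Jpow_J) (rule cgenideal_self[OF pc])
    thus False using q(1) True by (simp add: ord_def)
  qed
  moreover have "y \<otimes> e \<otimes> e = y \<otimes> e" using y(1) ec e by (simp add: m_assoc prim_def)
  ultimately obtain t where t: "t \<in> carrier R" "t \<otimes> (y \<otimes> e) = e"
    using prim_left[OF e, of "y \<otimes> e"] y(1) ec by auto
  obtain w where w: "w \<in> carrier R" "x = w \<otimes> p [^] r" using x(1) by (auto simp: mem_cgenideal)
  obtain t' where t': "t' \<in> carrier R" "p [^] r \<otimes> t = t' \<otimes> p [^] r" using normal_right[OF t(1)] by blast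
  have "x = w \<otimes> p [^] r \<otimes> e" using x(2) w by simp
  also have "\<dots> = w \<otimes> p [^] r \<otimes> (t \<otimes> (y \<otimes> e))" using t(2) by simp
  also have "\<dots> = w \<otimes> (p [^] r \<otimes> t) \<otimes> (y \<otimes> e)" using w(1) t(1) y(1) ec pc by (simp add: m_assoc)
  also have "\<dots> = w \<otimes> t' \<otimes> q" unfolding t'(2) qy using w(1) t'(1) y(1) ec pc by (simp add: m_assoc)
  finally show thesis using that w(1) t'(1) by blast
qed

lemma prim_generates_right:
  assumes e: "prim e" and q: "ord r q" "e \<otimes> q = q" and x: "x \<in> Jpow r" "e \<otimes> x = x"
  obtains s where "s \<in> carrier R" "x = q \<otimes> s"
  using special_ring.prim_generates_left[OF opposite, of e r q x] assms prim_opposite ord_opposite p Jpow_opposite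
  by auto

text \<open>With \<open>q = y p^r\<close> and \<open>ey\<close> outside \<open>J\<close>, inverting
  \<open>ey\<close> from the right and moving the inverse past \<open>p^r\<close> gives
  \<open>q t' = e p^r\<close>. So what annihilates \<open>q\<close> also annihilates
  \<open>p^r\<close>, and \<open>annihilator_p_pow\<close> applies.\<close>

lemma prim_annihilator:
  assumes e: "prim e" and q: "ord r q" "e \<otimes> q = q" and z: "z \<in> carrier R" "z \<otimes> e = z"
  shows "z \<otimes> q = \<zero> \<longleftrightarrow> z \<in> Jpow (nil_index - r)"
proof
  have rm: "r \<le> nil_index" and qr: "q \<in> Jpow r" using q(1) by (auto simp: ord_def)
  have ec: "e \<in> carrier R" using e by (simp add: prim_def)
  assume "z \<in> Jpow (nil_index - r)"
  hence "z \<otimes> q \<in> Jpow (nil_index - r + r)" by (rule Jpow_mult[OF _ qr])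
  thus "z \<otimes> q = \<zero>" using rm Jpow_nil_index by simp
next
  have rm: "r \<le> nil_index" and qr: "q \<in> Jpow r" using q(1) by (auto simp: ord_def)
  have ec: "e \<in> carrier R" using e by (simp add: prim_def)
  assume zq: "z \<otimes> q = \<zero>"
  show "z \<in> Jpow (nil_index - r)"
  proof (cases "r < nil_index")
    case False
    thus ?thesis using z(1) rm by (simp add: Jpow_0)
  next
    case True
    obtain y where y: "y \<in> carrier R" "q = y \<otimes> p [^] r" using qr by (auto simp: mem_cgenideal)
    have qy: "q = (e \<otimes> y) \<otimes> p [^] r" using q(2) y ec pc by (metis m_assoc)
    have "e \<otimes> y \<notin> J"
    proof
      assume "e \<otimes> y \<in> J"
      hence "q \<in> Jpow (Suc r)" unfolding qy by (rule J_Jpow) (rule cgenideal_self[OF pc])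
      thus False using q(1) True by (simp add: ord_def)
    qed
    moreover have "e \<otimes> (e \<otimes> y) = e \<otimes> y" using y(1) ec e by (simp add: prim_def flip: m_assoc)
    ultimately obtain t where t: "t \<in> carrier R" "(e \<otimes> y) \<otimes> t = e"
      using prim_right[OF e, of "e \<otimes> y"] y(1) ec by auto
    obtain t' where t': "t' \<in> carrier R" "t \<otimes> p [^] r = p [^] r \<otimes> t'" using normal_left[OF t(1)] by blast
    have "q \<otimes> t' = (e \<otimes> y) \<otimes> (p [^] r \<otimes> t')" unfolding qy using ec y(1) t'(1) pc by (simp add: m_assoc)
    also have "\<dots> = ((e \<otimes> y) \<otimes> t) \<otimes> p [^] r" unfolding t'(2)[symmetric] using ec y(1) t(1) pc by (simp add: m_assoc)
    also have "\<dots> = e \<otimes> p [^] r" using t(2) by simp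
    finally have qt': "q \<otimes> t' = e \<otimes> p [^] r" .
    have qc: "q \<in> carrier R" by (rule Jpow_carrier[OF qr])
    have "z \<otimes> p [^] r = z \<otimes> (q \<otimes> t')" unfolding qt' using z ec pc by (simp flip: m_assoc)
    also have "\<dots> = \<zero>" using zq z(1) qc t'(1) by (simp flip: m_assoc)
    finally show ?thesis using annihilator_p_pow[OF z(1) _ rm] by blast
  qed
qed

text \<open>Every block \<open>e'Re\<close> has elements of each order below
  \<open>nil_index\<close>. Otherwise the \<open>y\<close> with \<open>e'R p^r y\<close> inside
  \<open>J^(r+1)\<close> form an ideal that contains \<open>e\<close> and so is not inside
  \<open>J\<close>; it follows that \<open>e' p^r\<close> lies in \<open>R p^(r+1)\<close>, and
  cancelling \<open>p^r\<close> puts \<open>e'\<close> into \<open>J\<close>.\<close>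

lemma prim_connect:
  assumes e: "prim e" and e': "prim e'" and r: "r < nil_index"
  obtains q where "q \<in> Jpow r" "e' \<otimes> q = q" "q \<otimes> e = q" "q \<notin> Jpow (Suc r)"
proof -
  have ec: "e \<in> carrier R" and ee: "e \<otimes> e = e" and eJ: "e \<notin> J" using e by (auto simp: prim_def)
  have ec': "e' \<in> carrier R" and ee': "e' \<otimes> e' = e'" and eJ': "e' \<notin> J" using e' by (auto simp: prim_def)
  note pr = pc[of r]
  define H where "H = {y \<in> carrier R. \<forall>s\<in>carrier R. e' \<otimes> (s \<otimes> (p [^] r \<otimes> y)) \<in> Jpow (Suc r)}"
  note J1 = Jpow_left_ideal[of "Suc r"]
  have H: "ideal H R"
  proof (rule ideal_intro)
    show "H \<subseteq> carrier R" by (auto simp: H_def)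
    show "\<zero> \<in> H" using left_ideal_zero[OF J1] ec' pr by (simp add: H_def)
    show "y \<oplus> z \<in> H" if "y \<in> H" "z \<in> H" for y z
      using that ec' pr left_ideal_add[OF J1] by (simp add: H_def r_distr)
    show "u \<otimes> y \<in> H" if u: "u \<in> carrier R" and y: "y \<in> H" for u y
    proof -
      obtain u' where u': "u' \<in> carrier R" "p [^] r \<otimes> u = u' \<otimes> p [^] r" using normal_right[OF u] by blast
      have "e' \<otimes> (s \<otimes> (p [^] r \<otimes> (u \<otimes> y))) \<in> Jpow (Suc r)" if s: "s \<in> carrier R" for s
      proof -
        have "p [^] r \<otimes> (u \<otimes> y) = u' \<otimes> (p [^] r \<otimes> y)"
          using u'(2) u u'(1) y pr by (simp add: H_def flip: m_assoc)
        moreover have "e' \<otimes> ((s \<otimes> u') \<otimes> (p [^] r \<otimes> y)) \<in> Jpow (Suc r)"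
          using y s u'(1) by (simp add: H_def)
        ultimately show ?thesis using y s u'(1) ec' pr by (simp add: H_def m_assoc)
      qed
      thus ?thesis using y u by (simp add: H_def)
    qed
    show "y \<otimes> u \<in> H" if u: "u \<in> carrier R" and y: "y \<in> H" for u y
    proof -
      have "e' \<otimes> (s \<otimes> (p [^] r \<otimes> (y \<otimes> u))) \<in> Jpow (Suc r)" if s: "s \<in> carrier R" for s
      proof -
        have "e' \<otimes> (s \<otimes> (p [^] r \<otimes> y)) \<otimes> u \<in> Jpow (Suc r)"
          using y s by (intro Jpow_rmult[OF u]) (simp add: H_def)
        thus ?thesis using y s u ec' pr by (simp add: H_def m_assoc)
      qed
      thus ?thesis using y u by (simp add: H_def)
    qed
  qed
  have "e \<notin> H"
  proof
    assume "e \<in> H"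
    then obtain h j where h: "h \<in> H" "j \<in> J" "\<one> = h \<oplus> j" using ideal_not_le_J[OF H] eJ by blast
    have hc: "h \<in> carrier R" and jc: "j \<in> carrier R" using h J_carrier by (auto simp: H_def)
    have 1: "e' \<otimes> (\<one> \<otimes> (p [^] r \<otimes> h)) \<in> Jpow (Suc r)" using h(1) by (simp add: H_def)
    have 2: "e' \<otimes> (p [^] r \<otimes> j) \<in> Jpow (Suc r)"
      by (intro Jpow_lmult[OF ec'] Jpow_J[OF h(2)] cgenideal_self pr)
    have "e' \<otimes> p [^] r = e' \<otimes> (p [^] r \<otimes> (h \<oplus> j))" using h(3)[symmetric] pr by simp
    also have "\<dots> = e' \<otimes> (\<one> \<otimes> (p [^] r \<otimes> h)) \<oplus> e' \<otimes> (p [^] r \<otimes> j)" using ec' pr hc jc by algebra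
    finally have "e' \<otimes> p [^] r \<in> Jpow (Suc r)" using left_ideal_add[OF J1 1 2] by simp
    then obtain s where s: "s \<in> carrier R" "e' \<otimes> p [^] r = s \<otimes> p [^] Suc r" by (auto simp: mem_cgenideal)
    have "e' \<otimes> p [^] r = s \<otimes> p \<otimes> p [^] r" unfolding s(2) using s(1) p nat_pow_Suc2[OF p, of r] by (simp add: m_assoc)
    hence "(e' \<ominus> s \<otimes> p) \<otimes> p [^] r = \<zero>" using ec' s(1) p pr by (simp add: minus_eq l_distr l_minus r_neg)
    hence "e' \<ominus> s \<otimes> p \<in> J" using annihilates_p_pow[of "e' \<ominus> s \<otimes> p" r] p_pow_less_nil_index[OF r] ec' s(1) p by auto
    thus False using left_ideal_minus_iff[OF Jl J_lmult[OF s(1) p_in_J] ec'] eJ' by simp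
  qed
  then obtain s where s: "s \<in> carrier R" "e' \<otimes> (s \<otimes> (p [^] r \<otimes> e)) \<notin> Jpow (Suc r)"
    using ec by (auto simp: H_def)
  have "e' \<otimes> (e' \<otimes> (s \<otimes> (p [^] r \<otimes> e))) = e' \<otimes> (s \<otimes> (p [^] r \<otimes> e))"
    using ec' ee' s(1) pr ec by (metis m_assoc m_closed)
  moreover have "e' \<otimes> (s \<otimes> (p [^] r \<otimes> e)) \<otimes> e = e' \<otimes> (s \<otimes> (p [^] r \<otimes> e))"
    using ec' ee s(1) pr ec by (simp add: m_assoc)
  moreover have "e' \<otimes> (s \<otimes> (p [^] r \<otimes> e)) \<in> Jpow r"
    by (intro Jpow_lmult[OF ec'] Jpow_lmult[OF s(1)] Jpow_rmult[OF ec] cgenideal_self pr)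
  ultimately show thesis using that s(2) by blast
qed

end

section \<open>Diagonalisation\<close>

context ring
begin

text \<open>For \<open>f = g = 1\<close> this says that \<open>b\<close> witnesses that \<open>a\<close> is left morphic.  The idempotents make the
  notion additive along orthogonal decompositions of \<open>1\<close>.\<close>

definition morphic_pair :: "'a \<Rightarrow> 'a \<Rightarrow> 'a \<Rightarrow> 'a \<Rightarrow> bool" where
  "morphic_pair f g a b \<longleftrightarrow> a \<in> carrier R \<and> b \<in> carrier R \<and>
    f \<otimes> a = a \<and> a \<otimes> g = a \<and> g \<otimes> b = b \<and> b \<otimes> f = b \<and>
    (\<forall>z\<in>carrier R. z \<otimes> f = z \<longrightarrow> (z \<otimes> a = \<zero> \<longleftrightarrow> (\<exists>s\<in>carrier R. z = s \<otimes> b))) \<and>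
    (\<forall>z\<in>carrier R. z \<otimes> g = z \<longrightarrow> (z \<otimes> b = \<zero> \<longleftrightarrow> (\<exists>s\<in>carrier R. z = s \<otimes> a)))"

lemma morphic_pair_sym: "morphic_pair f g a b \<Longrightarrow> morphic_pair g f b a"
  by (auto simp: morphic_pair_def)

text \<open>The summands live in the orthogonal blocks \<open>eRd\<close> and \<open>fRg\<close>.
  Right multiplication by \<open>d\<close> and \<open>g\<close> separates the two parts of a product
  with \<open>q \<oplus> a\<close>; right multiplication by \<open>e\<close> and \<open>f\<close>
  separates those of a multiple of \<open>b \<oplus> b'\<close>. The other half of the additivity
  arises by exchanging the roles of the partners.\<close>

lemma morphic_pair_add_aux:
  assumes c: "e \<in> carrier R" "f \<in> carrier R" "d \<in> carrier R" "g \<in> carrier R"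
    and e: "e \<otimes> e = e" and f: "f \<otimes> f = f" and ef: "e \<otimes> f = \<zero>" "f \<otimes> e = \<zero>"
    and d: "d \<otimes> d = d" and g: "g \<otimes> g = g" and dg: "d \<otimes> g = \<zero>" "g \<otimes> d = \<zero>"
    and q: "morphic_pair e d q b" and a: "morphic_pair f g a b'"
    and z: "z \<in> carrier R" "z \<otimes> (e \<oplus> f) = z"
  shows "z \<otimes> (q \<oplus> a) = \<zero> \<longleftrightarrow> (\<exists>s\<in>carrier R. z = s \<otimes> (b \<oplus> b'))"
proof -
  have qc: "q \<in> carrier R" "b \<in> carrier R" and qe: "e \<otimes> q = q" "q \<otimes> d = q" "d \<otimes> b = b" "b \<otimes> e = b"
    and q1: "\<And>z. z \<in> carrier R \<Longrightarrow> z \<otimes> e = z \<Longrightarrow> z \<otimes> q = \<zero> \<longleftrightarrow> (\<exists>s\<in>carrier R. z = s \<otimes> b)"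
    using q by (auto simp: morphic_pair_def)
  have ac: "a \<in> carrier R" "b' \<in> carrier R" and af: "f \<otimes> a = a" "a \<otimes> g = a" "g \<otimes> b' = b'" "b' \<otimes> f = b'"
    and a1: "\<And>z. z \<in> carrier R \<Longrightarrow> z \<otimes> f = z \<Longrightarrow> z \<otimes> a = \<zero> \<longleftrightarrow> (\<exists>s\<in>carrier R. z = s \<otimes> b')"
    using a by (auto simp: morphic_pair_def)
  have ze: "z \<otimes> e \<otimes> e = z \<otimes> e" and zf: "z \<otimes> f \<otimes> f = z \<otimes> f"
    using z(1) c e f by (simp_all add: m_assoc)
  have zef: "z = z \<otimes> e \<oplus> z \<otimes> f" using z c by (simp add: r_distr)
  have zeq: "z \<otimes> e \<otimes> q = z \<otimes> q" and zfa: "z \<otimes> f \<otimes> a = z \<otimes> a"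
    using z(1) c qe(1) af(1) qc(1) ac(1) by (simp_all add: m_assoc)
  have be': "b' \<otimes> e = \<zero>" using af(4) ac(2) c ef(2) by (metis m_assoc r_null)
  have bf: "b \<otimes> f = \<zero>" using qe(4) qc(2) c ef(1) by (metis m_assoc r_null)
  have db': "d \<otimes> b' = \<zero>" using af(3) ac(2) c dg(1) by (metis m_assoc l_null)
  have gb: "g \<otimes> b = \<zero>" using qe(3) qc(2) c dg(2) by (metis m_assoc l_null)
  have ad: "a \<otimes> d = \<zero>" using af(2) ac(1) c dg(2) by (metis m_assoc r_null)
  have qg: "q \<otimes> g = \<zero>" using qe(2) qc(1) c dg(1) by (metis m_assoc r_null)
  have "z \<otimes> (q \<oplus> a) = \<zero> \<longleftrightarrow> z \<otimes> q = \<zero> \<and> z \<otimes> a = \<zero>"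
  proof
    assume 0: "z \<otimes> (q \<oplus> a) = \<zero>"
    have "z \<otimes> (q \<oplus> a) \<otimes> d = z \<otimes> (q \<otimes> d \<oplus> a \<otimes> d)"
      using z(1) qc ac c by (simp add: l_distr m_assoc)
    hence "z \<otimes> q = \<zero>" unfolding 0 qe(2) ad using z(1) qc c by simp
    moreover have "z \<otimes> (q \<oplus> a) \<otimes> g = z \<otimes> (q \<otimes> g \<oplus> a \<otimes> g)"
      using z(1) qc ac c by (simp add: l_distr m_assoc)
    hence "z \<otimes> a = \<zero>" unfolding 0 af(2) qg using z(1) ac c by simp
    ultimately show "z \<otimes> q = \<zero> \<and> z \<otimes> a = \<zero>" by simp
  qed (use z qc ac in \<open>simp add: r_distr\<close>)
  also have "\<dots> \<longleftrightarrow> (\<exists>s\<in>carrier R. z \<otimes> e = s \<otimes> b) \<and> (\<exists>s\<in>carrier R. z \<otimes> f = s \<otimes> b')"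
    using q1[of "z \<otimes> e"] a1[of "z \<otimes> f"] ze zf zeq zfa z(1) c by simp
  also have "\<dots> \<longleftrightarrow> (\<exists>s\<in>carrier R. z = s \<otimes> (b \<oplus> b'))"
  proof
    assume "(\<exists>s\<in>carrier R. z \<otimes> e = s \<otimes> b) \<and> (\<exists>s\<in>carrier R. z \<otimes> f = s \<otimes> b')"
    then obtain s t where s: "s \<in> carrier R" "z \<otimes> e = s \<otimes> b" and t: "t \<in> carrier R" "z \<otimes> f = t \<otimes> b'" by blast
    have "(s \<otimes> d \<oplus> t \<otimes> g) \<otimes> (b \<oplus> b')
      = s \<otimes> (d \<otimes> b) \<oplus> s \<otimes> (d \<otimes> b') \<oplus> (t \<otimes> (g \<otimes> b) \<oplus> t \<otimes> (g \<otimes> b'))"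
      using s(1) t(1) c qc ac by (simp add: l_distr r_distr m_assoc a_ac)
    also have "\<dots> = s \<otimes> b \<oplus> t \<otimes> b'" unfolding qe af db' gb using s(1) t(1) qc ac by simp
    also have "\<dots> = z" using zef s(2) t(2) by simp
    finally show "\<exists>s\<in>carrier R. z = s \<otimes> (b \<oplus> b')"
      using s(1) t(1) c by (intro bexI[of _ "s \<otimes> d \<oplus> t \<otimes> g"]) simp_all
  next
    assume "\<exists>s\<in>carrier R. z = s \<otimes> (b \<oplus> b')"
    then obtain s where s: "s \<in> carrier R" "z = s \<otimes> (b \<oplus> b')" by blast
    have "z \<otimes> e = s \<otimes> (b \<otimes> e \<oplus> b' \<otimes> e)" unfolding s(2) using s(1) qc ac c by (simp add: l_distr m_assoc)
    hence "z \<otimes> e = s \<otimes> b" unfolding qe be' using qc by simp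
    moreover have "z \<otimes> f = s \<otimes> (b \<otimes> f \<oplus> b' \<otimes> f)" unfolding s(2) using s(1) qc ac c by (simp add: l_distr m_assoc)
    hence "z \<otimes> f = s \<otimes> b'" unfolding af bf using ac by simp
    ultimately show "(\<exists>s\<in>carrier R. z \<otimes> e = s \<otimes> b) \<and> (\<exists>s\<in>carrier R. z \<otimes> f = s \<otimes> b')"
      using s(1) by blast
  qed
  finally show ?thesis .
qed

lemma morphic_pair_add:
  assumes c: "e \<in> carrier R" "f \<in> carrier R" "d \<in> carrier R" "g \<in> carrier R"
    and e: "e \<otimes> e = e" and f: "f \<otimes> f = f" and ef: "e \<otimes> f = \<zero>" "f \<otimes> e = \<zero>"
    and d: "d \<otimes> d = d" and g: "g \<otimes> g = g" and dg: "d \<otimes> g = \<zero>" "g \<otimes> d = \<zero>"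
    and q: "morphic_pair e d q b" and a: "morphic_pair f g a b'"
  shows "morphic_pair (e \<oplus> f) (d \<oplus> g) (q \<oplus> a) (b \<oplus> b')"
proof -
  have mult: "(u \<oplus> v) \<otimes> (x \<oplus> y) = x \<oplus> y \<and> (x \<oplus> y) \<otimes> (s \<oplus> t) = x \<oplus> y"
    if "u \<in> carrier R" "v \<in> carrier R" "s \<in> carrier R" "t \<in> carrier R" "x \<in> carrier R" "y \<in> carrier R"
      "u \<otimes> x = x" "v \<otimes> y = y" "u \<otimes> v = \<zero>" "v \<otimes> u = \<zero>" "x \<otimes> s = x" "y \<otimes> t = y" "s \<otimes> t = \<zero>" "t \<otimes> s = \<zero>"
    for u v s t x y
  proof
    have "u \<otimes> y = \<zero>" using that(1,2,6,8,9) by (metis m_assoc l_null)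
    moreover have "v \<otimes> x = \<zero>" using that(1,2,5,7,10) by (metis m_assoc l_null)
    ultimately show "(u \<oplus> v) \<otimes> (x \<oplus> y) = x \<oplus> y" using that by (simp add: l_distr r_distr)
    have "x \<otimes> t = \<zero>" using that(3,4,5,11,13) by (metis m_assoc r_null)
    moreover have "y \<otimes> s = \<zero>" using that(3,4,6,12,14) by (metis m_assoc r_null)
    ultimately show "(x \<oplus> y) \<otimes> (s \<oplus> t) = x \<oplus> y" using that by (simp add: l_distr r_distr)
  qed
  have qc: "q \<in> carrier R" "b \<in> carrier R" "e \<otimes> q = q" "q \<otimes> d = q" "d \<otimes> b = b" "b \<otimes> e = b"
    using q by (auto simp: morphic_pair_def)
  have ac: "a \<in> carrier R" "b' \<in> carrier R" "f \<otimes> a = a" "a \<otimes> g = a" "g \<otimes> b' = b'" "b' \<otimes> f = b'"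
    using a by (auto simp: morphic_pair_def)
  note m1 = mult[of e f d g q a, OF c qc(1) ac(1) qc(3) ac(3) ef qc(4) ac(4) dg]
  note m2 = mult[of d g e f b b', OF c(3,4,1,2) qc(2) ac(2) qc(5) ac(5) dg qc(6) ac(6) ef]
  show ?thesis
    unfolding morphic_pair_def
    using m1 m2 qc(1,2) ac(1,2) morphic_pair_add_aux[OF c e f ef d g dg q a]
      morphic_pair_add_aux[OF c(3,4,1,2) d g dg e f ef morphic_pair_sym[OF q] morphic_pair_sym[OF a]]
    by simp
qed

text \<open>Here \<open>u\<close> and \<open>v\<close> are units of the corner rings of
  \<open>f\<close> and \<open>g\<close>. An element \<open>z\<close> kills \<open>a\<close> iff
  \<open>zu'\<close> kills \<open>uav\<close>, iff \<open>zu'\<close> lies in \<open>Rb\<close>, iff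
  \<open>z\<close> lies in \<open>Rbu = R(vbu)\<close>. Elementary row and column operations are
  thus permitted.\<close>

lemma morphic_pair_units:
  assumes c: "a \<in> carrier R" "f \<in> carrier R" "g \<in> carrier R" "f \<otimes> a = a" "a \<otimes> g = a"
    and u: "u \<in> carrier R" "u' \<in> carrier R" "u \<otimes> u' = f" "u' \<otimes> u = f" "f \<otimes> u = u" "u \<otimes> f = u" "u' \<otimes> f = u'"
    and v: "v \<in> carrier R" "v' \<in> carrier R" "v \<otimes> v' = g" "v' \<otimes> v = g" "g \<otimes> v = v" "v \<otimes> g = v"
    and mp: "morphic_pair f g (u \<otimes> a \<otimes> v) b"
  shows "morphic_pair f g a (v \<otimes> b \<otimes> u)"
proof -
  have bc: "b \<in> carrier R" "g \<otimes> b = b" "b \<otimes> f = b"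
    and m1: "\<And>z. z \<in> carrier R \<Longrightarrow> z \<otimes> f = z \<Longrightarrow> z \<otimes> (u \<otimes> a \<otimes> v) = \<zero> \<longleftrightarrow> (\<exists>s\<in>carrier R. z = s \<otimes> b)"
    and m2: "\<And>z. z \<in> carrier R \<Longrightarrow> z \<otimes> g = z \<Longrightarrow> z \<otimes> b = \<zero> \<longleftrightarrow> (\<exists>s\<in>carrier R. z = s \<otimes> (u \<otimes> a \<otimes> v))"
    using mp by (auto simp: morphic_pair_def)
  have "z \<otimes> a = \<zero> \<longleftrightarrow> (\<exists>s\<in>carrier R. z = s \<otimes> (v \<otimes> b \<otimes> u))" if z: "z \<in> carrier R" "z \<otimes> f = z" for z
  proof -
    have eq: "z \<otimes> u' \<otimes> (u \<otimes> a \<otimes> v) = z \<otimes> a \<otimes> v"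
    proof -
      have "z \<otimes> u' \<otimes> (u \<otimes> a \<otimes> v) = z \<otimes> (u' \<otimes> u) \<otimes> a \<otimes> v" using z(1) u(1,2) v(1) c(1) by (simp add: m_assoc)
      thus ?thesis using u(4) z by simp
    qed
    have cancel: "z \<otimes> a = z \<otimes> a \<otimes> v \<otimes> v'" using z c v by (simp add: m_assoc)
    have "z \<otimes> a = \<zero> \<longleftrightarrow> z \<otimes> u' \<otimes> (u \<otimes> a \<otimes> v) = \<zero>"
      unfolding eq using cancel v(1,2) by auto
    also have "\<dots> \<longleftrightarrow> (\<exists>s\<in>carrier R. z \<otimes> u' = s \<otimes> b)"
    proof (rule m1)
      show "z \<otimes> u' \<otimes> f = z \<otimes> u'" using z(1) u(2,7) c(2) by (simp add: m_assoc)
    qed (use z(1) u(2) in simp)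
    also have "\<dots> \<longleftrightarrow> (\<exists>s\<in>carrier R. z = s \<otimes> (v \<otimes> b \<otimes> u))"
    proof
      assume "\<exists>s\<in>carrier R. z \<otimes> u' = s \<otimes> b"
      then obtain s where s: "s \<in> carrier R" "z \<otimes> u' = s \<otimes> b" by blast
      have "z = z \<otimes> u' \<otimes> u" using z u by (simp add: m_assoc)
      also have "\<dots> = s \<otimes> (g \<otimes> b) \<otimes> u" unfolding s(2) bc(2) ..
      also have "\<dots> = s \<otimes> v' \<otimes> (v \<otimes> b \<otimes> u)"
        unfolding v(4)[symmetric] using s(1) v(1,2) bc(1) u(1) by (simp add: m_assoc)
      finally show "\<exists>s\<in>carrier R. z = s \<otimes> (v \<otimes> b \<otimes> u)" using s(1) v(2) by blast
    next
      assume "\<exists>s\<in>carrier R. z = s \<otimes> (v \<otimes> b \<otimes> u)"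
      then obtain s where s: "s \<in> carrier R" "z = s \<otimes> (v \<otimes> b \<otimes> u)" by blast
      have "z \<otimes> u' = s \<otimes> v \<otimes> (b \<otimes> (u \<otimes> u'))" unfolding s(2) using s(1) v(1) bc(1) u(1,2) by (simp add: m_assoc)
      hence "z \<otimes> u' = s \<otimes> v \<otimes> b" unfolding u(3) bc(3) .
      thus "\<exists>s\<in>carrier R. z \<otimes> u' = s \<otimes> b" using s(1) v(1) by blast
    qed
    finally show ?thesis .
  qed
  moreover have "z \<otimes> (v \<otimes> b \<otimes> u) = \<zero> \<longleftrightarrow> (\<exists>s\<in>carrier R. z = s \<otimes> a)" if z: "z \<in> carrier R" "z \<otimes> g = z" for z
  proof -
    have cancel: "z \<otimes> v \<otimes> b = z \<otimes> (v \<otimes> b \<otimes> u) \<otimes> u'"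
    proof -
      have "z \<otimes> (v \<otimes> b \<otimes> u) \<otimes> u' = z \<otimes> v \<otimes> (b \<otimes> (u \<otimes> u'))" using z v(1) bc(1) u(1,2) by (simp add: m_assoc)
      thus ?thesis unfolding u(3) bc(3) by simp
    qed
    have fwd: "z \<otimes> (v \<otimes> b \<otimes> u) = z \<otimes> v \<otimes> b \<otimes> u" using z v(1) bc(1) u(1) by (simp add: m_assoc)
    have "z \<otimes> (v \<otimes> b \<otimes> u) = \<zero> \<longleftrightarrow> z \<otimes> v \<otimes> b = \<zero>"
      using cancel fwd u(1,2) by auto
    also have "\<dots> \<longleftrightarrow> (\<exists>s\<in>carrier R. z \<otimes> v = s \<otimes> (u \<otimes> a \<otimes> v))"
    proof (rule m2)
      show "z \<otimes> v \<otimes> g = z \<otimes> v" using z(1) v(1,6) c(3) by (simp add: m_assoc)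
    qed (use z(1) v(1) in simp)
    also have "\<dots> \<longleftrightarrow> (\<exists>s\<in>carrier R. z = s \<otimes> a)"
    proof
      assume "\<exists>s\<in>carrier R. z \<otimes> v = s \<otimes> (u \<otimes> a \<otimes> v)"
      then obtain s where s: "s \<in> carrier R" "z \<otimes> v = s \<otimes> (u \<otimes> a \<otimes> v)" by blast
      have "z = z \<otimes> v \<otimes> v'" using z v by (simp add: m_assoc)
      also have "\<dots> = s \<otimes> u \<otimes> (a \<otimes> (v \<otimes> v'))" unfolding s(2) using s(1) u(1) c(1) v(1,2) by (simp add: m_assoc)
      also have "\<dots> = s \<otimes> u \<otimes> a" unfolding v(3) c(5) ..
      finally show "\<exists>s\<in>carrier R. z = s \<otimes> a" using s(1) u(1) by blast
    next
      assume "\<exists>s\<in>carrier R. z = s \<otimes> a"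
      then obtain s where s: "s \<in> carrier R" "z = s \<otimes> a" by blast
      have "z \<otimes> v = s \<otimes> (f \<otimes> a) \<otimes> v" unfolding s(2) c(4) ..
      also have "\<dots> = s \<otimes> u' \<otimes> (u \<otimes> a \<otimes> v)"
        unfolding u(4)[symmetric] using s(1) u(1,2) c(1) v(1) by (simp add: m_assoc)
      finally show "\<exists>s\<in>carrier R. z \<otimes> v = s \<otimes> (u \<otimes> a \<otimes> v)" using s(1) u(2) by blast
    qed
    finally show ?thesis .
  qed
  moreover have "g \<otimes> (v \<otimes> b \<otimes> u) = v \<otimes> b \<otimes> u"
  proof -
    have "g \<otimes> (v \<otimes> b \<otimes> u) = (g \<otimes> v) \<otimes> b \<otimes> u" using c(3) v(1) bc(1) u(1) by (simp add: m_assoc)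
    thus ?thesis unfolding v(5) .
  qed
  moreover have "v \<otimes> b \<otimes> u \<otimes> f = v \<otimes> b \<otimes> u" using c(2) v(1) bc(1) u(1,6) by (simp add: m_assoc)
  ultimately show ?thesis
    unfolding morphic_pair_def using c v(1) bc(1) u(1) by simp
qed

text \<open>Admitting ideals of either side lets the same lemma sum over the rows of a decomposed
  element and, in the opposite ring, over its columns.\<close>

lemma finsum_mult_in_left_ideal:
  assumes "finite A" "A \<subseteq> carrier R" "x \<in> carrier R" "left_ideal I (opposite_ring R) \<or> left_ideal I R"
    "\<And>e. e \<in> A \<Longrightarrow> e \<otimes> x \<in> I"
  shows "finsum R (\<lambda>e. e) A \<otimes> x \<in> I"
  using assms
proof (induction A rule: finite_induct)
  case empty
  then show ?case using left_ideal_zero[of I R] left_ideal_zero[of I "opposite_ring R"] by auto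
next
  case (insert e A)
  have "finsum R (\<lambda>e. e) (insert e A) \<otimes> x = e \<otimes> x \<oplus> finsum R (\<lambda>e. e) A \<otimes> x"
    using insert by (subst finsum_insert) (auto simp: Pi_def l_distr subset_iff)
  moreover have "e \<otimes> x \<in> I" "finsum R (\<lambda>e. e) A \<otimes> x \<in> I" using insert by auto
  ultimately show ?case
    using insert.prems(3) left_ideal_add[of I R] left_ideal_add[of I "opposite_ring R"] by auto
qed

end

context special_ring
begin

text \<open>By \<open>prim_annihilator\<close> and uniseriality, every \<open>b\<close> of order
  \<open>nil_index - r\<close> in the transposed block \<open>dRe\<close> is a partner of
  \<open>q\<close>; what remains is its existence.\<close>

lemma prim_morphic_pair:
  assumes e: "prim e" and d: "prim d" and q: "ord r q" "e \<otimes> q = q" "q \<otimes> d = q"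
  obtains b where "morphic_pair e d q b"
proof -
  have rm: "r \<le> nil_index" and qr: "q \<in> Jpow r" using q(1) by (auto simp: ord_def)
  have ec: "e \<in> carrier R" "d \<in> carrier R" using e d by (auto simp: prim_def)
  have "\<exists>b. ord (nil_index - r) b \<and> d \<otimes> b = b \<and> b \<otimes> e = b"
  proof (cases "r = 0")
    case True
    \<comment> \<open>An entry of order zero needs a partner of order \<open>nil_index\<close>, that
      is, zero; \<open>prim_connect\<close> reaches the smaller orders only.\<close>
    have "ord (nil_index - r) \<zero>" using True Jpow_nil_index by (simp add: ord_def)
    thus ?thesis using ec by (intro exI[of _ \<zero>]) simp
  next
    case False
    hence "nil_index - r < nil_index" using rm by simp
    then obtain b where "b \<in> Jpow (nil_index - r)" "d \<otimes> b = b" "b \<otimes> e = b" "b \<notin> Jpow (Suc (nil_index - r))"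
      using prim_connect[OF e d] by blast
    thus ?thesis by (intro exI[of _ b]) (simp add: ord_def del: nat_pow_Suc)
  qed
  then obtain b where b: "ord (nil_index - r) b" "d \<otimes> b = b" "b \<otimes> e = b" by blast
  have bm: "b \<in> Jpow (nil_index - r)" using b(1) by (simp add: ord_def)
  have "z \<otimes> q = \<zero> \<longleftrightarrow> (\<exists>s\<in>carrier R. z = s \<otimes> b)" if z: "z \<in> carrier R" "z \<otimes> e = z" for z
    using prim_annihilator[OF e q(1,2) z] prim_generates_left[OF e b(1,3) _ z(2)] Jpow_lmult[OF _ bm]
    by metis
  moreover have "z \<otimes> b = \<zero> \<longleftrightarrow> (\<exists>s\<in>carrier R. z = s \<otimes> q)" if z: "z \<in> carrier R" "z \<otimes> d = z" for z
    using prim_annihilator[OF d b(1,2) z] prim_generates_left[OF d q(1,3) _ z(2)] Jpow_lmult[OF _ qr] rm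
    by (metis diff_diff_cancel)
  ultimately have "morphic_pair e d q b"
    unfolding morphic_pair_def using q(2,3) b(2,3) Jpow_carrier[OF qr] Jpow_carrier[OF bm] by simp
  thus thesis by (rule that)
qed

section \<open>Orthogonal families of local idempotents\<close>

definition orth :: "'a set \<Rightarrow> bool" where
  "orth A \<longleftrightarrow> finite A \<and> (\<forall>e\<in>A. prim e) \<and> (\<forall>e\<in>A. \<forall>f\<in>A. e \<noteq> f \<longrightarrow> e \<otimes> f = \<zero>)"

abbreviation total :: "'a set \<Rightarrow> 'a" where "total A \<equiv> finsum R (\<lambda>e. e) A"

lemma orth_carrier: "orth A \<Longrightarrow> A \<subseteq> carrier R"
  by (auto simp: orth_def prim_def)

lemma total_closed: "orth A \<Longrightarrow> total A \<in> carrier R"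
  using orth_carrier by (intro finsum_closed) auto

lemma orth_subset: "orth A \<Longrightarrow> B \<subseteq> A \<Longrightarrow> orth B"
  unfolding orth_def by (meson finite_subset subset_iff)

lemma total_remove: assumes "orth A" "e \<in> A" shows "total A = e \<oplus> total (A - {e})"
proof -
  have "total (insert e (A - {e})) = e \<oplus> total (A - {e})"
    using assms orth_carrier[OF assms(1)] by (subst finsum_insert) (auto simp: orth_def Pi_def)
  thus ?thesis using assms(2) by (simp add: insert_absorb)
qed

lemma total_orth_zero:
  assumes A: "orth A" and x: "x \<in> carrier R"
  shows "(\<And>e. e \<in> A \<Longrightarrow> x \<otimes> e = \<zero>) \<Longrightarrow> x \<otimes> total A = \<zero>"
    and "(\<And>e. e \<in> A \<Longrightarrow> e \<otimes> x = \<zero>) \<Longrightarrow> total A \<otimes> x = \<zero>"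
proof -
  have Ac: "finite A" "(\<lambda>e. e) \<in> A \<rightarrow> carrier R" using A orth_carrier[OF A] by (auto simp: orth_def)
  show "x \<otimes> total A = \<zero>" if *: "\<And>e. e \<in> A \<Longrightarrow> x \<otimes> e = \<zero>"
  proof -
    have "x \<otimes> total A = finsum R (\<lambda>e. x \<otimes> e) A" using finsum_rdistr[OF Ac(1) x Ac(2)] .
    also have "\<dots> = \<zero>" by (rule add.finprod_one_eqI) (use * in auto)
    finally show ?thesis .
  qed
  show "total A \<otimes> x = \<zero>" if *: "\<And>e. e \<in> A \<Longrightarrow> e \<otimes> x = \<zero>"
  proof -
    have "total A \<otimes> x = finsum R (\<lambda>e. e \<otimes> x) A" using finsum_ldistr[OF Ac(1) x Ac(2)] .
    also have "\<dots> = \<zero>" by (rule add.finprod_one_eqI) (use * in auto)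
    finally show ?thesis .
  qed
qed

lemma total_remove_orth:
  assumes A: "orth A" and e: "e \<in> A"
  shows "e \<otimes> total (A - {e}) = \<zero>" "total (A - {e}) \<otimes> e = \<zero>"
    "e \<otimes> total A = e" "total A \<otimes> e = e"
proof -
  have ec: "e \<in> carrier R" "e \<otimes> e = e" using A e by (auto simp: orth_def prim_def)
  have B: "orth (A - {e})" by (rule orth_subset[OF A]) auto
  show 1: "e \<otimes> total (A - {e}) = \<zero>"
    by (rule total_orth_zero(1)[OF B ec(1)]) (use A e in \<open>auto simp: orth_def\<close>)
  show 2: "total (A - {e}) \<otimes> e = \<zero>"
    by (rule total_orth_zero(2)[OF B ec(1)]) (use A e in \<open>auto simp: orth_def\<close>)
  show "e \<otimes> total A = e" "total A \<otimes> e = e"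
    unfolding total_remove[OF A e] using 1 2 ec total_closed[OF B] by (simp_all add: l_distr r_distr)
qed

lemma total_idem: assumes A: "orth A" shows "total A \<otimes> total A = total A"
proof -
  have Ac: "finite A" "(\<lambda>e. e) \<in> A \<rightarrow> carrier R" using A orth_carrier[OF A] by (auto simp: orth_def)
  have "total A \<otimes> total A = finsum R (\<lambda>e. total A \<otimes> e) A"
    using finsum_rdistr[OF Ac(1) total_closed[OF A] Ac(2)] .
  also have "\<dots> = total A"
    by (rule finsum_cong') (use total_remove_orth(4)[OF A] Ac in auto)
  finally show ?thesis .
qed

text \<open>Pick an entry of \<open>a\<close> of least order as pivot; by uniseriality it divides its row and its column,
  so the rest of both is cleared by elementary transformations.\<close>

lemma orth_morphic_pair:
  assumes "orth A" "orth B" "card A = card B" "a \<in> carrier R" "total A \<otimes> a = a" "a \<otimes> total B = a"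
  shows "\<exists>b. morphic_pair (total A) (total B) a b"
  using assms
proof (induction "card A" arbitrary: A B a)
  case 0
  hence "A = {}" "B = {}" by (auto simp: orth_def)
  hence "a = \<zero>" "total A = \<zero>" "total B = \<zero>" using 0 by auto
  thus ?case
    by (intro exI[of _ \<zero>]) (auto simp: morphic_pair_def)
next
  case (Suc n)
  note A = Suc.prems(1) and B = Suc.prems(2) and ac = Suc.prems(4) and Aa = Suc.prems(5) and aB = Suc.prems(6)
  note tA = total_closed[OF A] and tB = total_closed[OF B]
  have fin: "finite A" "finite B" using A B by (auto simp: orth_def)
  \<comment> \<open>The least order among the entries of \<open>a\<close> is the largest
    \<open>r\<close> with \<open>a\<close> in \<open>J^r\<close>; the bound by
    \<open>nil_index\<close> makes the maximum exist even when \<open>a\<close> is zero.\<close>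
  define r where "r = (GREATEST r. r \<le> nil_index \<and> a \<in> Jpow r)"
  have ex: "0 \<le> nil_index \<and> a \<in> Jpow 0" using ac by simp
  have r: "r \<le> nil_index \<and> a \<in> Jpow r" unfolding r_def
    by (rule GreatestI_nat[of _ 0 nil_index]) (use ex in auto)
  have r_max: "a \<notin> Jpow (Suc r)" if "r < nil_index"
  proof
    assume "a \<in> Jpow (Suc r)"
    hence "Suc r \<le> r" unfolding r_def
      by (intro Greatest_le_nat[of _ _ nil_index]) (use that in \<open>auto simp: r_def\<close>)
    thus False by simp
  qed
  have prA: "prim e" if "e \<in> A" for e using A that by (simp add: orth_def)
  have prB: "prim e" if "e \<in> B" for e using B that by (simp add: orth_def)
  have "\<exists>e\<in>A. \<exists>d\<in>B. ord r (e \<otimes> (a \<otimes> d))"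
  proof (cases "r < nil_index")
    case False
    obtain e d where ed: "e \<in> A" "d \<in> B" using Suc.hyps(2) Suc.prems(3) by (metis card.empty ex_in_conv nat.distinct(1))
    have "a = \<zero>" using r False Jpow_nil_index by auto
    hence "e \<otimes> (a \<otimes> d) = \<zero>" using prA[OF ed(1)] prB[OF ed(2)] by (simp add: prim_def)
    hence "ord r (e \<otimes> (a \<otimes> d))" using r False Jpow_nil_index by (auto simp: ord_def)
    thus ?thesis using ed by blast
  next
    case True
    have "\<exists>e\<in>A. \<exists>d\<in>B. e \<otimes> (a \<otimes> d) \<notin> Jpow (Suc r)"
    proof (rule ccontr)
      assume "\<not> (\<exists>e\<in>A. \<exists>d\<in>B. e \<otimes> (a \<otimes> d) \<notin> Jpow (Suc r))"
      hence *: "e \<otimes> (a \<otimes> d) \<in> Jpow (Suc r)" if "e \<in> A" "d \<in> B" for e d using that by blast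
      have "total A \<otimes> (a \<otimes> d) \<in> Jpow (Suc r)" if d: "d \<in> B" for d
        by (rule finsum_mult_in_left_ideal[OF fin(1) orth_carrier[OF A]])
           (use d *[OF _ d] ac orth_carrier[OF B] Jpow_left_ideal[of "Suc r"] in auto)
      hence ad: "a \<otimes> d \<in> Jpow (Suc r)" if d: "d \<in> B" for d
        using d Aa ac tA orth_carrier[OF B] by (metis m_assoc subsetD)
      \<comment> \<open>The idempotents of \<open>A\<close> have been summed on the left of
        \<open>a\<close>; those of \<open>B\<close> stand on its right, so their sum is formed in
        the opposite ring.\<close>
      have "finsum (opposite_ring R) (\<lambda>e. e) B \<otimes>\<^bsub>opposite_ring R\<^esub> a \<in> Jpow (Suc r)"
        by (rule ring.finsum_mult_in_left_ideal[OF ring_opposite fin(2)])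
           (use ad ac orth_carrier[OF B] Jpow_left_ideal[of "Suc r"] in auto)
      moreover have "finsum (opposite_ring R) (\<lambda>e. e) B = total B"
        by (simp add: finsum_def)
      ultimately show False using aB r_max[OF True] by simp
    qed
    then obtain e d where ed: "e \<in> A" "d \<in> B" "e \<otimes> (a \<otimes> d) \<notin> Jpow (Suc r)" by blast
    moreover have "e \<otimes> (a \<otimes> d) \<in> Jpow r"
      using r ed orth_carrier[OF A] orth_carrier[OF B] by (intro Jpow_lmult Jpow_rmult) auto
    ultimately show ?thesis using r by (auto simp: ord_def)
  qed
  then obtain e d where e: "e \<in> A" and d: "d \<in> B" and ordq: "ord r (e \<otimes> (a \<otimes> d))" by blast
  define q where "q = e \<otimes> (a \<otimes> d)"
  have ec: "e \<in> carrier R" "e \<otimes> e = e" and dc: "d \<in> carrier R" "d \<otimes> d = d"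
    using prA[OF e] prB[OF d] by (auto simp: prim_def)
  have qc: "q \<in> carrier R" unfolding q_def using ec dc ac by simp
  have eq: "e \<otimes> q = q" unfolding q_def using ec dc ac by (metis m_assoc m_closed)
  have qd: "q \<otimes> d = q" unfolding q_def using ec dc ac by (simp add: m_assoc)
  define f where "f = total (A - {e})"
  define g where "g = total (B - {d})"
  have A': "orth (A - {e})" by (rule orth_subset[OF A]) auto
  have B': "orth (B - {d})" by (rule orth_subset[OF B]) auto
  have fc: "f \<in> carrier R" "f \<otimes> f = f" "e \<otimes> f = \<zero>" "f \<otimes> e = \<zero>"
    unfolding f_def using total_closed[OF A'] total_idem[OF A'] total_remove_orth[OF A e] by auto
  have gc: "g \<in> carrier R" "g \<otimes> g = g" "d \<otimes> g = \<zero>" "g \<otimes> d = \<zero>"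
    unfolding g_def using total_closed[OF B'] total_idem[OF B'] total_remove_orth[OF B d] by auto
  have fA: "total A = e \<oplus> f" and gB: "total B = d \<oplus> g"
    unfolding f_def g_def by (rule total_remove[OF A e], rule total_remove[OF B d])
  have Aa': "e \<otimes> a \<oplus> f \<otimes> a = a" using Aa ec fc ac unfolding fA by (simp add: l_distr)
  have aB': "a \<otimes> d \<oplus> a \<otimes> g = a" using aB dc gc ac unfolding gB by (simp add: r_distr)
  have "a \<otimes> d \<in> Jpow r" by (rule Jpow_rmult[OF dc(1)]) (use r in simp)
  moreover have "a \<otimes> d \<otimes> d = a \<otimes> d" using dc ac by (simp add: m_assoc)
  ultimately obtain s where s: "s \<in> carrier R" "a \<otimes> d = s \<otimes> q"
    using prim_generates_left[OF prB[OF d] ordq[folded q_def] qd] by blast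
  have "e \<otimes> a \<in> Jpow r" by (rule Jpow_lmult[OF ec(1)]) (use r in simp)
  moreover have "e \<otimes> (e \<otimes> a) = e \<otimes> a" using ec ac by (simp flip: m_assoc)
  ultimately obtain t where t: "t \<in> carrier R" "e \<otimes> a = q \<otimes> t"
    using prim_generates_right[OF prA[OF e] ordq[folded q_def] eq] by blast
  \<comment> \<open>The row operation that clears column \<open>d\<close> outside the pivot:
    \<open>s\<close> expresses this column through \<open>q\<close>, and compression by
    \<open>f\<close> and \<open>e\<close> makes \<open>x\<close> square to zero. In the same way
    \<open>y\<close> clears row \<open>e\<close>.\<close>
  define x where "x = f \<otimes> s \<otimes> e"
  define y where "y = d \<otimes> t \<otimes> g"
  have xc: "x \<in> carrier R" and yc: "y \<in> carrier R"
    unfolding x_def y_def using fc s ec dc t gc by auto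
  have ex: "e \<otimes> x = \<zero>" and fx: "f \<otimes> x = x" and xe: "x \<otimes> e = x" and xf: "x \<otimes> f = \<zero>"
  proof -
    have "e \<otimes> x = (e \<otimes> f) \<otimes> s \<otimes> e" unfolding x_def using ec(1) fc(1) s(1) by (simp add: m_assoc)
    thus "e \<otimes> x = \<zero>" unfolding fc(3) using s ec by simp
    have "f \<otimes> x = (f \<otimes> f) \<otimes> s \<otimes> e" unfolding x_def using ec(1) fc(1) s(1) by (simp add: m_assoc)
    thus "f \<otimes> x = x" unfolding fc(2) x_def .
    show "x \<otimes> e = x" "x \<otimes> f = \<zero>" unfolding x_def using ec fc s(1) by (simp_all add: m_assoc)
  qed
  have dy: "d \<otimes> y = y" and gy: "g \<otimes> y = \<zero>" and yg: "y \<otimes> g = y" and yd: "y \<otimes> d = \<zero>"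
  proof -
    have "g \<otimes> y = (g \<otimes> d) \<otimes> t \<otimes> g" unfolding y_def using dc(1) gc(1) t(1) by (simp add: m_assoc)
    thus "g \<otimes> y = \<zero>" unfolding gc(4) using t gc by simp
    have "d \<otimes> y = (d \<otimes> d) \<otimes> t \<otimes> g" unfolding y_def using dc(1) gc(1) t(1) by (simp add: m_assoc)
    thus "d \<otimes> y = y" unfolding dc(2) y_def .
    show "y \<otimes> g = y" "y \<otimes> d = \<zero>" unfolding y_def using dc gc t(1) by (simp_all add: m_assoc)
  qed
  have xx: "x \<otimes> x = \<zero>" using xe ex xc ec by (metis m_assoc r_null)
  have yy: "y \<otimes> y = \<zero>" using yg gy yc gc by (metis m_assoc r_null)
  have xq: "x \<otimes> q = f \<otimes> (a \<otimes> d)"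
  proof -
    have "x \<otimes> q = f \<otimes> (s \<otimes> (e \<otimes> q))" unfolding x_def using fc(1) s(1) ec(1) qc by (simp add: m_assoc)
    thus ?thesis unfolding eq s(2)[symmetric] .
  qed
  have qy: "q \<otimes> y = e \<otimes> a \<otimes> g"
  proof -
    have "q \<otimes> y = (q \<otimes> d) \<otimes> t \<otimes> g" unfolding y_def using dc(1) t(1) gc(1) qc by (simp add: m_assoc)
    thus ?thesis unfolding qd t(2)[symmetric] .
  qed
  \<comment> \<open>As \<open>x\<close> squares to zero, \<open>u\<close> and \<open>u'\<close> are
    inverse to each other in the corner of \<open>total A\<close>; likewise \<open>v\<close> and
    \<open>v'\<close> in that of \<open>total B\<close>.\<close>
  define u where "u = total A \<ominus> x"
  define u' where "u' = total A \<oplus> x"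
  define v where "v = total B \<ominus> y"
  define v' where "v' = total B \<oplus> y"
  note cl = tA tB xc yc
  have Ax: "total A \<otimes> x = x" "x \<otimes> total A = x"
    unfolding fA using ec fc xc ex fx xe xf by (simp_all add: l_distr r_distr)
  have By: "total B \<otimes> y = y" "y \<otimes> total B = y"
    unfolding gB using dc gc yc dy gy yd yg by (simp_all add: l_distr r_distr)
  note AA = total_idem[OF A] and BB = total_idem[OF B]
  have u: "u \<in> carrier R" "u' \<in> carrier R" "u \<otimes> u' = total A" "u' \<otimes> u = total A"
    "total A \<otimes> u = u" "u \<otimes> total A = u" "u' \<otimes> total A = u'"
    unfolding u_def u'_def using cl Ax xx AA
    by (simp_all add: minus_eq l_distr r_distr l_minus r_minus a_assoc r_neg l_neg r_neg1 r_neg2)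
  have v: "v \<in> carrier R" "v' \<in> carrier R" "v \<otimes> v' = total B" "v' \<otimes> v = total B"
    "total B \<otimes> v = v" "v \<otimes> total B = v"
    unfolding v_def v'_def using cl By yy BB
    by (simp_all add: minus_eq l_distr r_distr l_minus r_minus a_assoc r_neg l_neg r_neg1 r_neg2)
  define a1 where "a1 = u \<otimes> a \<otimes> v"
  have a1c: "a1 \<in> carrier R" unfolding a1_def using u v ac by simp
  have ua: "u \<otimes> a = a \<ominus> x \<otimes> a" unfolding u_def using tA xc ac Aa by (simp add: minus_eq l_distr l_minus)
  have vd: "v \<otimes> d = d"
    unfolding v_def using tB yc dc(1) yd total_remove_orth(4)[OF B d] by (simp add: minus_eq l_distr l_minus)
  have eu: "e \<otimes> u = e"
    unfolding u_def using tA xc ec(1) ex total_remove_orth(3)[OF A e] by (simp add: minus_eq r_distr r_minus)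
  have xad: "x \<otimes> (a \<otimes> d) = x \<otimes> q"
  proof -
    have "x \<otimes> (a \<otimes> d) = (x \<otimes> e) \<otimes> (a \<otimes> d)" unfolding xe ..
    also have "\<dots> = x \<otimes> q" unfolding q_def using xc ec ac dc by (simp add: m_assoc)
    finally show ?thesis .
  qed
  have cancel: "x \<ominus> w = q" if "x = q \<oplus> w" "w \<in> carrier R" for x w
    using that qc by (simp add: minus_eq a_assoc r_neg)
  have a1d: "a1 \<otimes> d = q"
  proof -
    have "a1 \<otimes> d = u \<otimes> a \<otimes> (v \<otimes> d)" unfolding a1_def using u(1) v(1) ac dc(1) by (simp add: m_assoc)
    also have "\<dots> = a \<otimes> d \<ominus> x \<otimes> (a \<otimes> d)" unfolding vd ua using ac xc dc(1) by (simp add: minus_eq l_distr l_minus m_assoc)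
    also have "\<dots> = a \<otimes> d \<ominus> f \<otimes> (a \<otimes> d)" unfolding xad xq ..
    also have "\<dots> = q"
    proof (rule cancel)
      show "a \<otimes> d = q \<oplus> f \<otimes> (a \<otimes> d)"
        unfolding q_def using arg_cong[OF Aa', of "\<lambda>z. z \<otimes> d"] ac ec(1) fc(1) dc(1)
        by (simp add: l_distr m_assoc)
    qed (use fc(1) ac dc(1) in simp)
    finally show ?thesis .
  qed
  have ea1: "e \<otimes> a1 = q"
  proof -
    have "e \<otimes> a1 = (e \<otimes> u) \<otimes> a \<otimes> v" unfolding a1_def using u(1) v(1) ac ec(1) by (simp add: m_assoc)
    also have "\<dots> = e \<otimes> a \<otimes> v" unfolding eu ..
    also have "\<dots> = e \<otimes> a \<ominus> e \<otimes> a \<otimes> y"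
      unfolding v_def using ac ec tB yc aB by (simp add: minus_eq r_distr r_minus m_assoc)
    also have "e \<otimes> a \<otimes> y = q \<otimes> y"
    proof -
      have "e \<otimes> a \<otimes> y = e \<otimes> a \<otimes> (d \<otimes> y)" unfolding dy ..
      thus ?thesis unfolding q_def using ec ac dc yc by (simp add: m_assoc)
    qed
    also have "q \<otimes> y = e \<otimes> a \<otimes> g" by (rule qy)
    also have "e \<otimes> a \<ominus> e \<otimes> a \<otimes> g = q"
    proof (rule cancel)
      show "e \<otimes> a = q \<oplus> e \<otimes> a \<otimes> g"
        unfolding q_def using arg_cong[OF aB', of "\<lambda>z. e \<otimes> z"] ac ec(1) gc(1) dc(1)
        by (simp add: r_distr m_assoc)
    qed (use ec(1) ac gc(1) in simp)
    finally show ?thesis .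
  qed
  \<comment> \<open>The block left over by the elimination. Since row \<open>e\<close> and column
    \<open>d\<close> of \<open>a1\<close> consist of \<open>q\<close> alone, \<open>a1\<close> is
    the sum of \<open>q\<close> and this block, to which the induction hypothesis applies.\<close>
  define a' where "a' = f \<otimes> (a1 \<otimes> g)"
  have a'c: "a' \<in> carrier R" unfolding a'_def using fc gc a1c by simp
  have a'f: "f \<otimes> a' = a'" unfolding a'_def using fc gc a1c by (metis m_assoc m_closed)
  have a'g: "a' \<otimes> g = a'" unfolding a'_def using fc gc a1c by (simp add: m_assoc)
  have "total A \<otimes> a1 = a1"
  proof -
    have "total A \<otimes> a1 = (total A \<otimes> u) \<otimes> a \<otimes> v" unfolding a1_def using tA u(1) v(1) ac by (simp add: m_assoc)
    thus ?thesis unfolding u(5) a1_def .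
  qed
  moreover have "a1 \<otimes> total B = a1" unfolding a1_def using tB u(1) v(1,6) ac by (simp add: m_assoc)
  ultimately have "a1 = (e \<oplus> f) \<otimes> (a1 \<otimes> (d \<oplus> g))" unfolding fA gB by simp
  also have "\<dots> = e \<otimes> (a1 \<otimes> d) \<oplus> (e \<otimes> a1) \<otimes> g \<oplus> (f \<otimes> (a1 \<otimes> d) \<oplus> a')"
    unfolding a'_def using a1c ec(1) fc(1) dc(1) gc(1) by (simp add: l_distr r_distr m_assoc a_ac)
  also have "\<dots> = q \<oplus> a'"
  proof -
    have "q \<otimes> g = \<zero>" using qd gc(3) qc gc(1) dc(1) by (metis m_assoc r_null)
    moreover have "f \<otimes> q = \<zero>" using eq fc(4) qc fc(1) ec(1) by (metis m_assoc l_null)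
    ultimately show ?thesis unfolding a1d ea1 eq using qc a'c by simp
  qed
  finally have a1_eq: "a1 = q \<oplus> a'" .
  obtain b1 where b1: "morphic_pair e d q b1"
    by (rule prim_morphic_pair[OF prA[OF e] prB[OF d] ordq[folded q_def] eq qd])
  have "card (A - {e}) = n" "card (A - {e}) = card (B - {d})"
    using Suc.hyps(2) Suc.prems(3) e d fin by (simp_all add: card_Diff_singleton)
  then obtain b2 where b2: "morphic_pair f g a' b2"
    using Suc.hyps(1)[of "A - {e}" "B - {d}" a'] A' B' a'c a'f a'g unfolding f_def g_def by blast
  have "morphic_pair (total A) (total B) a1 (b1 \<oplus> b2)"
    unfolding a1_eq fA gB
    by (rule morphic_pair_add[OF ec(1) fc(1) dc(1) gc(1) ec(2) fc(2) fc(3,4) dc(2) gc(2) gc(3,4) b1 b2])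
  thus ?case
    using morphic_pair_units[OF ac tA tB Aa aB u v] unfolding a1_def by blast
qed

end

section \<open>Primitive idempotents\<close>

context special_ring
begin

section \<open>Congruence modulo the radical and lifting of idempotents\<close>

definition eqJ :: "'a \<Rightarrow> 'a \<Rightarrow> bool" where
  "eqJ x y \<longleftrightarrow> x \<in> carrier R \<and> y \<in> carrier R \<and> x \<ominus> y \<in> J"

lemma eqJ_refl: "x \<in> carrier R \<Longrightarrow> eqJ x x"
  using left_ideal_zero[OF Jl] by (simp add: eqJ_def minus_eq r_neg)

lemma eqJ_sym: assumes "eqJ x y" shows "eqJ y x"
proof -
  have xy: "x \<in> carrier R" "y \<in> carrier R" using assms by (auto simp: eqJ_def)
  have "\<zero> \<ominus> (x \<ominus> y) \<in> J"
    using left_ideal_minus[OF Jl left_ideal_zero[OF Jl]] assms by (simp add: eqJ_def)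
  moreover have "\<zero> \<ominus> (x \<ominus> y) = y \<ominus> x" using xy by algebra
  ultimately show ?thesis using xy by (simp add: eqJ_def)
qed

lemma eqJ_trans [trans]: assumes "eqJ x y" "eqJ y z" shows "eqJ x z"
proof -
  have c: "x \<in> carrier R" "y \<in> carrier R" "z \<in> carrier R" using assms by (auto simp: eqJ_def)
  have "(x \<ominus> y) \<oplus> (y \<ominus> z) \<in> J"
    using left_ideal_add[OF Jl] assms by (simp add: eqJ_def)
  moreover have "(x \<ominus> y) \<oplus> (y \<ominus> z) = x \<ominus> z" using c by algebra
  ultimately show ?thesis using c by (simp add: eqJ_def)
qed

lemma eqJ_add: assumes "eqJ x y" "eqJ z w" shows "eqJ (x \<oplus> z) (y \<oplus> w)"
proof -
  have c: "x \<in> carrier R" "y \<in> carrier R" "z \<in> carrier R" "w \<in> carrier R" using assms by (auto simp: eqJ_def)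
  have "(x \<ominus> y) \<oplus> (z \<ominus> w) \<in> J"
    using left_ideal_add[OF Jl] assms by (simp add: eqJ_def)
  moreover have "(x \<ominus> y) \<oplus> (z \<ominus> w) = (x \<oplus> z) \<ominus> (y \<oplus> w)" using c by algebra
  ultimately show ?thesis using c by (simp add: eqJ_def)
qed

lemma eqJ_lmult: assumes "eqJ x y" "r \<in> carrier R" shows "eqJ (r \<otimes> x) (r \<otimes> y)"
proof -
  have c: "x \<in> carrier R" "y \<in> carrier R" using assms by (auto simp: eqJ_def)
  have "r \<otimes> (x \<ominus> y) \<in> J" using J_lmult assms by (simp add: eqJ_def)
  moreover have "r \<otimes> (x \<ominus> y) = r \<otimes> x \<ominus> r \<otimes> y" using c assms(2) by algebra
  ultimately show ?thesis using c assms(2) by (simp add: eqJ_def)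
qed

lemma eqJ_rmult: assumes "eqJ x y" "r \<in> carrier R" shows "eqJ (x \<otimes> r) (y \<otimes> r)"
proof -
  have c: "x \<in> carrier R" "y \<in> carrier R" using assms by (auto simp: eqJ_def)
  have "(x \<ominus> y) \<otimes> r \<in> J" using J_rmult assms by (simp add: eqJ_def)
  moreover have "(x \<ominus> y) \<otimes> r = x \<otimes> r \<ominus> y \<otimes> r" using c assms(2) by algebra
  ultimately show ?thesis using c assms(2) by (simp add: eqJ_def)
qed

lemma eqJ_mem: assumes "eqJ x y" shows "x \<in> J \<longleftrightarrow> y \<in> J"
  using assms eqJ_sym[OF assms] left_ideal_minus_iff[OF Jl] by (auto simp: eqJ_def)

lemma eqJ_pow:
  assumes x: "x \<in> carrier R" "eqJ (x \<otimes> x) x" shows "eqJ (x [^] Suc n) x"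
proof (induction n)
  case 0
  then show ?case using x(1) eqJ_refl by simp
next
  case (Suc n)
  have "eqJ (x [^] Suc n \<otimes> x) (x \<otimes> x)" by (rule eqJ_rmult[OF Suc x(1)])
  also note x(2)
  finally show ?case using x(1) by simp
qed

text \<open>With \<open>y = 1 - x\<close> the product \<open>xy\<close> lies in \<open>J\<close>, so
  a power of it vanishes. Equal powers \<open>g\<close> of \<open>x\<close> and \<open>h\<close> of
  \<open>y\<close> then annihilate each other, while their sum \<open>u\<close> is congruent to one
  and hence invertible; the idempotent is \<open>u^-1 g\<close>. The last clause keeps it in the
  corner from which \<open>x\<close> was taken.\<close>

lemma lift_idempotent:
  assumes x: "x \<in> carrier R" "eqJ (x \<otimes> x) x"
  obtains e where "e \<in> carrier R" "e \<otimes> e = e" "eqJ e x"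
    "\<And>f. f \<in> carrier R \<Longrightarrow> f \<otimes> x = x \<Longrightarrow> x \<otimes> f = x \<Longrightarrow> f \<otimes> e = e \<and> e \<otimes> f = e"
proof -
  define y where "y = \<one> \<ominus> x"
  have y: "y \<in> carrier R" unfolding y_def using x(1) by simp
  have xy: "x \<otimes> y = x \<ominus> x \<otimes> x" and yx: "y \<otimes> x = x \<ominus> x \<otimes> x"
    unfolding y_def using x(1) by (simp_all add: minus_eq r_distr l_distr r_minus l_minus)
  have yy: "y \<otimes> y = y \<ominus> (x \<ominus> x \<otimes> x)"
  proof -
    have "y \<otimes> y = (\<one> \<ominus> x) \<otimes> y" by (simp add: y_def)
    also have "\<dots> = y \<ominus> x \<otimes> y" using x(1) y by (simp add: minus_eq l_distr l_minus)
    finally show ?thesis unfolding xy .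
  qed
  have xyJ: "x \<ominus> x \<otimes> x \<in> J" using eqJ_sym[OF x(2)] by (simp add: eqJ_def)
  have eqy: "eqJ (y \<otimes> y) y"
  proof -
    have "y \<ominus> (x \<ominus> x \<otimes> x) \<ominus> y = \<zero> \<ominus> (x \<ominus> x \<otimes> x)" using x(1) y by algebra
    thus ?thesis
      using left_ideal_minus[OF Jl left_ideal_zero[OF Jl] xyJ] x(1) y unfolding yy by (simp add: eqJ_def)
  qed
  \<comment> \<open>The successor guarantees a factor \<open>x\<close>: it makes \<open>g\<close>
    congruent to \<open>x\<close>, and an \<open>f\<close> that fixes \<open>x\<close> from both
    sides also fixes \<open>g\<close>.\<close>
  define g where "g = x [^] Suc nil_index"
  define h where "h = y [^] Suc nil_index"
  have gc: "g \<in> carrier R" and hc: "h \<in> carrier R" unfolding g_def h_def using x(1) y by auto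
  have gx: "eqJ g x" unfolding g_def by (rule eqJ_pow[OF x])
  have hy: "eqJ h y" unfolding h_def by (rule eqJ_pow[OF y eqy])
  have nil: "(x \<otimes> y) [^] Suc nil_index = \<zero>" using J_nilpotent[OF xyJ] x(1) unfolding xy by simp
  have gh: "g \<otimes> h = \<zero>"
    unfolding g_def h_def using nil pow_mult_distrib[of x y "Suc nil_index"] xy yx x(1) y by simp
  have hg: "h \<otimes> g = \<zero>"
    unfolding g_def h_def using nil pow_mult_distrib[of y x "Suc nil_index"] xy yx x(1) y by simp
  define u where "u = g \<oplus> h"
  have uc: "u \<in> carrier R" unfolding u_def using gc hc by simp
  have ug: "u \<otimes> g = g \<otimes> g" and gu: "g \<otimes> u = g \<otimes> g"
    unfolding u_def using gc hc gh hg by (simp_all add: l_distr r_distr)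
  have "eqJ u (x \<oplus> y)" unfolding u_def by (rule eqJ_add[OF gx hy])
  moreover have "x \<oplus> y = \<one>" unfolding y_def using x(1) by algebra
  ultimately have j: "\<one> \<ominus> u \<in> J" using eqJ_sym by (auto simp: eqJ_def)
  have uj: "\<one> \<ominus> (\<one> \<ominus> u) = u" using uc by algebra
  obtain v where v: "v \<in> carrier R" "v \<otimes> u = \<one>" "u \<otimes> v = \<one>"
    using one_minus_nilpotent[OF J_carrier[OF j] J_nilpotent[OF j]] unfolding uj by blast
  have vg: "v \<otimes> g = g \<otimes> v"
  proof -
    have "v \<otimes> g = v \<otimes> (g \<otimes> u) \<otimes> v" using v gc uc by (simp add: m_assoc)
    also have "\<dots> = (v \<otimes> u) \<otimes> g \<otimes> v" unfolding gu ug[symmetric] using v(1) gc uc by (simp add: m_assoc)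
    finally show ?thesis using v gc by simp
  qed
  define e where "e = v \<otimes> g"
  have ec: "e \<in> carrier R" unfolding e_def using v gc by simp
  have ue: "u \<otimes> e = g"
  proof -
    have "u \<otimes> e = (u \<otimes> v) \<otimes> g" unfolding e_def using v(1) gc uc by (simp add: m_assoc)
    thus ?thesis using v gc by simp
  qed
  have "e \<otimes> e = v \<otimes> ((g \<otimes> v) \<otimes> g)" unfolding e_def using v(1) gc by (simp add: m_assoc)
  also have "\<dots> = v \<otimes> v \<otimes> (g \<otimes> g)" unfolding vg[symmetric] using v(1) gc by (simp add: m_assoc)
  also have "\<dots> = v \<otimes> (v \<otimes> u) \<otimes> g" unfolding ug[symmetric] using v(1) gc uc by (simp add: m_assoc)
  also have "\<dots> = e" unfolding v(2) e_def using v(1) by simp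
  finally have ee: "e \<otimes> e = e" .
  have "e = u \<otimes> e \<oplus> (\<one> \<ominus> u) \<otimes> e"
  proof -
    have "(u \<oplus> (\<one> \<ominus> u)) \<otimes> e = u \<otimes> e \<oplus> (\<one> \<ominus> u) \<otimes> e" using uc ec by (simp add: l_distr)
    moreover have "u \<oplus> (\<one> \<ominus> u) = \<one>" using uc by algebra
    ultimately show ?thesis using ec by simp
  qed
  hence "e = g \<oplus> (\<one> \<ominus> u) \<otimes> e" unfolding ue .
  moreover have "g \<oplus> (\<one> \<ominus> u) \<otimes> e \<ominus> g = (\<one> \<ominus> u) \<otimes> e" using gc uc ec by algebra
  ultimately have "eqJ e g" using J_rmult[OF ec j] ec gc by (simp add: eqJ_def)
  hence ex: "eqJ e x" using gx eqJ_trans by blast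
  have "f \<otimes> e = e \<and> e \<otimes> f = e" if f: "f \<in> carrier R" "f \<otimes> x = x" "x \<otimes> f = x" for f
  proof
    have "g = x \<otimes> x [^] nil_index" unfolding g_def using x(1) by (rule nat_pow_Suc2)
    hence fg: "f \<otimes> g = g" using f x(1) by (simp flip: m_assoc)
    have gf: "g \<otimes> f = g" unfolding g_def using f x(1) by (simp add: m_assoc)
    have "f \<otimes> e = (f \<otimes> g) \<otimes> v" unfolding e_def vg using f gc v(1) by (simp add: m_assoc)
    thus "f \<otimes> e = e" unfolding fg e_def vg .
    show "e \<otimes> f = e" unfolding e_def using gf f gc v(1) by (simp add: m_assoc)
  qed
  with ec ee ex that show thesis by blast
qed

text \<open>A left ideal \<open>I\<close> minimal above \<open>J\<close> inside
  \<open>Rf + J\<close> is a simple module modulo \<open>J\<close>. Its generator, compressed by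
  \<open>f\<close> and lifted, is the idempotent: for \<open>x\<close> in \<open>eRe\<close> outside
  \<open>J\<close>, minimality gives \<open>Rx + J = I\<close>, so \<open>x\<close> has a left
  inverse up to the radical.\<close>

lemma exists_prim:
  assumes f: "f \<in> carrier R" "f \<otimes> f = f" "f \<notin> J"
  obtains e where "prim e" "f \<otimes> e = e" "e \<otimes> f = e"
proof -
  define P where "P = PIdl f <+>\<^bsub>R\<^esub> J"
  have fl: "left_ideal (PIdl f) R" by (rule left_ideal_cgenideal[OF f(1)])
  have P: "left_ideal P R" unfolding P_def by (rule left_ideal_set_add[OF fl Jl])
  have fP: "f \<in> P" and JP: "J \<subseteq> P"
    using subset_set_add[OF fl Jl] cgenideal_self[OF f(1)] unfolding P_def by auto
  define G where "G = {I. left_ideal I R \<and> J \<subset> I \<and> I \<subseteq> P}"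
  have "P \<in> G" unfolding G_def using P fP JP f(3) by blast
  then obtain I where I: "I \<in> G"
    and min: "\<And>K. (K, I) \<in> {(K, I). left_ideal K R \<and> left_ideal I R \<and> J \<subseteq> K \<and> K \<subset> I} \<Longrightarrow> K \<notin> G"
    by (rule wfE_min[OF left_dcc_mod[OF J lss rss]]) blast
  have Il: "left_ideal I R" and JI: "J \<subset> I" and IP: "I \<subseteq> P" using I by (auto simp: G_def)
  have I_min: "K = I" if K: "left_ideal K R" "J \<subset> K" "K \<subseteq> I" for K
  proof (rule ccontr)
    assume "K \<noteq> I"
    hence "K \<notin> G" using min[of K] K Il by blast
    thus False using K IP by (auto simp: G_def)
  qed
  obtain e0 where e0: "e0 \<in> I" "\<And>x. x \<in> I \<Longrightarrow> x \<ominus> x \<otimes> e0 \<in> J"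
    using left_semisimple_modE[OF lss Il] JI by blast
  note e0c = left_ideal_carrier[OF Il e0(1)]
  have e0J: "e0 \<notin> J"
  proof
    assume "e0 \<in> J"
    have "x \<in> J" if x: "x \<in> I" for x
    proof -
      note xc = left_ideal_carrier[OF Il x]
      show ?thesis
        using e0(2)[OF x] left_ideal_minus_iff[OF Jl J_lmult[OF xc \<open>e0 \<in> J\<close>] xc] by simp
    qed
    thus False using JI by blast
  qed
  have e0f: "eqJ (e0 \<otimes> f) e0"
  proof -
    have "e0 \<in> PIdl f <+>\<^bsub>R\<^esub> J" using e0(1) IP P_def by blast
    then obtain q j where q: "q \<in> PIdl f" "j \<in> J" "e0 = q \<oplus> j" unfolding mem_set_add by blast
    then obtain s where s: "s \<in> carrier R" "q = s \<otimes> f" unfolding mem_cgenideal by blast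
    have jc: "j \<in> carrier R" by (rule J_carrier[OF q(2)])
    have "e0 \<otimes> f = q \<oplus> j \<otimes> f" unfolding q(3) s(2) using s(1) f jc by (simp add: l_distr m_assoc)
    hence "e0 \<otimes> f \<ominus> e0 = q \<oplus> j \<otimes> f \<ominus> (q \<oplus> j)" unfolding q(3) by simp
    also have "\<dots> = j \<otimes> f \<ominus> j" unfolding s(2) using s(1) f(1) jc by algebra
    finally show ?thesis
      using left_ideal_minus[OF Jl J_rmult[OF f(1) q(2)] q(2)] e0c f(1) by (simp add: eqJ_def)
  qed
  have e0e0: "eqJ (e0 \<otimes> e0) e0"
    by (rule eqJ_sym) (use e0(2)[OF e0(1)] e0c in \<open>simp add: eqJ_def\<close>)
  \<comment> \<open>Compression by \<open>f\<close> moves \<open>e0\<close> into the corner of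
    \<open>f\<close>. It stays idempotent modulo \<open>J\<close> because
    \<open>e0 \<otimes> f\<close> is congruent to \<open>e0\<close>.\<close>
  define e1 where "e1 = f \<otimes> (e0 \<otimes> f)"
  have e1c: "e1 \<in> carrier R" unfolding e1_def using f e0c by simp
  have fe1: "f \<otimes> e1 = e1" unfolding e1_def using f e0c by (metis m_assoc m_closed)
  have e1f: "e1 \<otimes> f = e1" unfolding e1_def using f e0c by (simp add: m_assoc)
  have e1e0: "eqJ e1 (f \<otimes> e0)" unfolding e1_def by (rule eqJ_lmult[OF e0f f(1)])
  have e0e1: "eqJ (e0 \<otimes> e1) e0"
  proof -
    have "eqJ (e0 \<otimes> e1) (e0 \<otimes> (f \<otimes> e0))" by (rule eqJ_lmult[OF e1e0 e0c])
    also have "e0 \<otimes> (f \<otimes> e0) = (e0 \<otimes> f) \<otimes> e0" using f e0c by (simp add: m_assoc)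
    also have "eqJ ((e0 \<otimes> f) \<otimes> e0) (e0 \<otimes> e0)" by (rule eqJ_rmult[OF e0f e0c])
    also note e0e0
    finally show ?thesis .
  qed
  have e1J: "e1 \<notin> J" using eqJ_mem[OF e0e1] e0J J_lmult[OF e0c] by blast
  have e1e1: "eqJ (e1 \<otimes> e1) e1"
  proof -
    have "eqJ (e1 \<otimes> e1) ((f \<otimes> e0) \<otimes> e1)" by (rule eqJ_rmult[OF e1e0 e1c])
    also have "(f \<otimes> e0) \<otimes> e1 = f \<otimes> (e0 \<otimes> e1)" using f e0c e1c by (simp add: m_assoc)
    also have "eqJ (f \<otimes> (e0 \<otimes> e1)) (f \<otimes> e0)" by (rule eqJ_lmult[OF e0e1 f(1)])
    also have "eqJ (f \<otimes> e0) e1" by (rule eqJ_sym[OF e1e0])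
    finally show ?thesis .
  qed
  obtain e where e: "e \<in> carrier R" "e \<otimes> e = e" "eqJ e e1" "f \<otimes> e = e" "e \<otimes> f = e"
    using lift_idempotent[OF e1c e1e1] f(1) fe1 e1f by metis
  have eJ: "e \<notin> J" using eqJ_mem[OF e(3)] e1J by simp
  have eI: "e \<in> I"
  proof -
    have "eqJ e (f \<otimes> e0)" using e(3) e1e0 eqJ_trans by blast
    hence "e \<ominus> f \<otimes> e0 \<in> I" using JI by (auto simp: eqJ_def)
    thus ?thesis using left_ideal_minus_iff[OF Il left_ideal_mult[OF Il f(1) e0(1)] e(1)] by simp
  qed
  have linv: "\<exists>y\<in>carrier R. e \<otimes> y = y \<and> y \<otimes> e = y \<and> y \<otimes> x = e"
    if x: "x \<in> carrier R" "e \<otimes> x = x" "x \<otimes> e = x" "x \<notin> J" for x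
  proof -
    have xl: "left_ideal (PIdl x) R" by (rule left_ideal_cgenideal[OF x(1)])
    have xI: "x \<in> I" using left_ideal_mult[OF Il x(1) eI] x(3) by simp
    have "PIdl x <+>\<^bsub>R\<^esub> J = I"
    proof (rule I_min)
      show "left_ideal (PIdl x <+>\<^bsub>R\<^esub> J) R" by (rule left_ideal_set_add[OF xl Jl])
      show "J \<subset> PIdl x <+>\<^bsub>R\<^esub> J"
        using subset_set_add[OF xl Jl] cgenideal_self[OF x(1)] x(4) by blast
      show "PIdl x <+>\<^bsub>R\<^esub> J \<subseteq> I"
        by (rule set_add_subset[OF Il]) (use cgenideal_subset_iff[OF Il x(1)] xI JI in auto)
    qed
    hence "e \<in> PIdl x <+>\<^bsub>R\<^esub> J" using eI by simp
    then obtain q j where q: "q \<in> PIdl x" "j \<in> J" "e = q \<oplus> j" unfolding mem_set_add by blast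
    then obtain s where s: "s \<in> carrier R" "q = s \<otimes> x" unfolding mem_cgenideal by blast
    have jc: "j \<in> carrier R" by (rule J_carrier[OF q(2)])
    \<comment> \<open>The error \<open>j\<close> is moved into the corner of \<open>e\<close>. As
      \<open>k\<close> is radical, \<open>\<one> \<ominus> k\<close> is invertible, and dividing by
      it turns \<open>e \<ominus> k = esx\<close> into an exact left inverse of
      \<open>x\<close>.\<close>
    define k where "k = e \<otimes> j \<otimes> e"
    have kJ: "k \<in> J" unfolding k_def by (intro J_rmult[OF e(1)] J_lmult[OF e(1)] q(2))
    have kc: "k \<in> carrier R" by (rule J_carrier[OF kJ])
    have "e = e \<otimes> e \<otimes> e" using e(1,2) by simp
    also have "\<dots> = e \<otimes> (s \<otimes> x \<oplus> j) \<otimes> e" using q(3) s(2) by simp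
    also have "\<dots> = e \<otimes> s \<otimes> (x \<otimes> e) \<oplus> k" unfolding k_def using e(1) s(1) x(1) jc by (simp add: l_distr r_distr m_assoc)
    also have "\<dots> = e \<otimes> s \<otimes> x \<oplus> k" unfolding x(3) ..
    finally have "e = e \<otimes> s \<otimes> x \<oplus> k" .
    moreover have "e \<otimes> s \<otimes> x \<oplus> k \<ominus> k = e \<otimes> s \<otimes> x" using e(1) s(1) x(1) kc by algebra
    ultimately have ek: "e \<ominus> k = e \<otimes> s \<otimes> x" by simp
    have ke: "k \<otimes> e = k" unfolding k_def using e(1,2) jc by (simp add: m_assoc)
    have "(\<one> \<ominus> k) \<otimes> e = e \<ominus> k" using e(1) kc ke by (simp add: minus_eq l_distr l_minus)
    hence *: "(\<one> \<ominus> k) \<otimes> e = e \<otimes> s \<otimes> x" using ek by simp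
    obtain v where v: "v \<in> carrier R" "v \<otimes> (\<one> \<ominus> k) = \<one>"
      using one_minus_nilpotent[OF kc J_nilpotent[OF kJ]] by blast
    have "v \<otimes> ((\<one> \<ominus> k) \<otimes> e) = (v \<otimes> (\<one> \<ominus> k)) \<otimes> e" using v(1) kc e(1) by (simp add: m_assoc)
    hence ve: "v \<otimes> (e \<otimes> s \<otimes> x) = e" unfolding * v(2) using e(1) by simp
    define y where "y = e \<otimes> (v \<otimes> (e \<otimes> s)) \<otimes> e"
    have yc: "y \<in> carrier R" unfolding y_def using e(1) v(1) s(1) by simp
    have "y \<otimes> x = e \<otimes> (v \<otimes> (e \<otimes> s)) \<otimes> (e \<otimes> x)" unfolding y_def using e(1) v(1) s(1) x(1) by (simp add: m_assoc)
    also have "\<dots> = e \<otimes> (v \<otimes> (e \<otimes> s \<otimes> x))" unfolding x(2) using e(1) v(1) s(1) x(1) by (simp add: m_assoc)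
    finally have "y \<otimes> x = e" unfolding ve e(2) .
    moreover have "e \<otimes> y = y"
    proof -
      have "e \<otimes> y = (e \<otimes> e) \<otimes> (v \<otimes> (e \<otimes> s)) \<otimes> e" unfolding y_def using e(1) v(1) s(1) by (simp add: m_assoc)
      thus ?thesis unfolding e(2) y_def .
    qed
    moreover have "y \<otimes> e = y" unfolding y_def using e(1,2) v(1) s(1) by (simp add: m_assoc)
    ultimately show ?thesis using yc by blast
  qed
  have "\<exists>y\<in>carrier R. e \<otimes> y = y \<and> y \<otimes> e = y \<and> x \<otimes> y = e \<and> y \<otimes> x = e"
    if x: "x \<in> carrier R" "e \<otimes> x = x" "x \<otimes> e = x" "x \<notin> J" for x
  proof -
    obtain y where y: "y \<in> carrier R" "e \<otimes> y = y" "y \<otimes> e = y" "y \<otimes> x = e" using linv[OF x] by blast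
    \<comment> \<open>Left inverses are two-sided here: the left inverse \<open>y\<close> of
      \<open>x\<close> also lies outside \<open>J\<close>, so it has a left inverse
      \<open>z\<close>, and \<open>z\<close> must be \<open>x\<close>.\<close>
    have "y \<notin> J" using J_rmult[OF x(1), of y] y(4) eJ by auto
    then obtain z where z: "z \<in> carrier R" "z \<otimes> e = z" "z \<otimes> y = e" using linv[OF y(1-3)] by blast
    have "z = z \<otimes> (y \<otimes> x)" using z(2) y(4) by simp
    also have "\<dots> = (z \<otimes> y) \<otimes> x" using z(1) y(1) x(1) by (simp add: m_assoc)
    also have "\<dots> = x" unfolding z(3) by (rule x(2))
    finally show ?thesis using y z(3) by blast
  qed
  hence "prim e" unfolding prim_def using e eJ by blast
  thus thesis using that e(4,5) by blast
qed

text \<open>Choose an orthogonal family with \<open>R (total A) + J\<close> maximal. If the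
  complementary idempotent lay outside \<open>J\<close>, \<open>exists_prim\<close> would split a
  further member off it. So it is nilpotent, hence zero, and the family sums to one exactly, not
  only modulo \<open>J\<close>.\<close>

lemma exists_orth_total_one: obtains A where "orth A" "total A = \<one>"
proof -
  define G where "G = {PIdl (total A) <+>\<^bsub>R\<^esub> J | A. orth A}"
  have "orth {}" by (simp add: orth_def)
  hence "PIdl (total {}) <+>\<^bsub>R\<^esub> J \<in> G" unfolding G_def by blast
  then obtain P where P: "P \<in> G"
    and max: "\<And>K. (K, P) \<in> {(K, I). left_ideal K R \<and> left_ideal I R \<and> J \<subseteq> I \<and> I \<subset> K} \<Longrightarrow> K \<notin> G"
    by (rule wfE_min[OF left_acc_mod[OF Jl lss]]) blast
  obtain A where A: "orth A" "P = PIdl (total A) <+>\<^bsub>R\<^esub> J" using P unfolding G_def by blast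
  have lid: "left_ideal (PIdl (total B) <+>\<^bsub>R\<^esub> J) R" "total B \<in> PIdl (total B) <+>\<^bsub>R\<^esub> J"
    "J \<subseteq> PIdl (total B) <+>\<^bsub>R\<^esub> J" if B: "orth B" for B
  proof -
    note l = left_ideal_cgenideal[OF total_closed[OF B]]
    show "left_ideal (PIdl (total B) <+>\<^bsub>R\<^esub> J) R" by (rule left_ideal_set_add[OF l Jl])
    show "total B \<in> PIdl (total B) <+>\<^bsub>R\<^esub> J" "J \<subseteq> PIdl (total B) <+>\<^bsub>R\<^esub> J"
      using subset_set_add[OF l Jl] cgenideal_self[OF total_closed[OF B]] by auto
  qed
  define f where "f = total A"
  have f: "f \<in> carrier R" "f \<otimes> f = f" unfolding f_def using total_closed[OF A(1)] total_idem[OF A(1)] by auto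
  define g where "g = \<one> \<ominus> f"
  have gc: "g \<in> carrier R" unfolding g_def using f by simp
  have fg: "f \<otimes> g = \<zero>" "g \<otimes> f = \<zero>"
    unfolding g_def using f by (simp_all add: minus_eq r_distr l_distr r_minus l_minus r_neg)
  have gg: "g \<otimes> g = g"
  proof -
    have "g \<otimes> g = (\<one> \<ominus> f) \<otimes> g" by (simp add: g_def)
    also have "\<dots> = g \<ominus> f \<otimes> g" using f(1) gc by (simp add: minus_eq l_distr l_minus)
    finally show ?thesis unfolding fg using gc by (simp add: minus_eq)
  qed
  have "g \<in> J"
  proof (rule ccontr)
    assume "g \<notin> J"
    then obtain e where e: "prim e" "g \<otimes> e = e" "e \<otimes> g = e" using exists_prim[OF gc gg] by blast
    have ec: "e \<in> carrier R" "e \<otimes> e = e" "e \<notin> J" using e(1) by (auto simp: prim_def)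
    have fe: "f \<otimes> e = \<zero>" using e(2) fg(1) f(1) gc ec(1) by (metis m_assoc l_null)
    have ef: "e \<otimes> f = \<zero>" using e(3) fg(2) f(1) gc ec(1) by (metis m_assoc r_null)
    have ae: "a \<otimes> e = \<zero>" "e \<otimes> a = \<zero>" if a: "a \<in> A" for a
    proof -
      have ac: "a \<in> carrier R" "a \<otimes> f = a" "f \<otimes> a = a"
        using a orth_carrier[OF A(1)] total_remove_orth(3,4)[OF A(1) a] unfolding f_def by auto
      show "a \<otimes> e = \<zero>" using ac fe f(1) ec(1) by (metis m_assoc r_null)
      show "e \<otimes> a = \<zero>" using ac ef f(1) ec(1) by (metis m_assoc l_null)
    qed
    have eA: "e \<notin> A" using ae[of e] ec left_ideal_zero[OF Jl] by auto
    have A': "orth (insert e A)" using A(1) e(1) ae unfolding orth_def by auto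
    have tot: "total (insert e A) = e \<oplus> f"
      using total_remove[OF A', of e] eA unfolding f_def by simp
    define K where "K = PIdl (total (insert e A)) <+>\<^bsub>R\<^esub> J"
    have K: "left_ideal K R" "e \<oplus> f \<in> K" "J \<subseteq> K"
      using lid[OF A'] unfolding K_def tot by auto
    have KG: "K \<in> G" unfolding K_def G_def using A' by blast
    have "f \<otimes> (e \<oplus> f) = f" "e \<otimes> (e \<oplus> f) = e" using f ec fe ef by (simp_all add: r_distr)
    hence fK: "f \<in> K" and eK: "e \<in> K"
      using left_ideal_mult[OF K(1) f(1) K(2)] left_ideal_mult[OF K(1) ec(1) K(2)] by simp_all
    have "P \<subseteq> K"
      unfolding A(2) by (rule set_add_subset[OF K(1)])
        (use cgenideal_subset_iff[OF K(1) f(1)] fK K(3) in \<open>auto simp: f_def\<close>)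
    moreover have "e \<notin> P"
    proof
      assume "e \<in> P"
      then obtain q j where q: "q \<in> PIdl f" "j \<in> J" "e = q \<oplus> j" unfolding A(2) f_def[symmetric] mem_set_add by blast
      then obtain s where s: "s \<in> carrier R" "q = s \<otimes> f" unfolding mem_cgenideal by blast
      have jc: "j \<in> carrier R" by (rule J_carrier[OF q(2)])
      have "e = (s \<otimes> f \<oplus> j) \<otimes> e" using ec(2) q(3) s(2) by simp
      also have "\<dots> = s \<otimes> (f \<otimes> e) \<oplus> j \<otimes> e" using s(1) f(1) jc ec(1) by (simp add: l_distr m_assoc)
      also have "\<dots> = j \<otimes> e" unfolding fe using s(1) jc ec(1) by simp
      finally show False using J_rmult[OF ec(1) q(2)] ec(3) by simp
    qed
    ultimately have "P \<subset> K" using eK by blast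
    hence "K \<notin> G" using max[of K] K(1) lid[OF A(1)] unfolding A(2) by simp
    thus False using KG by simp
  qed
  hence "g = \<zero>" using nilpotent_fixes_zero[OF gc J_nilpotent gc] gg by simp
  hence "f = \<one>" unfolding g_def using f(1) by simp
  thus thesis using that[OF A(1)] by (simp add: f_def)
qed

lemma left_morphic_special: "left_morphic R"
proof (rule left_morphicI)
  fix a assume a: "a \<in> carrier R"
  obtain A where A: "orth A" "total A = \<one>" by (rule exists_orth_total_one)
  obtain b where "morphic_pair \<one> \<one> a b"
    using orth_morphic_pair[OF A(1) A(1) refl a] A(2) a by auto
  hence "b \<in> carrier R"
    "\<forall>z\<in>carrier R. z \<otimes> a = \<zero> \<longleftrightarrow> (\<exists>s\<in>carrier R. z = s \<otimes> b)"
    "\<forall>z\<in>carrier R. z \<otimes> b = \<zero> \<longleftrightarrow> (\<exists>s\<in>carrier R. z = s \<otimes> a)"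
    by (auto simp: morphic_pair_def)
  thus "\<exists>b\<in>carrier R. (\<forall>x\<in>carrier R. x \<in> PIdl a \<longleftrightarrow> x \<otimes> b = \<zero>) \<and>
      (\<forall>x\<in>carrier R. x \<in> PIdl b \<longleftrightarrow> x \<otimes> a = \<zero>)"
    unfolding mem_cgenideal by blast
qed

theorem morphic_special: "morphic_ring R"
  unfolding morphic_ring_def
  using left_morphic_special special_ring.left_morphic_special[OF opposite] by simp

end

section \<open>Morphic rings with T-nilpotent radical\<close>

context ring
begin

section \<open>Annihilator calculus in morphic rings\<close>

lemma left_morphicE:
  assumes "left_morphic R" "a \<in> carrier R"
  obtains b where "b \<in> carrier R"
    "\<And>x. x \<in> carrier R \<Longrightarrow> x \<in> PIdl a \<longleftrightarrow> x \<otimes> b = \<zero>"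
    "\<And>x. x \<in> carrier R \<Longrightarrow> x \<in> PIdl b \<longleftrightarrow> x \<otimes> a = \<zero>"
proof -
  obtain b where b: "b \<in> carrier R" "PIdl a = left_annihilator R b" "left_annihilator R a = PIdl b"
    using assms left_morphic_element_iff[OF assms(2)] unfolding left_morphic_def by blast
  show thesis
    by (rule that[OF b(1)]) (simp_all add: b(2) b(3)[symmetric] mem_left_annihilator)
qed

text \<open>The partner \<open>b\<close> of \<open>a\<close> satisfies \<open>ab = 0\<close>, so it
  is among the elements \<open>y\<close> on which \<open>x\<close> is tested, and
  \<open>xb = 0\<close> already means that \<open>x\<close> lies in \<open>Ra\<close>.\<close>

lemma left_morphic_double_annihilator:
  assumes lm: "left_morphic R" and a: "a \<in> carrier R" and x: "x \<in> carrier R"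
    and *: "\<And>y. y \<in> carrier R \<Longrightarrow> a \<otimes> y = \<zero> \<Longrightarrow> x \<otimes> y = \<zero>"
  shows "x \<in> PIdl a"
proof -
  obtain b where b: "b \<in> carrier R" "\<And>x. x \<in> carrier R \<Longrightarrow> x \<in> PIdl a \<longleftrightarrow> x \<otimes> b = \<zero>"
    using left_morphicE[OF lm a] by metis
  have "a \<otimes> b = \<zero>" using b(2)[OF a] cgenideal_self[OF a] by simp
  thus ?thesis using b(2)[OF x] *[OF b(1)] by simp
qed

text \<open>If \<open>Ra\<close> and \<open>Rbu\<close> are the left annihilators of
  \<open>u\<close> and \<open>d\<close>, then \<open>yud = 0\<close> says that
  \<open>yu = sbu\<close> for some \<open>s\<close>, that is, \<open>y - sb\<close> lies in
  \<open>Ra\<close>. So the sum is the left annihilator of \<open>ud\<close>, which is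
  principal.\<close>

lemma left_morphic_sum:
  assumes lm: "left_morphic R" and a: "a \<in> carrier R" and b: "b \<in> carrier R"
  obtains c where "c \<in> carrier R" "PIdl a <+>\<^bsub>R\<^esub> PIdl b = PIdl c"
proof -
  obtain u where u: "u \<in> carrier R" "\<And>x. x \<in> carrier R \<Longrightarrow> x \<in> PIdl a \<longleftrightarrow> x \<otimes> u = \<zero>"
    using left_morphicE[OF lm a] by metis
  have bu: "b \<otimes> u \<in> carrier R" using b u by simp
  obtain d where d: "d \<in> carrier R" "\<And>x. x \<in> carrier R \<Longrightarrow> x \<in> PIdl (b \<otimes> u) \<longleftrightarrow> x \<otimes> d = \<zero>"
    using left_morphicE[OF lm bu] by metis
  have ud: "u \<otimes> d \<in> carrier R" using u d by simp
  obtain c where c: "c \<in> carrier R" "\<And>x. x \<in> carrier R \<Longrightarrow> x \<in> PIdl c \<longleftrightarrow> x \<otimes> (u \<otimes> d) = \<zero>"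
    using left_morphicE[OF lm ud] by metis
  have "PIdl a <+>\<^bsub>R\<^esub> PIdl b = PIdl c"
  proof
    have "a \<otimes> u = \<zero>" using u(2)[OF a] cgenideal_self[OF a] by simp
    hence "a \<otimes> (u \<otimes> d) = \<zero>" using a u d by (simp flip: m_assoc)
    hence "a \<in> PIdl c" using c(2)[OF a] by simp
    moreover have "b \<otimes> u \<otimes> d = \<zero>" using d(2)[OF bu] cgenideal_self[OF bu] by simp
    hence "b \<otimes> (u \<otimes> d) = \<zero>" using b u(1) d(1) by (simp add: m_assoc)
    hence "b \<in> PIdl c" using c(2)[OF b] by simp
    ultimately show "PIdl a <+>\<^bsub>R\<^esub> PIdl b \<subseteq> PIdl c"
      using cgenideal_subset_iff[OF left_ideal_cgenideal[OF c(1)]] a b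
      by (intro set_add_subset left_ideal_cgenideal c(1)) simp_all
  next
    show "PIdl c \<subseteq> PIdl a <+>\<^bsub>R\<^esub> PIdl b"
    proof
      fix y assume y: "y \<in> PIdl c"
      have yc: "y \<in> carrier R" by (rule left_ideal_carrier[OF left_ideal_cgenideal[OF c(1)] y])
      have "y \<otimes> u \<otimes> d = \<zero>" using c(2)[OF yc] y yc u(1) d(1) by (simp add: m_assoc)
      hence "y \<otimes> u \<in> PIdl (b \<otimes> u)" using d(2)[of "y \<otimes> u"] yc u(1) by simp
      then obtain s where s: "s \<in> carrier R" "y \<otimes> u = s \<otimes> (b \<otimes> u)" unfolding mem_cgenideal by blast
      have "(y \<ominus> s \<otimes> b) \<otimes> u = y \<otimes> u \<ominus> s \<otimes> (b \<otimes> u)" using yc s(1) b u(1) by algebra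
      hence "(y \<ominus> s \<otimes> b) \<otimes> u = \<zero>" using s b u(1) by simp
      hence "y \<ominus> s \<otimes> b \<in> PIdl a" using u(2)[of "y \<ominus> s \<otimes> b"] yc s(1) b by simp
      moreover have "s \<otimes> b \<in> PIdl b" using s(1) by (auto simp: mem_cgenideal)
      moreover have "y = (y \<ominus> s \<otimes> b) \<oplus> s \<otimes> b" using yc s(1) b by algebra
      ultimately show "y \<in> PIdl a <+>\<^bsub>R\<^esub> PIdl b" unfolding mem_set_add by blast
    qed
  qed
  thus thesis using that c(1) by blast
qed

text \<open>If \<open>Rb\<close> is the left annihilator of \<open>d\<close>, then \<open>sa\<close>
  lies in \<open>Rb\<close> exactly when \<open>s\<close> annihilates \<open>ad\<close>. These
  \<open>s\<close> form a principal left ideal \<open>Re\<close>, and the intersection is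
  \<open>Rea\<close>.\<close>

lemma left_morphic_Int:
  assumes lm: "left_morphic R" and a: "a \<in> carrier R" and b: "b \<in> carrier R"
  obtains c where "c \<in> carrier R" "PIdl a \<inter> PIdl b = PIdl c"
proof -
  obtain d where d: "d \<in> carrier R" "\<And>x. x \<in> carrier R \<Longrightarrow> x \<in> PIdl b \<longleftrightarrow> x \<otimes> d = \<zero>"
    using left_morphicE[OF lm b] by metis
  have ad: "a \<otimes> d \<in> carrier R" using a d by simp
  obtain e where e: "e \<in> carrier R" "\<And>x. x \<in> carrier R \<Longrightarrow> x \<in> PIdl e \<longleftrightarrow> x \<otimes> (a \<otimes> d) = \<zero>"
    using left_morphicE[OF lm ad] by metis
  have ec: "e \<in> PIdl e" by (rule cgenideal_self[OF e(1)])
  have "x \<in> PIdl a \<inter> PIdl b \<longleftrightarrow> x \<in> PIdl (e \<otimes> a)" for x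
  proof
    assume "x \<in> PIdl a \<inter> PIdl b"
    hence xa: "x \<in> PIdl a" and xb: "x \<in> PIdl b" by blast+
    obtain s where s: "s \<in> carrier R" "x = s \<otimes> a" using xa unfolding mem_cgenideal by blast
    have "x \<otimes> d = \<zero>" using d(2)[of x] xb m_closed[OF s(1) a] unfolding s(2) by simp
    hence "s \<otimes> (a \<otimes> d) = \<zero>" unfolding s(2) using s(1) a d(1) by (simp add: m_assoc)
    hence "s \<in> PIdl e" using e(2)[OF s(1)] by simp
    then obtain t where t: "t \<in> carrier R" "s = t \<otimes> e" unfolding mem_cgenideal by blast
    have "x = t \<otimes> (e \<otimes> a)" unfolding s(2) t(2) using t(1) e(1) a by (simp add: m_assoc)
    thus "x \<in> PIdl (e \<otimes> a)" unfolding mem_cgenideal using t(1) by blast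
  next
    assume "x \<in> PIdl (e \<otimes> a)"
    then obtain t where t: "t \<in> carrier R" "x = t \<otimes> (e \<otimes> a)" unfolding mem_cgenideal by blast
    have "e \<otimes> (a \<otimes> d) = \<zero>" using e(2)[OF e(1)] ec by simp
    moreover have "x \<otimes> d = t \<otimes> (e \<otimes> (a \<otimes> d))" unfolding t(2) using t(1) e(1) a d(1) by (simp add: m_assoc)
    ultimately have "x \<otimes> d = \<zero>" using t(1) by simp
    moreover have "x \<in> carrier R" unfolding t(2) using t(1) e(1) a by simp
    ultimately have "x \<in> PIdl b" using d(2) by blast
    moreover have "x = (t \<otimes> e) \<otimes> a" unfolding t(2) using t(1) e(1) a by (simp add: m_assoc)
    hence "x \<in> PIdl a" unfolding mem_cgenideal using t(1) e(1) by blast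
    ultimately show "x \<in> PIdl a \<inter> PIdl b" by blast
  qed
  hence "PIdl a \<inter> PIdl b = PIdl (e \<otimes> a)" by blast
  thus thesis using that[of "e \<otimes> a"] e(1) a by simp
qed

section \<open>Consequences of T-nilpotence\<close>

lemma foldr_mult_closed: "set xs \<subseteq> carrier R \<Longrightarrow> foldr (\<otimes>) xs \<one> \<in> carrier R"
  by (induction xs) auto

lemma foldr_mult_append:
  "set xs \<subseteq> carrier R \<Longrightarrow> set ys \<subseteq> carrier R \<Longrightarrow>
    foldr (\<otimes>) (xs @ ys) \<one> = foldr (\<otimes>) xs \<one> \<otimes> foldr (\<otimes>) ys \<one>"
  by (induction xs) (auto simp: foldr_mult_closed m_assoc)

lemma T_nilpotent_nilpotent:
  assumes J: "J \<subseteq> carrier R" "left_T_nilpotent J R" and j: "j \<in> J"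
  shows "\<exists>n::nat. j [^] n = \<zero>"
proof -
  have jc: "j \<in> carrier R" using J j by blast
  have "foldr (\<otimes>) (replicate n j) \<one> = j [^] n" for n
    by (induction n) (use nat_pow_Suc2[OF jc] in \<open>simp_all del: nat_pow_Suc\<close>)
  hence "foldr (\<otimes>) (map (\<lambda>_. j) [0..<n]) \<one> = j [^] n" for n
    by (simp add: map_replicate_const)
  moreover obtain n where "foldr (\<otimes>) (map (\<lambda>_. j) [0..<n]) \<one> = \<zero>"
    using J(2) j unfolding left_T_nilpotent_def by meson
  ultimately show ?thesis by metis
qed

text \<open>If every nonzero \<open>cs\<close> survived multiplication by some element of
  \<open>J\<close>, radical factors could be appended on the right forever without the product
  becoming zero. T-nilpotence forbids this, as its products grow in the same direction.\<close>

lemma T_nilpotent_essential: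
  assumes J: "J \<subseteq> carrier R" "left_T_nilpotent J R" and c: "c \<in> carrier R" "c \<noteq> \<zero>"
  obtains s where "s \<in> carrier R" "c \<otimes> s \<noteq> \<zero>" "\<And>j. j \<in> J \<Longrightarrow> c \<otimes> s \<otimes> j = \<zero>"
proof (rule ccontr)
  assume "\<not> thesis"
  hence "\<forall>s. s \<in> carrier R \<and> c \<otimes> s \<noteq> \<zero> \<longrightarrow> (\<exists>j. j \<in> J \<and> c \<otimes> s \<otimes> j \<noteq> \<zero>)"
    using that by blast
  then obtain h where h: "\<And>s. s \<in> carrier R \<Longrightarrow> c \<otimes> s \<noteq> \<zero> \<Longrightarrow> h s \<in> J \<and> c \<otimes> s \<otimes> h s \<noteq> \<zero>"
    by metis
  \<comment> \<open>\<open>s n\<close> is the product of the first \<open>n\<close> chosen radical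
    elements, each chosen in dependence on the product before it.\<close>
  define s where "s = rec_nat \<one> (\<lambda>_ x. x \<otimes> h x)"
  have s0: "s 0 = \<one>" and sS: "s (Suc n) = s n \<otimes> h (s n)" for n by (simp_all add: s_def)
  have s: "s n \<in> carrier R \<and> c \<otimes> s n \<noteq> \<zero>" for n
  proof (induction n)
    case 0
    then show ?case using c s0 by simp
  next
    case (Suc n)
    hence "h (s n) \<in> carrier R" using h J(1) by blast
    thus ?case using Suc h[of "s n"] c(1) by (simp add: sS m_assoc)
  qed
  hence hJ: "h (s n) \<in> J" for n using h by blast
  have "foldr (\<otimes>) (map (\<lambda>n. h (s n)) [0..<n]) \<one> = s n" for n
  proof (induction n)
    case (Suc n)
    have "foldr (\<otimes>) (map (\<lambda>n. h (s n)) [0..<n] @ [h (s n)]) \<one> = s n \<otimes> h (s n)"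
      using hJ J(1) by (subst foldr_mult_append) (auto simp: Suc subset_iff)
    thus ?case by (simp add: sS)
  qed (simp add: s0)
  moreover obtain n where "foldr (\<otimes>) (map (\<lambda>n. h (s n)) [0..<n]) \<one> = \<zero>"
    using J(2) hJ unfolding left_T_nilpotent_def by meson
  ultimately have "s n = \<zero>" by metis
  thus False using s[of n] c(1) by simp
qed

text \<open>Some \<open>z\<close> in the right ideal \<open>cR\<close> generates a minimal right ideal, because \<open>cR\<close> contains a nonzero
  element killed by \<open>J\<close> on the right.  By the annihilator duality of morphic rings the left annihilator of
  \<open>z\<close> is then a maximal left ideal.\<close>

lemma morphic_maximal_annihilator:
  assumes J: "ideal J R" and lss: "left_semisimple_mod J R" and rss: "left_semisimple_mod J (opposite_ring R)"
    and T: "left_T_nilpotent J R" and lm: "left_morphic R" and rm: "left_morphic (opposite_ring R)"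
    and c: "c \<in> carrier R" "c \<noteq> \<zero>"
  obtains z x where "z \<in> carrier R" "z \<noteq> \<zero>" "x \<in> carrier R"
    "\<And>y. y \<in> carrier R \<Longrightarrow> y \<otimes> c = \<zero> \<Longrightarrow> y \<otimes> z = \<zero>"
    "\<And>y. y \<in> carrier R \<Longrightarrow> y \<in> PIdl x \<longleftrightarrow> y \<otimes> z = \<zero>" "J \<subseteq> PIdl x"
proof -
  have Jl: "left_ideal J R" and Jr: "left_ideal J (opposite_ring R)"
    using J ideal_iff_left_ideal by blast+
  have Jc: "J \<subseteq> carrier R" using left_ideal_carrier[OF Jl] by blast
  obtain s where s: "s \<in> carrier R" "c \<otimes> s \<noteq> \<zero>" "\<And>j. j \<in> J \<Longrightarrow> c \<otimes> s \<otimes> j = \<zero>"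
    using T_nilpotent_essential[OF Jc T c] by blast
  define y0 where "y0 = c \<otimes> s"
  have y0: "y0 \<in> carrier R" "y0 \<noteq> \<zero>" "\<And>j. j \<in> J \<Longrightarrow> y0 \<otimes> j = \<zero>"
    unfolding y0_def using s c by auto
  \<comment> \<open>Since \<open>y0\<close> kills \<open>J\<close>, multiplication by
    \<open>y0\<close> factors through \<open>R/J\<close>, where right ideals satisfy the minimum
    condition. Minimality of \<open>I\<close> among those not killed by \<open>y0\<close> makes
    \<open>z = y0 i\<close> generate a minimal right ideal.\<close>
  define G where "G = {I. left_ideal I (opposite_ring R) \<and> J \<subseteq> I \<and> (\<exists>i\<in>I. y0 \<otimes> i \<noteq> \<zero>)}"
  have "carrier R \<in> G"
    unfolding G_def using ring.left_ideal_carrier_R[OF ring_opposite] Jc y0 by (auto intro!: bexI[of _ \<one>])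
  then obtain I where I: "I \<in> G" and min: "\<And>K. (K, I) \<in> {(K, I). left_ideal K (opposite_ring R) \<and>
      left_ideal I (opposite_ring R) \<and> J \<subseteq> K \<and> K \<subset> I} \<Longrightarrow> K \<notin> G"
    by (rule wfE_min[OF ring.left_dcc_mod[OF ring_opposite ideal_opposite[OF J] rss], simplified opposite_ring_simps, OF lss]) blast
  have Ir: "left_ideal I (opposite_ring R)" and JI: "J \<subseteq> I" using I by (auto simp: G_def)
  obtain i where i: "i \<in> I" "y0 \<otimes> i \<noteq> \<zero>" using I by (auto simp: G_def)
  have ic: "i \<in> carrier R" using left_ideal_carrier[OF Ir i(1)] by simp
  define z where "z = y0 \<otimes> i"
  have zc: "z \<in> carrier R" and z0: "z \<noteq> \<zero>" unfolding z_def using y0 ic i by auto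
  have zmin: "\<exists>w\<in>carrier R. z = z \<otimes> t \<otimes> w" if t: "t \<in> carrier R" "z \<otimes> t \<noteq> \<zero>" for t
  proof -
    have itc: "i \<otimes> t \<in> carrier (opposite_ring R)" using ic t by simp
    have l: "left_ideal (PIdl\<^bsub>opposite_ring R\<^esub> (i \<otimes> t)) (opposite_ring R)"
      by (rule ring.left_ideal_cgenideal[OF ring_opposite itc])
    define K where "K = PIdl\<^bsub>opposite_ring R\<^esub> (i \<otimes> t) <+>\<^bsub>R\<^esub> J"
    have K: "left_ideal K (opposite_ring R)" "J \<subseteq> K" "i \<otimes> t \<in> K"
      unfolding K_def
      using ring.left_ideal_set_add[OF ring_opposite l Jr] ring.subset_set_add[OF ring_opposite l Jr]
        ring.cgenideal_self[OF ring_opposite itc] by auto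
    have "i \<otimes> t \<in> I" using left_ideal_mult[OF Ir, of t i] t i by simp
    hence "K \<subseteq> I"
      unfolding K_def using ring.set_add_subset[OF ring_opposite Ir _ JI]
        ring.cgenideal_subset_iff[OF ring_opposite Ir itc] by simp
    moreover have "y0 \<otimes> (i \<otimes> t) \<noteq> \<zero>" using t y0 ic unfolding z_def by (simp add: m_assoc)
    hence "K \<in> G" unfolding G_def using K by blast
    ultimately have "K = I" using min[of K] K Ir by blast
    hence "i \<in> K" using i by simp
    then obtain q j where q: "q \<in> PIdl\<^bsub>opposite_ring R\<^esub> (i \<otimes> t)" "j \<in> J" "i = q \<oplus> j"
      unfolding K_def mem_set_add by blast
    then obtain w where w: "w \<in> carrier R" "q = i \<otimes> t \<otimes> w" unfolding mem_cgenideal by auto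
    have jc: "j \<in> carrier R" using q(2) Jc by blast
    have "z = y0 \<otimes> (q \<oplus> j)" unfolding z_def using q(3) by simp
    also have "\<dots> = y0 \<otimes> q" using y0 jc q(2) w ic t by (simp add: r_distr)
    also have "\<dots> = z \<otimes> t \<otimes> w" unfolding w z_def using y0(1) ic t(1) w(1) by (simp add: m_assoc)
    finally show ?thesis using w(1) by blast
  qed
  obtain x where x: "x \<in> carrier R" "\<And>y. y \<in> carrier R \<Longrightarrow> y \<in> PIdl x \<longleftrightarrow> y \<otimes> z = \<zero>"
    using left_morphicE[OF lm zc] by metis
  have max: "\<exists>u\<in>carrier R. \<exists>v\<in>carrier R. \<one> = u \<oplus> v \<otimes> y \<and> u \<otimes> z = \<zero>"
    if y: "y \<in> carrier R" "y \<otimes> z \<noteq> \<zero>" for y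
  proof -
    obtain b where b: "b \<in> carrier R" "PIdl x <+>\<^bsub>R\<^esub> PIdl y = PIdl b"
      by (rule left_morphic_sum[OF lm x(1) y(1)])
    obtain d where d: "d \<in> carrier R" "\<And>y. y \<in> carrier R \<Longrightarrow> y \<in> PIdl b \<longleftrightarrow> y \<otimes> d = \<zero>"
      using left_morphicE[OF lm b(1)] by metis
    note sub = subset_set_add[OF left_ideal_cgenideal[OF x(1)] left_ideal_cgenideal[OF y(1)], unfolded b(2)]
    have yd: "y \<otimes> d = \<zero>" using d(2)[OF y(1)] sub(2) cgenideal_self[OF y(1)] by blast
    \<comment> \<open>Here morphicity of the opposite ring enters: whatever annihilates
      \<open>z\<close> annihilates \<open>d\<close>, so \<open>d\<close> is a right multiple of
      \<open>z\<close>. If \<open>d\<close> were nonzero, minimality of \<open>zR\<close> would give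
      \<open>z\<close> in \<open>dR\<close>, and \<open>y\<close> would kill
      \<open>z\<close>.\<close>
    have "d \<in> PIdl\<^bsub>opposite_ring R\<^esub> z"
    proof (rule ring.left_morphic_double_annihilator[OF ring_opposite rm]; simp add: zc d(1))
      fix w assume w: "w \<in> carrier R" "w \<otimes> z = \<zero>"
      hence "w \<in> PIdl b" using x(2)[OF w(1)] sub(1) by blast
      thus "w \<otimes> d = \<zero>" using d(2)[OF w(1)] by simp
    qed
    then obtain t where t: "t \<in> carrier R" "d = z \<otimes> t" unfolding mem_cgenideal by auto
    have "d = \<zero>"
    proof (rule ccontr)
      assume "d \<noteq> \<zero>"
      then obtain w where w: "w \<in> carrier R" "z = d \<otimes> w" using zmin[OF t(1)] t(2) by auto
      have "y \<otimes> z = (y \<otimes> d) \<otimes> w" unfolding w(2) using y(1) d(1) w(1) by (simp add: m_assoc)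
      thus False using y(2) yd w(1) by simp
    qed
    hence "\<one> \<in> PIdl x <+>\<^bsub>R\<^esub> PIdl y" unfolding b(2) using d(2)[of \<one>] by simp
    then obtain u q where u: "u \<in> PIdl x" "q \<in> PIdl y" "\<one> = u \<oplus> q" unfolding mem_set_add by blast
    obtain v where v: "v \<in> carrier R" "q = v \<otimes> y" using u(2) unfolding mem_cgenideal by blast
    have uc: "u \<in> carrier R" by (rule left_ideal_carrier[OF left_ideal_cgenideal[OF x(1)] u(1)])
    show ?thesis using uc v u x(2)[OF uc] by blast
  qed
  have "j \<in> PIdl x" if j: "j \<in> J" for j
  proof (rule ccontr)
    assume "j \<notin> PIdl x"
    have jc: "j \<in> carrier R" using j Jc by blast
    hence "j \<otimes> z \<noteq> \<zero>" using x(2)[OF jc] \<open>j \<notin> PIdl x\<close> by simp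
    then obtain u v where u: "u \<in> carrier R" "v \<in> carrier R" "\<one> = u \<oplus> v \<otimes> j" "u \<otimes> z = \<zero>"
      using max[OF jc] by blast
    have vj: "v \<otimes> j \<in> J" by (rule left_ideal_mult[OF Jl u(2) j])
    obtain n :: nat where n: "(v \<otimes> j) [^] n = \<zero>" using T_nilpotent_nilpotent[OF Jc T vj] by blast
    have "z = (u \<oplus> v \<otimes> j) \<otimes> z" using u(3)[symmetric] zc by simp
    also have "\<dots> = (v \<otimes> j) \<otimes> z" using u jc zc by (simp add: l_distr)
    finally have "z = \<zero>" using nilpotent_fixes_zero[OF _ n zc] u(2) jc by simp
    thus False using z0 by simp
  qed
  moreover have "y \<otimes> z = \<zero>" if "y \<in> carrier R" "y \<otimes> c = \<zero>" for y
  proof -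
    have "y \<otimes> z = (y \<otimes> c) \<otimes> (s \<otimes> i)" unfolding z_def y0_def using that(1) c(1) s(1) ic by (simp add: m_assoc)
    thus ?thesis using that(2) s(1) ic by simp
  qed
  ultimately show thesis using that[OF zc z0 x(1)] x(2) by blast
qed

text \<open>Take \<open>Ra\<close> minimal among the principal left ideals above \<open>J\<close>,
  with generator \<open>e\<close> modulo \<open>J\<close>. If \<open>1 - e\<close> is not left
  invertible, it kills some nonzero \<open>z\<close> whose annihilator \<open>Rx\<close> contains
  \<open>J\<close>. As \<open>Ra\<close> meets \<open>Rx\<close> in a principal ideal, minimality
  gives that \<open>e\<close> kills \<open>z\<close> too, which is absurd. So \<open>1 - e\<close>
  is left invertible, and since \<open>(1 - e)e\<close> lies in \<open>J\<close>, so do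
  \<open>e\<close> and \<open>Ra\<close>.\<close>

lemma morphic_radical_principal:
  assumes J: "ideal J R" and lss: "left_semisimple_mod J R" and rss: "left_semisimple_mod J (opposite_ring R)"
    and T: "left_T_nilpotent J R" and lm: "left_morphic R" and rm: "left_morphic (opposite_ring R)"
  obtains p where "p \<in> carrier R" "J = PIdl p"
proof -
  have Jl: "left_ideal J R" and Jr: "left_ideal J (opposite_ring R)"
    using J ideal_iff_left_ideal by blast+
  have Jc: "J \<subseteq> carrier R" using left_ideal_carrier[OF Jl] by blast
  define G where "G = {PIdl a | a. a \<in> carrier R \<and> J \<subseteq> PIdl a}"
  have "PIdl \<one> \<in> G" unfolding G_def using Jc by (intro CollectI exI[of _ \<one>]) simp
  then obtain I where I: "I \<in> G"
    and min: "\<And>K. (K, I) \<in> {(K, I). left_ideal K R \<and> left_ideal I R \<and> J \<subseteq> K \<and> K \<subset> I} \<Longrightarrow> K \<notin> G"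
    by (rule wfE_min[OF left_dcc_mod[OF J lss rss]]) blast
  obtain a where a: "a \<in> carrier R" "J \<subseteq> PIdl a" "I = PIdl a" using I unfolding G_def by blast
  have al: "left_ideal (PIdl a) R" by (rule left_ideal_cgenideal[OF a(1)])
  obtain e where e: "e \<in> PIdl a" "\<And>x. x \<in> PIdl a \<Longrightarrow> x \<ominus> x \<otimes> e \<in> J"
    using left_semisimple_modE[OF lss al a(2)] by blast
  have ec: "e \<in> carrier R" by (rule left_ideal_carrier[OF al e(1)])
  define b where "b = \<one> \<ominus> e"
  have bc: "b \<in> carrier R" unfolding b_def using ec by simp
  have "b \<otimes> e = e \<ominus> e \<otimes> e" unfolding b_def using ec by (simp add: minus_eq l_distr l_minus)
  hence be: "b \<otimes> e \<in> J" using e(2)[OF e(1)] by simp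
  obtain c where c: "c \<in> carrier R" "\<And>x. x \<in> carrier R \<Longrightarrow> x \<in> PIdl b \<longleftrightarrow> x \<otimes> c = \<zero>"
    using left_morphicE[OF lm bc] by metis
  have bc0: "b \<otimes> c = \<zero>" using c(2)[OF bc] cgenideal_self[OF bc] by simp
  have "c = \<zero>"
  proof (rule ccontr)
    assume c0: "c \<noteq> \<zero>"
    obtain z x where z: "z \<in> carrier R" "z \<noteq> \<zero>" and x: "x \<in> carrier R"
      and cz: "\<And>y. y \<in> carrier R \<Longrightarrow> y \<otimes> c = \<zero> \<Longrightarrow> y \<otimes> z = \<zero>"
      and xz: "\<And>y. y \<in> carrier R \<Longrightarrow> y \<in> PIdl x \<longleftrightarrow> y \<otimes> z = \<zero>" and Jx: "J \<subseteq> PIdl x"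
      by (rule morphic_maximal_annihilator[OF J lss rss T lm rm c(1) c0]) blast
    obtain d where d: "d \<in> carrier R" "PIdl a \<inter> PIdl x = PIdl d"
      by (rule left_morphic_Int[OF lm a(1) x])
    have "PIdl d \<in> G" unfolding G_def using d a(2) Jx by blast
    moreover have "J \<subseteq> PIdl d" using d a(2) Jx by blast
    ultimately have "\<not> PIdl d \<subset> I" using min[of "PIdl d"] left_ideal_cgenideal[OF d(1)] al a(3) by blast
    hence "PIdl a \<subseteq> PIdl x" using d(2) a(3) by blast
    hence "e \<otimes> z = \<zero>" using e(1) xz[OF ec] by blast
    moreover have "b \<otimes> z = \<zero>" by (rule cz[OF bc bc0])
    moreover have "z = e \<otimes> z \<oplus> b \<otimes> z"
    proof -
      have "e \<otimes> z \<oplus> b \<otimes> z = (e \<oplus> b) \<otimes> z" using ec bc z(1) by (simp add: l_distr)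
      moreover have "e \<oplus> b = \<one>" unfolding b_def using ec by algebra
      ultimately show ?thesis using z(1) by simp
    qed
    ultimately show False using z by simp
  qed
  hence "\<one> \<in> PIdl b" using c(2)[of \<one>] by simp
  then obtain s where s: "s \<in> carrier R" "\<one> = s \<otimes> b" unfolding mem_cgenideal by blast
  have "e = s \<otimes> (b \<otimes> e)" using s bc ec by (metis l_one m_assoc)
  hence eJ: "e \<in> J" using left_ideal_mult[OF Jl s(1) be] by simp
  have "PIdl a \<subseteq> J"
  proof
    fix x assume x: "x \<in> PIdl a"
    have xc: "x \<in> carrier R" by (rule left_ideal_carrier[OF al x])
    show "x \<in> J" using left_ideal_minus_iff[OF Jl left_ideal_mult[OF Jl xc eJ] xc] e(2)[OF x] by simp
  qed
  thus thesis using that a by blast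
qed

text \<open>\<open>layer p L i\<close> is the image of \<open>L \<inter> Rp\<^sup>i\<close> in \<open>Rp\<^sup>i / Rp\<^sup>i\<^sup>+\<^sup>1\<close>, pulled back along \<open>s \<mapsto> sp\<^sup>i\<close>.\<close>

definition layer :: "'a \<Rightarrow> 'a set \<Rightarrow> nat \<Rightarrow> 'a set" where
  "layer p L i = {s \<in> carrier R. \<exists>l\<in>L. s \<otimes> p [^] i \<ominus> l \<in> PIdl (p [^] Suc i)}"

lemma layer_left_ideal:
  assumes p: "p \<in> carrier R" and L: "left_ideal L R"
  shows "left_ideal (layer p L i) R" "PIdl p \<subseteq> layer p L i"
proof -
  note Lc = left_ideal_carrier[OF L]
  have pc: "p [^] n \<in> carrier R" for n :: nat using p by simp
  have P: "left_ideal (PIdl (p [^] Suc i)) R" by (rule left_ideal_cgenideal[OF pc])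
  show "left_ideal (layer p L i) R"
  proof (rule left_idealI)
    show "layer p L i \<subseteq> carrier R" by (auto simp: layer_def)
    show "\<zero> \<in> layer p L i"
      using left_ideal_zero[OF L] left_ideal_zero[OF P] pc
      by (auto simp: layer_def minus_eq intro!: bexI[of _ \<zero>])
  next
    fix x y assume "x \<in> layer p L i" "y \<in> layer p L i"
    then obtain k l where x: "x \<in> carrier R" "k \<in> L" "x \<otimes> p [^] i \<ominus> k \<in> PIdl (p [^] Suc i)"
      and y: "y \<in> carrier R" "l \<in> L" "y \<otimes> p [^] i \<ominus> l \<in> PIdl (p [^] Suc i)"
      unfolding layer_def by blast
    have "(x \<oplus> y) \<otimes> p [^] i \<ominus> (k \<oplus> l) = (x \<otimes> p [^] i \<ominus> k) \<oplus> (y \<otimes> p [^] i \<ominus> l)"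
      using x(1) y(1) Lc[OF x(2)] Lc[OF y(2)] pc[of i] by algebra
    hence "(x \<oplus> y) \<otimes> p [^] i \<ominus> (k \<oplus> l) \<in> PIdl (p [^] Suc i)"
      using left_ideal_add[OF P x(3) y(3)] by (simp only:)
    thus "x \<oplus> y \<in> layer p L i"
      using left_ideal_add[OF L x(2) y(2)] a_closed[OF x(1) y(1)] unfolding layer_def by blast
  next
    fix r x assume r: "r \<in> carrier R" and "x \<in> layer p L i"
    then obtain k where x: "x \<in> carrier R" "k \<in> L" "x \<otimes> p [^] i \<ominus> k \<in> PIdl (p [^] Suc i)"
      unfolding layer_def by blast
    have "r \<otimes> x \<otimes> p [^] i \<ominus> r \<otimes> k = r \<otimes> (x \<otimes> p [^] i \<ominus> k)"
      using r x(1) Lc[OF x(2)] pc[of i] by algebra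
    hence "r \<otimes> x \<otimes> p [^] i \<ominus> r \<otimes> k \<in> PIdl (p [^] Suc i)"
      using left_ideal_mult[OF P r x(3)] by (simp only:)
    thus "r \<otimes> x \<in> layer p L i"
      using left_ideal_mult[OF L r x(2)] m_closed[OF r x(1)] unfolding layer_def by blast
  qed
  show "PIdl p \<subseteq> layer p L i"
  proof
    fix x assume "x \<in> PIdl p"
    then obtain s where s: "s \<in> carrier R" "x = s \<otimes> p" unfolding mem_cgenideal by blast
    have "x \<otimes> p [^] i \<ominus> \<zero> = s \<otimes> p [^] Suc i"
      unfolding s(2) using s(1) p nat_pow_Suc2[OF p, of i] by (simp add: minus_eq m_assoc)
    hence "x \<otimes> p [^] i \<ominus> \<zero> \<in> PIdl (p [^] Suc i)" using s(1) unfolding mem_cgenideal by blast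
    thus "x \<in> layer p L i" using left_ideal_zero[OF L] m_closed[OF s(1) p]
      unfolding layer_def s(2) by blast
  qed
qed

lemma layer_mono: "L \<subseteq> L' \<Longrightarrow> layer p L i \<subseteq> layer p L' i"
  by (auto simp: layer_def)

text \<open>Downward induction on \<open>i\<close>: an element of \<open>L'\<close> in
  \<open>Rp^i\<close> agrees with one of \<open>L\<close> up to \<open>Rp^(i+1)\<close>, and the
  difference is again in \<open>L'\<close>. The descent starts from \<open>p^n = 0\<close>.\<close>

lemma layer_determines:
  assumes p: "p \<in> carrier R" "p [^] (n::nat) = \<zero>" and L: "left_ideal L R" "left_ideal L' R" "L \<subseteq> L'"
    and sub: "\<And>i. i < n \<Longrightarrow> layer p L' i \<subseteq> layer p L i"
  shows "L' \<subseteq> L"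
proof -
  have "\<forall>x. x \<in> L' \<longrightarrow> x \<in> PIdl (p [^] i) \<longrightarrow> x \<in> L" if "i \<le> n" for i
    using that
  proof (induction i rule: inc_induct)
    case base
    show ?case using left_ideal_zero[OF L(1)] unfolding mem_cgenideal p(2) by auto
  next
    case (step i)
    show ?case
    proof (intro allI impI)
      fix x assume x: "x \<in> L'" "x \<in> PIdl (p [^] i)"
      have xc: "x \<in> carrier R" by (rule left_ideal_carrier[OF L(2) x(1)])
      obtain s where s: "s \<in> carrier R" "x = s \<otimes> p [^] i" using x(2) unfolding mem_cgenideal by blast
      have pSi: "p [^] Suc i \<in> carrier R" using p(1) by simp
      have "s \<otimes> p [^] i \<ominus> x \<in> PIdl (p [^] Suc i)"
        unfolding s(2)[symmetric] using xc left_ideal_zero[OF left_ideal_cgenideal[OF pSi]]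
        by (simp add: minus_eq r_neg)
      hence "s \<in> layer p L' i" unfolding layer_def using s(1) x(1) by blast
      hence "s \<in> layer p L i" using sub step.hyps by blast
      then obtain l where l: "l \<in> L" "x \<ominus> l \<in> PIdl (p [^] Suc i)" unfolding layer_def s(2) by blast
      have "x \<ominus> l \<in> L'" by (rule left_ideal_minus[OF L(2) x(1)]) (use l(1) L(3) in blast)
      hence "x \<ominus> l \<in> L" using step.IH l(2) by blast
      thus "x \<in> L" using left_ideal_minus_iff[OF L(1) l(1) xc] by simp
    qed
  qed
  from this[of 0] show ?thesis using left_ideal_carrier[OF L(2)] by auto
qed

text \<open>A left ideal is determined within a larger one by its \<open>n\<close> layers, and each
  layer is a left ideal above \<open>J\<close>. So descending chains become stationary layer by
  layer. For principality, a generator of each layer is lifted to some \<open>l i\<close> in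
  \<open>L\<close>; by \<open>left_morphic_sum\<close> these lie in one principal ideal inside
  \<open>L\<close>, and it has the same layers as \<open>L\<close>.\<close>

lemma morphic_left_artinian_principal:
  assumes J: "ideal J R" and lss: "left_semisimple_mod J R" and rss: "left_semisimple_mod J (opposite_ring R)"
    and lm: "left_morphic R" and p: "p \<in> carrier R" "J = PIdl p" "p [^] (n::nat) = \<zero>"
  shows "left_artinian R" "left_principal_ring R"
proof -
  show "left_artinian R"
    unfolding left_artinian_def
  proof (intro allI impI)
    fix I :: "nat \<Rightarrow> 'a set"
    assume *: "(\<forall>n. left_ideal (I n) R) \<and> (\<forall>n. I (Suc n) \<subseteq> I n)"
    hence I: "left_ideal (I k) R" for k by blast
    have anti: "I l \<subseteq> I k" if "k \<le> l" for k l
      using lift_Suc_antimono_le[of I k l] * that by blast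
    note lay = layer_left_ideal[OF p(1) I, folded p(2)]
    have "\<exists>N. \<forall>k\<ge>N. layer p (I k) i = layer p (I N) i" for i
    proof -
      obtain P where P: "P \<in> range (\<lambda>k. layer p (I k) i)"
        and min: "\<And>K. (K, P) \<in> {(K, I). left_ideal K R \<and> left_ideal I R \<and> J \<subseteq> K \<and> K \<subset> I} \<Longrightarrow>
          K \<notin> range (\<lambda>k. layer p (I k) i)"
        by (rule wfE_min[OF left_dcc_mod[OF J lss rss], of _ "range (\<lambda>k. layer p (I k) i)"]) blast+
      then obtain N where N: "P = layer p (I N) i" by blast
      have "layer p (I k) i = layer p (I N) i" if "k \<ge> N" for k
      proof (rule ccontr)
        assume "layer p (I k) i \<noteq> layer p (I N) i"
        hence "layer p (I k) i \<subset> P" using layer_mono[OF anti[OF that]] N by blast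
        hence "layer p (I k) i \<notin> range (\<lambda>k. layer p (I k) i)" using min lay N by blast
        thus False by blast
      qed
      thus ?thesis by blast
    qed
    then obtain N where N: "\<And>i k. k \<ge> N i \<Longrightarrow> layer p (I k) i = layer p (I (N i)) i" by metis
    \<comment> \<open>Inserting zero keeps the set nonempty when \<open>n = 0\<close>.\<close>
    define M where "M = Max (insert 0 (N ` {..<n}))"
    have M: "N i \<le> M" if "i < n" for i unfolding M_def using that by simp
    have "I k = I M" if k: "k \<ge> M" for k
    proof
      show "I k \<subseteq> I M" by (rule anti[OF k])
      show "I M \<subseteq> I k"
      proof (rule layer_determines[OF p(1,3) I I anti[OF k]])
        fix i assume "i < n"
        hence "N i \<le> M" "N i \<le> k" using M k by force+
        thus "layer p (I M) i \<subseteq> layer p (I k) i" using N[of i M] N[of i k] by simp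
      qed
    qed
    thus "\<exists>N. \<forall>n\<ge>N. I n = I N" by blast
  qed
  show "left_principal_ring R"
    unfolding left_principal_ring_def
  proof (intro allI impI)
    fix L assume L: "left_ideal L R"
    note Lc = left_ideal_carrier[OF L]
    note lay = layer_left_ideal[OF p(1) L, folded p(2)]
    have "\<exists>e l. l \<in> L \<and> e \<in> carrier R \<and> e \<otimes> p [^] i \<ominus> l \<in> PIdl (p [^] Suc i) \<and>
      (\<forall>s\<in>layer p L i. s \<ominus> s \<otimes> e \<in> J)" for i
    proof -
      obtain e where e: "e \<in> layer p L i" "\<And>x. x \<in> layer p L i \<Longrightarrow> x \<ominus> x \<otimes> e \<in> J"
        using left_semisimple_modE[OF lss lay] by blast
      obtain l where "l \<in> L" "e \<in> carrier R" "e \<otimes> p [^] i \<ominus> l \<in> PIdl (p [^] Suc i)"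
        using e(1) unfolding layer_def by blast
      thus ?thesis using e(2) by blast
    qed
    then obtain e l where l: "\<And>i. l i \<in> L" and e: "\<And>i. e i \<in> carrier R"
      "\<And>i. e i \<otimes> p [^] i \<ominus> l i \<in> PIdl (p [^] Suc i)"
      "\<And>i s. s \<in> layer p L i \<Longrightarrow> s \<ominus> s \<otimes> e i \<in> J" by metis
    have "\<exists>c\<in>L. \<forall>i<k. l i \<in> PIdl c" for k
    proof (induction k)
      case 0
      show ?case using left_ideal_zero[OF L] by blast
    next
      case (Suc k)
      then obtain c where c: "c \<in> L" "\<forall>i<k. l i \<in> PIdl c" by blast
      obtain d where d: "d \<in> carrier R" "PIdl c <+>\<^bsub>R\<^esub> PIdl (l k) = PIdl d"
        by (rule left_morphic_sum[OF lm Lc[OF c(1)] Lc[OF l[of k]]])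
      note sub = subset_set_add[OF left_ideal_cgenideal[OF Lc[OF c(1)]] left_ideal_cgenideal[OF Lc[OF l[of k]]], unfolded d(2)]
      have "PIdl d \<subseteq> L"
        unfolding d(2)[symmetric]
        using cgenideal_subset_iff[OF L Lc[OF c(1)]] cgenideal_subset_iff[OF L Lc[OF l[of k]]] c(1) l[of k]
        by (intro set_add_subset[OF L]) simp_all
      hence "d \<in> L" using cgenideal_self[OF d(1)] by blast
      moreover have "l i \<in> PIdl d" if "i < Suc k" for i
      proof (cases "i = k")
        case True
        thus ?thesis using sub(2) cgenideal_self[OF Lc[OF l[of k]]] by blast
      next
        case False
        hence "i < k" using that by simp
        thus ?thesis using c(2) sub(1) by blast
      qed
      ultimately show ?case by blast
    qed
    then obtain c where c: "c \<in> L" "\<forall>i<n. l i \<in> PIdl c" by blast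
    note cc = Lc[OF c(1)]
    note cl = left_ideal_cgenideal[OF cc]
    have cL: "PIdl c \<subseteq> L" using cgenideal_subset_iff[OF L cc] c(1) by simp
    have "L \<subseteq> PIdl c"
    proof (rule layer_determines[OF p(1,3) cl L cL])
      fix i assume i: "i < n"
      have pi: "p [^] i \<in> carrier R" "p [^] Suc i \<in> carrier R" using p(1) by auto
      note Pl = left_ideal_cgenideal[OF pi(2)]
      show "layer p L i \<subseteq> layer p (PIdl c) i"
      proof
        fix s assume s: "s \<in> layer p L i"
        have sc: "s \<in> carrier R" using s by (simp add: layer_def)
        have lc: "l i \<in> carrier R" by (rule Lc[OF l])
        have "s \<ominus> s \<otimes> e i \<in> PIdl p" using e(3)[OF s] p(2) by simp
        then obtain t where t: "t \<in> carrier R" "s \<ominus> s \<otimes> e i = t \<otimes> p" unfolding mem_cgenideal by blast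
        have "(s \<ominus> s \<otimes> e i) \<otimes> p [^] i = t \<otimes> p [^] Suc i"
          unfolding t(2) using t(1) p(1) nat_pow_Suc2[OF p(1), of i] by (simp add: m_assoc)
        hence 1: "(s \<ominus> s \<otimes> e i) \<otimes> p [^] i \<in> PIdl (p [^] Suc i)" using t(1) unfolding mem_cgenideal by blast
        have 2: "s \<otimes> (e i \<otimes> p [^] i \<ominus> l i) \<in> PIdl (p [^] Suc i)"
          by (rule left_ideal_mult[OF Pl sc e(2)])
        have "s \<otimes> p [^] i \<ominus> s \<otimes> l i = (s \<ominus> s \<otimes> e i) \<otimes> p [^] i \<oplus> s \<otimes> (e i \<otimes> p [^] i \<ominus> l i)"
          using sc e(1)[of i] lc pi(1) by algebra
        hence "s \<otimes> p [^] i \<ominus> s \<otimes> l i \<in> PIdl (p [^] Suc i)" using left_ideal_add[OF Pl 1 2] by simp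
        moreover have "s \<otimes> l i \<in> PIdl c" using left_ideal_mult[OF cl sc] c(2) i by blast
        ultimately show "s \<in> layer p (PIdl c) i" unfolding layer_def using sc by blast
      qed
    qed
    thus "\<exists>a\<in>carrier R. L = PIdl a" using cL cc by blast
  qed
qed

text \<open>As \<open>J\<close> is two-sided and equal to \<open>Rp\<close>, a factor from
  \<open>J\<close> to the right of \<open>p^k\<close> produces one more \<open>p\<close> there. So a
  product of \<open>n\<close> radical elements, in the reversed order too, lies in
  \<open>Rp^n\<close>.\<close>

lemma radical_T_nilpotent_opposite:
  assumes J: "ideal J R" and p: "p \<in> carrier R" "J = PIdl p" "p [^] (n::nat) = \<zero>"
  shows "left_T_nilpotent J (opposite_ring R)"
  unfolding left_T_nilpotent_def
proof (intro allI impI exI)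
  have Jl: "left_ideal J R" and Jr: "left_ideal J (opposite_ring R)"
    using J ideal_iff_left_ideal by blast+
  fix r :: "nat \<Rightarrow> 'a" assume r: "\<forall>i. r i \<in> J"
  have pJ: "p \<in> J" unfolding p(2) by (rule cgenideal_self[OF p(1)])
  have pow: "p [^] k \<otimes> x \<in> PIdl (p [^] Suc k)" if x: "x \<in> J" for k :: nat and x
  proof (induction k)
    case 0
    then show ?case using x p left_ideal_carrier[OF Jl x] by simp
  next
    case (Suc k)
    then obtain t where t: "t \<in> carrier R" "p [^] k \<otimes> x = t \<otimes> p [^] Suc k" unfolding mem_cgenideal by blast
    have "p \<otimes> t \<in> J" using left_ideal_mult[OF Jr, of t p] t(1) pJ by simp
    then obtain u where u: "u \<in> carrier R" "p \<otimes> t = u \<otimes> p" unfolding p(2) mem_cgenideal by blast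
    have "p [^] Suc k \<otimes> x = p \<otimes> (p [^] k \<otimes> x)"
      using nat_pow_Suc2[OF p(1), of k] p(1) left_ideal_carrier[OF Jl x] by (simp add: m_assoc del: nat_pow_Suc)
    also have "\<dots> = (p \<otimes> t) \<otimes> p [^] Suc k" unfolding t(2) using t(1) p(1) by (simp add: m_assoc)
    also have "\<dots> = u \<otimes> (p \<otimes> p [^] Suc k)" unfolding u(2) using u(1) p(1) by (simp add: m_assoc)
    also have "\<dots> = u \<otimes> p [^] Suc (Suc k)" using nat_pow_Suc2[OF p(1), of "Suc k"] by simp
    finally show ?case using u(1) unfolding mem_cgenideal by blast
  qed
  have "foldr (mult (opposite_ring R)) xs \<one> \<in> PIdl (p [^] length xs)" if "set xs \<subseteq> J" for xs
    using that
  proof (induction xs)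
    case (Cons x xs)
    then obtain s where s: "s \<in> carrier R" "foldr (mult (opposite_ring R)) xs \<one> = s \<otimes> p [^] length xs"
      unfolding mem_cgenideal by auto
    have x: "x \<in> J" using Cons by simp
    have "foldr (mult (opposite_ring R)) (x # xs) \<one> = s \<otimes> (p [^] length xs \<otimes> x)"
      using s p(1) left_ideal_carrier[OF Jl x] by (simp add: m_assoc)
    thus ?case
      using left_ideal_mult[OF left_ideal_cgenideal[OF nat_pow_closed[OF p(1)]] s(1) pow[OF x, of "length xs"]]
      unfolding length_Cons by (simp only:)
  qed simp
  from this[of "map r [0..<n]"] have "foldr (mult (opposite_ring R)) (map r [0..<n]) \<one> \<in> PIdl \<zero>"
    using r p(3) by auto
  thus "foldr (\<otimes>\<^bsub>opposite_ring R\<^esub>) (map r [0..<n]) \<one>\<^bsub>opposite_ring R\<^esub> = \<zero>\<^bsub>opposite_ring R\<^esub>"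
    by (auto simp: mem_cgenideal)
qed

text \<open>The sides are not treated symmetrically: the left generator \<open>p\<close> must be
  found first, since its nilpotence supplies the T-nilpotence that the search for a right generator
  \<open>q\<close> requires.\<close>

theorem morphic_artinian_principal:
  assumes J: "ideal J R" and lss: "left_semisimple_mod J R" and rss: "left_semisimple_mod J (opposite_ring R)"
    and T: "left_T_nilpotent J R" and morph: "morphic_ring R"
  shows "artinian_ring R" "principal_ring R"
proof -
  have lm: "left_morphic R" and rm: "left_morphic (opposite_ring R)" using morph by (auto simp: morphic_ring_def)
  have Jl: "left_ideal J R" using J ideal_iff_left_ideal by blast
  have Jc: "J \<subseteq> carrier R" using left_ideal_carrier[OF Jl] by blast
  obtain p where p: "p \<in> carrier R" "J = PIdl p" by (rule morphic_radical_principal[OF J lss rss T lm rm])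
  obtain n :: nat where n: "p [^] n = \<zero>"
    using T_nilpotent_nilpotent[OF Jc T] p cgenideal_self[OF p(1)] by blast
  note left = morphic_left_artinian_principal[OF J lss rss lm p n]
  note T' = radical_T_nilpotent_opposite[OF J p n]
  note J' = ideal_opposite[OF J]
  obtain q where q: "q \<in> carrier R" "J = PIdl\<^bsub>opposite_ring R\<^esub> q"
    using ring.morphic_radical_principal[OF ring_opposite J' rss _ T' rm] lss lm by auto
  obtain k :: nat where k: "q [^] k = \<zero>"
    using T_nilpotent_nilpotent[OF Jc T, of q] q ring.cgenideal_self[OF ring_opposite, of q] by auto
  note right = ring.morphic_left_artinian_principal[OF ring_opposite J' rss _ rm, of q k]
  show "artinian_ring R" "principal_ring R"
    using left right lss q k unfolding artinian_ring_def principal_ring_def by simp_all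
qed

end

section \<open>Indecomposable principal rings\<close>

context ring
begin

text \<open>Write \<open>b = ta\<close>.  Left multiplication by \<open>t\<close> maps \<open>aR\<close> onto \<open>I\<close>, and by the ascending chain
  condition on right ideals it is injective on \<open>I\<close>.\<close>

lemma ideal_same_generator:
  assumes rp: "left_principal_ring (opposite_ring R)" and I: "ideal I R"
    and a: "a \<in> carrier R" "I = PIdl a" and b: "b \<in> carrier R" "I = PIdl\<^bsub>opposite_ring R\<^esub> b"
  shows "I = PIdl\<^bsub>opposite_ring R\<^esub> a"
proof -
  have Il: "left_ideal I R" and Ir: "left_ideal I (opposite_ring R)"
    using I ideal_iff_left_ideal by blast+
  note Ic = left_ideal_carrier[OF Il]
  have aI: "a \<in> I" unfolding a(2) by (rule cgenideal_self[OF a(1)])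
  have aR: "a \<otimes> r \<in> I" if "r \<in> carrier R" for r
    using left_ideal_mult[OF Ir, of r a] aI that by simp
  have "b \<in> I" unfolding b(2) using ring.cgenideal_self[OF ring_opposite, of b] b(1) by simp
  then obtain t where t: "t \<in> carrier R" "b = t \<otimes> a" unfolding a(2) mem_cgenideal by blast
  have surj: "\<exists>r\<in>carrier R. x = t \<otimes> (a \<otimes> r)" if x: "x \<in> I" for x
  proof -
    obtain r where "r \<in> carrier R" "x = b \<otimes> r" using x unfolding b(2) mem_cgenideal by auto
    thus ?thesis unfolding t(2) using t(1) a(1) by (auto simp: m_assoc)
  qed
  have tc: "t [^] n \<in> carrier R" for n :: nat using t(1) by simp
  have surj_pow: "\<exists>w\<in>I. x = t [^] n \<otimes> w" if "x \<in> I" for x and n :: nat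
    using that
  proof (induction n arbitrary: x)
    case 0
    then show ?case using Ic by (intro bexI[of _ x]) simp_all
  next
    case (Suc n)
    obtain r where r: "r \<in> carrier R" "x = t \<otimes> (a \<otimes> r)" using surj[OF Suc.prems] by blast
    obtain w where w: "w \<in> I" "a \<otimes> r = t [^] n \<otimes> w" using Suc.IH[OF aR[OF r(1)]] by blast
    have "x = t [^] Suc n \<otimes> w"
      unfolding r(2) w(2) using t(1) Ic[OF w(1)] nat_pow_Suc2[OF t(1), of n] by (simp add: m_assoc)
    thus ?case using w(1) by blast
  qed
  \<comment> \<open>The kernels of the powers of \<open>t\<close> on \<open>I\<close> are an
    ascending chain of right ideals. Their union is principal, so its generator, and with it the
    whole union, lies in one \<open>A N\<close>.\<close>
  define A where "A n = {y \<in> I. t [^] n \<otimes> y = \<zero>}" for n :: nat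
  have A_mono: "A n \<subseteq> A k" if "n \<le> k" for n k
  proof
    fix y assume y: "y \<in> A n"
    hence yI: "y \<in> I" and y0: "t [^] n \<otimes> y = \<zero>" by (auto simp: A_def)
    have "t [^] k = t [^] (k - n) \<otimes> t [^] n" using t(1) that by (simp add: nat_pow_mult)
    hence "t [^] k \<otimes> y = t [^] (k - n) \<otimes> (t [^] n \<otimes> y)" using tc Ic[OF yI] by (simp add: m_assoc)
    thus "y \<in> A k" using yI y0 tc by (simp add: A_def)
  qed
  define U where "U = (\<Union>n. A n)"
  have "left_ideal U (opposite_ring R)"
  proof (rule ring.left_idealI[OF ring_opposite]; simp?)
    show "U \<subseteq> carrier R" using Ic by (auto simp: U_def A_def)
    show "\<zero> \<in> U" using left_ideal_zero[OF Il] tc by (auto simp: U_def A_def)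
    show "x \<oplus> y \<in> U" if xy: "x \<in> U" "y \<in> U" for x y
    proof -
      obtain i j where "x \<in> A i" "y \<in> A j" using xy by (auto simp: U_def)
      hence "x \<in> A (max i j)" "y \<in> A (max i j)"
        using A_mono[of i "max i j"] A_mono[of j "max i j"] by auto
      hence "x \<oplus> y \<in> A (max i j)"
        using left_ideal_add[OF Il] tc Ic by (simp add: A_def r_distr)
      thus ?thesis by (auto simp: U_def)
    qed
    show "x \<otimes> r \<in> U" if r: "r \<in> carrier R" and x: "x \<in> U" for r x
    proof -
      obtain i :: nat where i: "x \<in> I" "t [^] i \<otimes> x = \<zero>" using x unfolding U_def A_def by blast
      have "t [^] i \<otimes> (x \<otimes> r) = (t [^] i \<otimes> x) \<otimes> r" using tc Ic[OF i(1)] r by (simp add: m_assoc)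
      hence "x \<otimes> r \<in> A i" using i r left_ideal_mult[OF Ir, of r x] by (simp add: A_def)
      thus ?thesis by (auto simp: U_def)
    qed
  qed
  then obtain u where u: "u \<in> carrier R" "U = PIdl\<^bsub>opposite_ring R\<^esub> u"
    using rp unfolding left_principal_ring_def by auto
  have "u \<in> U" unfolding u(2) using ring.cgenideal_self[OF ring_opposite, of u] u(1) by simp
  then obtain N where N: "u \<in> A N" by (auto simp: U_def)
  have stab: "t [^] N \<otimes> w = \<zero>" if w: "w \<in> I" "t [^] Suc N \<otimes> w = \<zero>" for w
  proof -
    have "w \<in> U" unfolding U_def A_def using w by blast
    then obtain r where r: "r \<in> carrier R" "w = u \<otimes> r" unfolding u(2) mem_cgenideal by auto
    have "t [^] N \<otimes> w = (t [^] N \<otimes> u) \<otimes> r" unfolding r(2) using tc u(1) r(1) by (simp add: m_assoc)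
    thus ?thesis using N r(1) by (simp add: A_def)
  qed
  \<comment> \<open>The argument of Fitting's lemma: by surjectivity \<open>y\<close> has the form
    \<open>t^N w\<close>, and a \<open>w\<close> in \<open>I\<close> killed by
    \<open>t^(N+1)\<close> is already killed by \<open>t^N\<close>.\<close>
  have inj: "y = \<zero>" if y: "y \<in> I" "t \<otimes> y = \<zero>" for y
  proof -
    obtain w where w: "w \<in> I" "y = t [^] N \<otimes> w" using surj_pow[OF y(1)] by blast
    have "t [^] Suc N \<otimes> w = t \<otimes> y"
      unfolding w(2) using t(1) Ic[OF w(1)] nat_pow_Suc2[OF t(1), of N] by (simp add: m_assoc)
    thus ?thesis using stab[OF w(1)] y(2) w(2) by simp
  qed
  have "x \<in> PIdl\<^bsub>opposite_ring R\<^esub> a" if x: "x \<in> I" for x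
  proof -
    note xc = Ic[OF x]
    obtain r where r: "r \<in> carrier R" "t \<otimes> x = t \<otimes> (a \<otimes> r)"
      using surj[OF left_ideal_mult[OF Il t(1) x]] by blast
    have arc: "a \<otimes> r \<in> carrier R" using a(1) r(1) by simp
    have "t \<otimes> (x \<ominus> a \<otimes> r) = t \<otimes> x \<ominus> t \<otimes> (a \<otimes> r)" using t(1) xc arc by algebra
    hence "t \<otimes> (x \<ominus> a \<otimes> r) = \<zero>" unfolding r(2) using t(1) arc by simp
    hence "x \<ominus> a \<otimes> r = \<zero>" using inj left_ideal_minus[OF Il x aR[OF r(1)]] by blast
    hence "x = a \<otimes> r" using xc arc by simp
    thus ?thesis using r(1) by (auto simp: mem_cgenideal)
  qed
  moreover have "PIdl\<^bsub>opposite_ring R\<^esub> a \<subseteq> I" using aR by (auto simp: mem_cgenideal)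
  ultimately show ?thesis by blast
qed

lemma ideal_normal_generator:
  assumes pr: "principal_ring R" and I: "ideal I R"
  obtains a where "a \<in> carrier R" "I = PIdl a" "I = PIdl\<^bsub>opposite_ring R\<^esub> a"
proof -
  have lp: "left_principal_ring R" and rp: "left_principal_ring (opposite_ring R)"
    using pr by (auto simp: principal_ring_def)
  have Il: "left_ideal I R" and Ir: "left_ideal I (opposite_ring R)"
    using I ideal_iff_left_ideal by blast+
  obtain a where a: "a \<in> carrier R" "I = PIdl a" using lp Il unfolding left_principal_ring_def by blast
  obtain b where b: "b \<in> carrier R" "I = PIdl\<^bsub>opposite_ring R\<^esub> b"
    using rp Ir unfolding left_principal_ring_def by auto
  show thesis by (rule that[OF a ideal_same_generator[OF rp I a b]])
qed

text \<open>Normal factors can be rearranged at the price of extra factors on the right. Thus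
  \<open>k\<close> copies of \<open>b\<close> and of \<open>d\<close> are paired off, and each pair
  contributes one \<open>p\<close>. Applied with \<open>p^n = 0\<close>, this makes
  \<open>b^n d^n\<close> vanish.\<close>

lemma normal_pow_product:
  assumes c: "b \<in> carrier R" "d \<in> carrier R" "p \<in> carrier R"
    and b: "\<And>s. s \<in> carrier R \<Longrightarrow> \<exists>t\<in>carrier R. s \<otimes> b = b \<otimes> t"
    and d: "\<And>s. s \<in> carrier R \<Longrightarrow> \<exists>t\<in>carrier R. s \<otimes> d = d \<otimes> t"
    and p: "\<And>s. s \<in> carrier R \<Longrightarrow> \<exists>t\<in>carrier R. s \<otimes> p = p \<otimes> t"
    and bd: "\<exists>w\<in>carrier R. b \<otimes> d = d \<otimes> b \<otimes> w" and bdp: "\<exists>w\<in>carrier R. b \<otimes> d = p \<otimes> w"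
  shows "\<exists>v\<in>carrier R. b [^] (k::nat) \<otimes> d [^] k = p [^] k \<otimes> v"
proof -
  obtain w1 where w1: "w1 \<in> carrier R" "b \<otimes> d = d \<otimes> b \<otimes> w1" using bd by blast
  obtain u where u: "u \<in> carrier R" "b \<otimes> d = p \<otimes> u" using bdp by blast
  have pc: "b [^] k \<in> carrier R" "d [^] k \<in> carrier R" "p [^] k \<in> carrier R" for k :: nat using c by auto
  have swap: "\<exists>w\<in>carrier R. b [^] k \<otimes> d = d \<otimes> b [^] k \<otimes> w" for k :: nat
  proof (induction k)
    case 0
    then show ?case using c by (intro bexI[of _ \<one>]) simp_all
  next
    case (Suc k)
    then obtain w where w: "w \<in> carrier R" "b [^] k \<otimes> d = d \<otimes> b [^] k \<otimes> w" by blast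
    obtain w2 where w2: "w2 \<in> carrier R" "w1 \<otimes> b [^] k = b [^] k \<otimes> w2" using normal_pow[OF c(1) b w1(1)] by blast
    have "b [^] Suc k \<otimes> d = b \<otimes> (b [^] k \<otimes> d)" using c pc nat_pow_Suc2[OF c(1), of k] by (simp add: m_assoc del: nat_pow_Suc)
    also have "\<dots> = (b \<otimes> d) \<otimes> (b [^] k \<otimes> w)" unfolding w(2) using c pc w(1) by (simp add: m_assoc)
    also have "\<dots> = d \<otimes> b \<otimes> (w1 \<otimes> b [^] k) \<otimes> w" unfolding w1(2) using c pc w(1) w1(1) by (simp add: m_assoc)
    also have "\<dots> = d \<otimes> (b \<otimes> b [^] k) \<otimes> (w2 \<otimes> w)" unfolding w2(2) using c pc w(1) w2(1) by (simp add: m_assoc)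
    also have "\<dots> = d \<otimes> b [^] Suc k \<otimes> (w2 \<otimes> w)" using nat_pow_Suc2[OF c(1), of k] by simp
    finally show ?case using w(1) w2(1) by blast
  qed
  show ?thesis
  proof (induction k)
    case 0
    then show ?case by auto
  next
    case (Suc k)
    then obtain v where v: "v \<in> carrier R" "b [^] k \<otimes> d [^] k = p [^] k \<otimes> v" by blast
    obtain w where w: "w \<in> carrier R" "b [^] k \<otimes> d = d \<otimes> b [^] k \<otimes> w" using swap by blast
    obtain w' where w': "w' \<in> carrier R" "w \<otimes> d [^] k = d [^] k \<otimes> w'" using normal_pow[OF c(2) d w(1)] by blast
    obtain u' where u': "u' \<in> carrier R" "u \<otimes> p [^] k = p [^] k \<otimes> u'" using normal_pow[OF c(3) p u(1)] by blast
    have "b [^] Suc k \<otimes> d [^] Suc k = b \<otimes> (b [^] k \<otimes> d) \<otimes> d [^] k"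
      using c pc nat_pow_Suc2[OF c(1), of k] nat_pow_Suc2[OF c(2), of k] by (simp add: m_assoc del: nat_pow_Suc)
    also have "\<dots> = (b \<otimes> d) \<otimes> b [^] k \<otimes> (w \<otimes> d [^] k)" unfolding w(2) using c pc w(1) by (simp add: m_assoc)
    also have "\<dots> = (b \<otimes> d) \<otimes> (b [^] k \<otimes> d [^] k) \<otimes> w'" unfolding w'(2) using c pc w'(1) by (simp add: m_assoc)
    also have "\<dots> = p \<otimes> (u \<otimes> p [^] k) \<otimes> (v \<otimes> w')" unfolding v(2) u(2) using c pc u(1) v(1) w'(1) by (simp add: m_assoc)
    also have "\<dots> = (p \<otimes> p [^] k) \<otimes> (u' \<otimes> (v \<otimes> w'))" unfolding u'(2) using c pc u'(1) v(1) w'(1) by (simp add: m_assoc)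
    also have "\<dots> = p [^] Suc k \<otimes> (u' \<otimes> (v \<otimes> w'))" using nat_pow_Suc2[OF c(3), of k] by simp
    finally show ?case using u'(1) v(1) w'(1) by blast
  qed
qed

text \<open>Insert \<open>\<one> = sa + k\<close> between \<open>t\<close> and \<open>a^i\<close>;
  since \<open>K\<close> is two-sided, it absorbs the new term containing \<open>k\<close>.\<close>

lemma coprime_pow:
  assumes K: "ideal K R" and a: "a \<in> carrier R" and s: "s \<in> carrier R" "k \<in> K" "\<one> = s \<otimes> a \<oplus> k"
  shows "\<exists>t\<in>carrier R. \<exists>l\<in>K. \<one> = t \<otimes> a [^] (i::nat) \<oplus> l"
proof (induction i)
  have Kl: "left_ideal K R" and Kr: "left_ideal K (opposite_ring R)" using K ideal_iff_left_ideal by blast+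
  note Kc = left_ideal_carrier[OF Kl]
  {
    case 0
    show ?case using left_ideal_zero[OF Kl] by (intro bexI[of _ \<one>] bexI[of _ \<zero>]) simp_all
  next
    case (Suc i)
    then obtain t l where t: "t \<in> carrier R" "l \<in> K" "\<one> = t \<otimes> a [^] i \<oplus> l" by blast
    have ai: "a [^] i \<in> carrier R" using a by simp
    have "t \<otimes> (s \<otimes> a \<oplus> k) = t" using t(1) s(3)[symmetric] by simp
    hence "\<one> = t \<otimes> (s \<otimes> a \<oplus> k) \<otimes> a [^] i \<oplus> l" using t(3) by (simp only:)
    also have "\<dots> = (t \<otimes> s) \<otimes> (a \<otimes> a [^] i) \<oplus> (t \<otimes> k \<otimes> a [^] i \<oplus> l)"
      using t(1) s(1) Kc[OF s(2)] Kc[OF t(2)] a ai by (simp add: l_distr r_distr m_assoc a_assoc)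
    also have "\<dots> = (t \<otimes> s) \<otimes> a [^] Suc i \<oplus> (t \<otimes> k \<otimes> a [^] i \<oplus> l)" using nat_pow_Suc2[OF a, of i] by simp
    finally have 1: "\<one> = (t \<otimes> s) \<otimes> a [^] Suc i \<oplus> (t \<otimes> k \<otimes> a [^] i \<oplus> l)" .
    have tk: "t \<otimes> k \<in> K" by (rule left_ideal_mult[OF Kl t(1) s(2)])
    have "t \<otimes> k \<otimes> a [^] i \<in> K" using left_ideal_mult[OF Kr, of "a [^] i" "t \<otimes> k"] tk ai by simp
    hence "t \<otimes> k \<otimes> a [^] i \<oplus> l \<in> K" using left_ideal_add[OF Kl _ t(2)] by simp
    thus ?case using 1 t(1) s(1) by blast
  }
qed

text \<open>Modulo \<open>J\<close> the ideal \<open>P\<close> has the complement \<open>K\<close>.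
  Their generators satisfy \<open>b^n d^n = d^n b^n = 0\<close>, while these powers remain coprime.
  So one splits as \<open>u \<oplus> v\<close> with \<open>u\<close> in \<open>Rb^n\<close>,
  \<open>v\<close> in \<open>Rd^n\<close> and \<open>uRv = vRu = 0\<close>, which makes
  \<open>u\<close> a central idempotent. Its triviality forces \<open>P = J\<close> or
  \<open>P = R\<close>.\<close>

lemma indecomposable_radical_maximal:
  assumes pr: "principal_ring R" and J: "ideal J R" and lss: "left_semisimple_mod J R"
    and rss: "left_semisimple_mod J (opposite_ring R)"
    and p: "p \<in> carrier R" "J = PIdl p" "J = PIdl\<^bsub>opposite_ring R\<^esub> p" "p [^] (n::nat) = \<zero>" "n > 0"
    and ci: "no_nontrivial_central_idempotents R"
    and P: "ideal P R" "J \<subseteq> P"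
  shows "P = J \<or> P = carrier R"
proof -
  have Jl: "left_ideal J R" and Jr: "left_ideal J (opposite_ring R)" using J ideal_iff_left_ideal by blast+
  have Pl: "left_ideal P R" and Pr: "left_ideal P (opposite_ring R)" using P ideal_iff_left_ideal by blast+
  note Jc = left_ideal_carrier[OF Jl] and Pc = left_ideal_carrier[OF Pl]
  define K where "K = {s \<in> carrier R. \<forall>x\<in>P. x \<otimes> s \<in> J}"
  have K: "ideal K R"
  proof (rule ideal_intro)
    show "K \<subseteq> carrier R" by (auto simp: K_def)
    show "\<zero> \<in> K" using left_ideal_zero[OF Jl] Pc by (simp add: K_def)
    show "x \<oplus> y \<in> K" if "x \<in> K" "y \<in> K" for x y
      using that left_ideal_add[OF Jl] Pc by (simp add: K_def r_distr)
    show "r \<otimes> x \<in> K" if r: "r \<in> carrier R" and x: "x \<in> K" for r x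
    proof -
      have "y \<otimes> (r \<otimes> x) \<in> J" if y: "y \<in> P" for y
      proof -
        have "y \<otimes> r \<in> P" using left_ideal_mult[OF Pr, of r y] r y by simp
        hence "(y \<otimes> r) \<otimes> x \<in> J" using x by (simp add: K_def)
        thus ?thesis using Pc[OF y] r x by (simp add: K_def m_assoc)
      qed
      thus ?thesis using r x by (simp add: K_def)
    qed
    show "x \<otimes> r \<in> K" if r: "r \<in> carrier R" and x: "x \<in> K" for r x
    proof -
      have "y \<otimes> (x \<otimes> r) \<in> J" if y: "y \<in> P" for y
      proof -
        have "(y \<otimes> x) \<otimes> r \<in> J" using left_ideal_mult[OF Jr, of r "y \<otimes> x"] r x y by (simp add: K_def)
        thus ?thesis using Pc[OF y] r x by (simp add: K_def m_assoc)
      qed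
      thus ?thesis using r x by (simp add: K_def)
    qed
  qed
  have Kl: "left_ideal K R" and Kr: "left_ideal K (opposite_ring R)" using K ideal_iff_left_ideal by blast+
  note Kc = left_ideal_carrier[OF Kl]
  have PK: "x \<otimes> y \<in> J" if "x \<in> P" "y \<in> K" for x y using that by (simp add: K_def)
  obtain e where e: "e \<in> P" "\<And>x. x \<in> P \<Longrightarrow> x \<ominus> x \<otimes> e \<in> J"
    using left_semisimple_modE[OF lss Pl P(2)] by blast
  note ec = Pc[OF e(1)]
  obtain e' where e': "e' \<in> P" "\<And>x. x \<in> P \<Longrightarrow> x \<ominus> e' \<otimes> x \<in> J"
    using left_semisimple_modE[OF rss Pr P(2)] by auto
  have x1e: "x \<otimes> (\<one> \<ominus> e) = x \<ominus> x \<otimes> e" if "x \<in> carrier R" for x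
    using that ec by (simp add: minus_eq r_distr r_minus)
  have eK: "\<one> \<ominus> e \<in> K" unfolding K_def using e(2) x1e[OF Pc] ec by simp
  have JK: "J \<subseteq> K"
  proof
    fix x assume x: "x \<in> J"
    have "y \<otimes> x \<in> J" if "y \<in> P" for y by (rule left_ideal_mult[OF Jl Pc[OF that] x])
    thus "x \<in> K" unfolding K_def using Jc[OF x] by simp
  qed
  \<comment> \<open>\<open>K\<close> controls products whose left factor is in \<open>P\<close>, so
    \<open>x\<close> has to be compared with \<open>e' \<otimes> x\<close>, where \<open>e'\<close>
    is the left unit of \<open>P\<close> modulo \<open>J\<close>.\<close>
  have PK_J: "x \<in> J" if x: "x \<in> P" "x \<in> K" for x
    using left_ideal_minus_iff[OF Jl PK[OF e'(1) x(2)] Pc[OF x(1)]] e'(2)[OF x(1)] by simp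
  obtain b where b: "b \<in> carrier R" "P = PIdl b" "P = PIdl\<^bsub>opposite_ring R\<^esub> b"
    by (rule ideal_normal_generator[OF pr P(1)])
  obtain d where d: "d \<in> carrier R" "K = PIdl d" "K = PIdl\<^bsub>opposite_ring R\<^esub> d"
    by (rule ideal_normal_generator[OF pr K])
  note nb = normal_generator_swap[OF trans[OF b(2)[symmetric] b(3)]]
  note nd = normal_generator_swap[OF trans[OF d(2)[symmetric] d(3)]]
  note np = normal_generator_swap[OF trans[OF p(2)[symmetric] p(3)]]
  have bP: "b \<in> P" unfolding b(2) by (rule cgenideal_self[OF b(1)])
  have dK: "d \<in> K" unfolding d(2) by (rule cgenideal_self[OF d(1)])
  have bdJ: "b \<otimes> d \<in> J" by (rule PK[OF bP dK])
  have dbJ: "d \<otimes> b \<in> J"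
    using PK_J left_ideal_mult[OF Pl d(1) bP] left_ideal_mult[OF Kr, of b d] dK b(1) by simp
  \<comment> \<open>Since \<open>bd\<close> lies in \<open>Rb\<close>, write it as
    \<open>sb\<close>. Then \<open>s\<close> multiplies \<open>P\<close> into \<open>J\<close>,
    which puts \<open>s\<close> into \<open>K = dR\<close>, and normality of \<open>b\<close> moves
    the remaining factor to the right.\<close>
  have "\<exists>w\<in>carrier R. b \<otimes> d = d \<otimes> b \<otimes> w"
  proof -
    have "b \<otimes> d \<in> P" using bdJ P(2) by blast
    then obtain s where s: "s \<in> carrier R" "b \<otimes> d = s \<otimes> b" unfolding b(2) mem_cgenideal by blast
    have sP: "s \<otimes> x \<in> J" if x: "x \<in> P" for x
    proof -
      obtain r where r: "r \<in> carrier R" "x = b \<otimes> r" using x unfolding b(3) mem_cgenideal by auto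
      have "s \<otimes> x = (b \<otimes> d) \<otimes> r" unfolding r(2) s(2) using s(1) b(1) r(1) by (simp add: m_assoc)
      thus ?thesis using left_ideal_mult[OF Jr, of r "b \<otimes> d"] bdJ r(1) by simp
    qed
    have "s \<otimes> (\<one> \<ominus> e) \<in> K" by (rule left_ideal_mult[OF Kl s(1) eK])
    hence "s \<ominus> s \<otimes> e \<in> K" using x1e[OF s(1)] by simp
    hence "s \<in> K" using left_ideal_minus_iff[OF Kl _ s(1), of "s \<otimes> e"] sP[OF e(1)] JK by blast
    then obtain w where w: "w \<in> carrier R" "s = d \<otimes> w" unfolding d(3) mem_cgenideal by auto
    obtain w' where w': "w' \<in> carrier R" "w \<otimes> b = b \<otimes> w'" using nb(1)[OF w(1)] by blast
    have "b \<otimes> d = d \<otimes> (w \<otimes> b)" unfolding s(2) w(2) using d(1) w(1) b(1) by (simp add: m_assoc)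
    also have "\<dots> = d \<otimes> b \<otimes> w'" unfolding w'(2) using d(1) w'(1) b(1) by (simp add: m_assoc)
    finally show ?thesis using w'(1) by blast
  qed
  \<comment> \<open>Now \<open>db = td\<close>, and \<open>t\<close> lies in \<open>P\<close>
    because \<open>1 - e\<close> is in \<open>dR\<close>, so that \<open>t(1 - e)\<close> lies in
    \<open>dbR\<close> and hence in \<open>J\<close>.\<close>
  moreover have "\<exists>w\<in>carrier R. d \<otimes> b = b \<otimes> d \<otimes> w"
  proof -
    have "d \<otimes> b \<in> K" using dbJ JK by blast
    then obtain t where t: "t \<in> carrier R" "d \<otimes> b = t \<otimes> d" unfolding d(2) mem_cgenideal by blast
    obtain r where r: "r \<in> carrier R" "\<one> \<ominus> e = d \<otimes> r" using eK unfolding d(3) mem_cgenideal by auto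
    have "t \<otimes> (\<one> \<ominus> e) = (d \<otimes> b) \<otimes> r" unfolding t(2) r(2) using t(1) d(1) r(1) by (simp add: m_assoc)
    hence "t \<ominus> t \<otimes> e \<in> J" using x1e[OF t(1)] left_ideal_mult[OF Jr, of r "d \<otimes> b"] dbJ r(1) by simp
    hence "t \<ominus> t \<otimes> e \<in> P" using P(2) by blast
    hence "t \<in> P" using left_ideal_minus_iff[OF Pl left_ideal_mult[OF Pl t(1) e(1)] t(1)] by simp
    then obtain w where w: "w \<in> carrier R" "t = b \<otimes> w" unfolding b(3) mem_cgenideal by auto
    obtain w' where w': "w' \<in> carrier R" "w \<otimes> d = d \<otimes> w'" using nd(1)[OF w(1)] by blast
    have "d \<otimes> b = b \<otimes> (w \<otimes> d)" unfolding t(2) w(2) using d(1) w(1) b(1) by (simp add: m_assoc)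
    also have "\<dots> = b \<otimes> d \<otimes> w'" unfolding w'(2) using d(1) w'(1) b(1) by (simp add: m_assoc)
    finally show ?thesis using w'(1) by blast
  qed
  moreover have "\<exists>w\<in>carrier R. b \<otimes> d = p \<otimes> w" "\<exists>w\<in>carrier R. d \<otimes> b = p \<otimes> w"
    using bdJ dbJ unfolding p(3) mem_cgenideal by auto
  ultimately have "\<exists>v\<in>carrier R. b [^] n \<otimes> d [^] n = p [^] n \<otimes> v" "\<exists>v\<in>carrier R. d [^] n \<otimes> b [^] n = p [^] n \<otimes> v"
    using normal_pow_product[OF b(1) d(1) p(1) nb(1) nd(1) np(1)]
      normal_pow_product[OF d(1) b(1) p(1) nd(1) nb(1) np(1)] by blast+
  hence zero: "b [^] n \<otimes> d [^] n = \<zero>" "d [^] n \<otimes> b [^] n = \<zero>" unfolding p(4) by auto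
  have bn: "b [^] n \<in> carrier R" and dn: "d [^] n \<in> carrier R" using b(1) d(1) by auto
  have pull_b: "\<exists>t\<in>carrier R. b [^] n \<otimes> s = t \<otimes> b [^] n" if "s \<in> carrier R" for s
    using ring.normal_pow[OF ring_opposite, of b s n] nb(2) that b(1) by simp
  have pull_d: "\<exists>t\<in>carrier R. d [^] n \<otimes> s = t \<otimes> d [^] n" if "s \<in> carrier R" for s
    using ring.normal_pow[OF ring_opposite, of d s n] nd(2) that d(1) by simp
  obtain s0 where s0: "s0 \<in> carrier R" "e = s0 \<otimes> b" using e(1) unfolding b(2) mem_cgenideal by blast
  have "\<one> = e \<oplus> (\<one> \<ominus> e)" using ec by algebra
  then obtain s1 k1 where s1: "s1 \<in> carrier R" "k1 \<in> K" "\<one> = s1 \<otimes> b [^] n \<oplus> k1"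
    using coprime_pow[OF K b(1) s0(1) eK, of n] unfolding s0(2) by blast
  obtain t0 where t0: "t0 \<in> carrier R" "k1 = t0 \<otimes> d" using s1(2) unfolding d(2) mem_cgenideal by blast
  have bnl: "left_ideal (PIdl (b [^] n)) R" by (rule left_ideal_cgenideal[OF bn])
  \<comment> \<open>In the second use of \<open>coprime_pow\<close> the ideal generated by
    \<open>b^n\<close> plays the part of \<open>K\<close>, so it must be two-sided; normality of
    \<open>b\<close> provides this.\<close>
  have bni: "ideal (PIdl (b [^] n)) R"
    unfolding ideal_iff_left_ideal
  proof
    show "left_ideal (PIdl (b [^] n)) R" by (rule bnl)
    show "left_ideal (PIdl (b [^] n)) (opposite_ring R)"
    proof (rule ring.left_idealI[OF ring_opposite]; simp?)
      show "PIdl (b [^] n) \<subseteq> carrier R" using left_ideal_carrier[OF bnl] by blast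
      show "\<zero> \<in> PIdl (b [^] n)" by (rule left_ideal_zero[OF bnl])
      show "x \<oplus> y \<in> PIdl (b [^] n)" if "x \<in> PIdl (b [^] n)" "y \<in> PIdl (b [^] n)" for x y
        by (rule left_ideal_add[OF bnl that])
      fix r x assume r: "r \<in> carrier R" and "x \<in> PIdl (b [^] n)"
      then obtain q where q: "q \<in> carrier R" "x = q \<otimes> b [^] n" unfolding mem_cgenideal by blast
      obtain t where t: "t \<in> carrier R" "b [^] n \<otimes> r = t \<otimes> b [^] n" using pull_b[OF r] by blast
      have "x \<otimes> r = q \<otimes> (b [^] n \<otimes> r)" unfolding q(2) using q(1) bn r by (simp add: m_assoc)
      also have "\<dots> = (q \<otimes> t) \<otimes> b [^] n" unfolding t(2) using q(1) bn t(1) by (simp add: m_assoc)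
      finally show "x \<otimes> r \<in> PIdl (b [^] n)" unfolding mem_cgenideal using q(1) t(1) by blast
    qed
  qed
  have k1c: "k1 \<in> carrier R" by (rule Kc[OF s1(2)])
  have "\<one> = k1 \<oplus> s1 \<otimes> b [^] n" using s1(1,3) k1c bn a_comm by simp
  moreover have "s1 \<otimes> b [^] n \<in> PIdl (b [^] n)" using s1(1) by (auto simp: mem_cgenideal)
  ultimately obtain t l where t: "t \<in> carrier R" "l \<in> PIdl (b [^] n)" "\<one> = t \<otimes> d [^] n \<oplus> l"
    using coprime_pow[OF bni d(1) t0(1), of "s1 \<otimes> b [^] n" n] unfolding t0(2) by blast
  obtain s where s: "s \<in> carrier R" "l = s \<otimes> b [^] n" using t(2) unfolding mem_cgenideal by blast
  define u where "u = s \<otimes> b [^] n"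
  define v where "v = t \<otimes> d [^] n"
  have uc: "u \<in> carrier R" and vc: "v \<in> carrier R" unfolding u_def v_def using s(1) t(1) bn dn by auto
  have uv1: "\<one> = v \<oplus> u" unfolding u_def v_def using t(3) s(2) by simp
  \<comment> \<open>Normality moves \<open>b^n\<close> to the right until it meets
    \<open>d^n\<close>. Together with the mirror image this makes \<open>u\<close> idempotent and
    central.\<close>
  have uxv: "u \<otimes> x \<otimes> v = \<zero>" if x: "x \<in> carrier R" for x
  proof -
    obtain y where y: "y \<in> carrier R" "b [^] n \<otimes> (x \<otimes> t) = y \<otimes> b [^] n" using pull_b[of "x \<otimes> t"] x t(1) by auto
    have "u \<otimes> x \<otimes> v = s \<otimes> (b [^] n \<otimes> (x \<otimes> t)) \<otimes> d [^] n"
      unfolding u_def v_def using s(1) t(1) x bn dn by (simp add: m_assoc)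
    also have "\<dots> = s \<otimes> y \<otimes> (b [^] n \<otimes> d [^] n)" unfolding y(2) using s(1) y(1) bn dn by (simp add: m_assoc)
    finally show ?thesis unfolding zero using s(1) y(1) by simp
  qed
  have vxu: "v \<otimes> x \<otimes> u = \<zero>" if x: "x \<in> carrier R" for x
  proof -
    obtain y where y: "y \<in> carrier R" "d [^] n \<otimes> (x \<otimes> s) = y \<otimes> d [^] n" using pull_d[of "x \<otimes> s"] x s(1) by auto
    have "v \<otimes> x \<otimes> u = t \<otimes> (d [^] n \<otimes> (x \<otimes> s)) \<otimes> b [^] n"
      unfolding u_def v_def using s(1) t(1) x bn dn by (simp add: m_assoc)
    also have "\<dots> = t \<otimes> y \<otimes> (d [^] n \<otimes> b [^] n)" unfolding y(2) using t(1) y(1) bn dn by (simp add: m_assoc)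
    finally show ?thesis unfolding zero using t(1) y(1) by simp
  qed
  have xu: "x \<otimes> u = u \<otimes> x \<otimes> u" and ux: "u \<otimes> x = u \<otimes> x \<otimes> u" if x: "x \<in> carrier R" for x
  proof -
    have "x \<otimes> u = (v \<oplus> u) \<otimes> (x \<otimes> u)" using uv1[symmetric] x uc by simp
    also have "\<dots> = v \<otimes> x \<otimes> u \<oplus> u \<otimes> x \<otimes> u" using uc vc x by (simp add: l_distr m_assoc)
    finally show "x \<otimes> u = u \<otimes> x \<otimes> u" unfolding vxu[OF x] using uc x by simp
    have "u \<otimes> x = u \<otimes> x \<otimes> (v \<oplus> u)" using uv1[symmetric] x uc by simp
    also have "\<dots> = u \<otimes> x \<otimes> v \<oplus> u \<otimes> x \<otimes> u" using uc vc x by (simp add: r_distr)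
    finally show "u \<otimes> x = u \<otimes> x \<otimes> u" unfolding uxv[OF x] using uc x by simp
  qed
  have "u \<otimes> u = u" using ux[of \<one>] uc by simp
  moreover have "u \<otimes> x = x \<otimes> u" if "x \<in> carrier R" for x using xu[OF that] ux[OF that] by simp
  ultimately have "u = \<zero> \<or> u = \<one>" using ci uc unfolding no_nontrivial_central_idempotents_def by blast
  thus ?thesis
  proof
    \<comment> \<open>A positive exponent shows that \<open>v\<close> is a multiple of
      \<open>d\<close> and \<open>u\<close> a multiple of \<open>b\<close>.\<close>
    obtain k where k: "n = Suc k" using p(5) by (cases n) auto
    {
      assume "u = \<zero>"
      hence "v = \<one>" using uv1 vc by simp
      moreover have "v = (t \<otimes> d [^] k) \<otimes> d" unfolding v_def k using t(1) d(1) by (simp add: m_assoc)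
      ultimately have "\<one> = (t \<otimes> d [^] k) \<otimes> d" by simp
      moreover have "t \<otimes> d [^] k \<in> carrier R" using t(1) d(1) by simp
      ultimately have "\<one> \<in> K" unfolding d(2) mem_cgenideal by blast
      hence "P \<subseteq> J" using PK[of _ \<one>] Pc by fastforce
      thus ?thesis using P(2) by blast
    next
      assume "u = \<one>"
      moreover have "u = (s \<otimes> b [^] k) \<otimes> b" unfolding u_def k using s(1) b(1) by (simp add: m_assoc)
      ultimately have "\<one> = (s \<otimes> b [^] k) \<otimes> b" by simp
      moreover have "s \<otimes> b [^] k \<in> carrier R" using s(1) b(1) by simp
      ultimately have "\<one> \<in> P" unfolding b(2) mem_cgenideal by blast
      thus ?thesis using left_ideal_eq_carrier_iff[OF Pl] by simp
    }
  qed
qed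

theorem principal_imp_special:
  assumes pr: "principal_ring R" and J: "ideal J R" and lss: "left_semisimple_mod J R"
    and rss: "left_semisimple_mod J (opposite_ring R)" and T: "left_T_nilpotent J R"
    and ci: "no_nontrivial_central_idempotents R" and one: "\<one> \<noteq> \<zero>"
  obtains p where "special_ring R J p"
proof -
  have Jl: "left_ideal J R" using J ideal_iff_left_ideal by blast
  have Jc: "J \<subseteq> carrier R" using left_ideal_carrier[OF Jl] by blast
  obtain p where p: "p \<in> carrier R" "J = PIdl p" "J = PIdl\<^bsub>opposite_ring R\<^esub> p"
    by (rule ideal_normal_generator[OF pr J])
  obtain n :: nat where n: "p [^] n = \<zero>"
    using T_nilpotent_nilpotent[OF Jc T] p(2) cgenideal_self[OF p(1)] by blast
  have n0: "n > 0" using n one by (cases n) auto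
  have "\<one> \<notin> J"
  proof
    assume "\<one> \<in> J"
    then obtain k :: nat where "\<one> [^] k = \<zero>" using T_nilpotent_nilpotent[OF Jc T] by blast
    thus False using one by simp
  qed
  hence "special_ring R J p"
    using J p n lss rss indecomposable_radical_maximal[OF pr J lss rss p n n0 ci]
    by (intro special_ring.intro special_ring_axioms.intro ring_axioms) blast+
  thus thesis by (rule that)
qed

end

section \<open>Trivial extensions\<close>

context ring
begin

section \<open>Transport along isomorphisms and degenerate cases\<close>

lemma left_morphic_iso:
  assumes S: "ring S" and h: "h \<in> ring_iso R S" and lm: "left_morphic R"
  shows "left_morphic S"
proof (rule ring.left_morphicI[OF S])
  interpret S: ring S by (rule S)
  note hc = ring_iso_memE(1)[OF h] and hm = ring_iso_memE(2)[OF h]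
  have bij: "bij_betw h (carrier R) (carrier S)" by (rule ring_iso_memE(5)[OF h])
  have h0: "h \<zero> = \<zero>\<^bsub>S\<^esub>"
    using ring_hom_zero[OF _ ring_axioms S] h unfolding ring_iso_def by blast
  have surj: "\<exists>x\<in>carrier R. y = h x" if "y \<in> carrier S" for y
    using that bij unfolding bij_betw_def by blast
  have inj: "h x = h y \<longleftrightarrow> x = y" if "x \<in> carrier R" "y \<in> carrier R" for x y
    using that bij unfolding bij_betw_def inj_on_def by blast
  have mem: "h x \<in> PIdl\<^bsub>S\<^esub> (h a) \<longleftrightarrow> x \<in> PIdl a" if x: "x \<in> carrier R" and a: "a \<in> carrier R" for x a
  proof
    assume "h x \<in> PIdl\<^bsub>S\<^esub> (h a)"
    then obtain r where r: "r \<in> carrier S" "h x = r \<otimes>\<^bsub>S\<^esub> h a" unfolding mem_cgenideal by blast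
    obtain r' where r': "r' \<in> carrier R" "r = h r'" using surj[OF r(1)] by blast
    have "h x = h (r' \<otimes> a)" using r(2) r' hm[OF r'(1) a] by simp
    hence "x = r' \<otimes> a" using inj x r'(1) a by simp
    thus "x \<in> PIdl a" unfolding mem_cgenideal using r'(1) by blast
  next
    assume "x \<in> PIdl a"
    then obtain r where "r \<in> carrier R" "x = r \<otimes> a" unfolding mem_cgenideal by blast
    thus "h x \<in> PIdl\<^bsub>S\<^esub> (h a)" unfolding mem_cgenideal using hm[OF _ a] hc by auto
  qed
  have mult0: "h x \<otimes>\<^bsub>S\<^esub> h y = \<zero>\<^bsub>S\<^esub> \<longleftrightarrow> x \<otimes> y = \<zero>" if "x \<in> carrier R" "y \<in> carrier R" for x y
    unfolding hm[OF that, symmetric] h0[symmetric] by (rule inj) (use that in auto)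
  fix a assume "a \<in> carrier S"
  then obtain a' where a: "a' \<in> carrier R" "a = h a'" using surj by blast
  obtain b where b: "b \<in> carrier R" "\<And>x. x \<in> carrier R \<Longrightarrow> x \<in> PIdl a' \<longleftrightarrow> x \<otimes> b = \<zero>"
    "\<And>x. x \<in> carrier R \<Longrightarrow> x \<in> PIdl b \<longleftrightarrow> x \<otimes> a' = \<zero>"
    by (rule left_morphicE[OF lm a(1)]) (rule that)
  have "(y \<in> PIdl\<^bsub>S\<^esub> a \<longleftrightarrow> y \<otimes>\<^bsub>S\<^esub> h b = \<zero>\<^bsub>S\<^esub>) \<and> (y \<in> PIdl\<^bsub>S\<^esub> (h b) \<longleftrightarrow> y \<otimes>\<^bsub>S\<^esub> a = \<zero>\<^bsub>S\<^esub>)"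
    if "y \<in> carrier S" for y
    using surj[OF that] mem mult0 a b by auto
  thus "\<exists>b\<in>carrier S. (\<forall>x\<in>carrier S. x \<in> PIdl\<^bsub>S\<^esub> a \<longleftrightarrow> x \<otimes>\<^bsub>S\<^esub> b = \<zero>\<^bsub>S\<^esub>) \<and>
    (\<forall>x\<in>carrier S. x \<in> PIdl\<^bsub>S\<^esub> b \<longleftrightarrow> x \<otimes>\<^bsub>S\<^esub> a = \<zero>\<^bsub>S\<^esub>)"
    using hc[OF b(1)] by blast
qed

lemma morphic_ring_iso:
  assumes S: "ring S" and h: "h \<in> ring_iso R S" and m: "morphic_ring R"
  shows "morphic_ring S"
proof -
  have "h \<in> ring_iso (opposite_ring R) (opposite_ring S)"
    using h unfolding ring_iso_def ring_hom_def by auto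
  thus ?thesis
    using left_morphic_iso[OF S h] ring.left_morphic_iso[OF ring_opposite ring.ring_opposite[OF S]] m
    unfolding morphic_ring_def by blast
qed

text \<open>The zero ring satisfies the hypotheses of the theorem, but it is not simple and lies
  outside the structure theory, which requires one to differ from zero.\<close>

lemma zero_ring_left:
  assumes z: "carrier R = {\<zero>}"
  shows "left_morphic R" "left_artinian R" "left_principal_ring R"
proof -
  have I: "I = {\<zero>}" if "left_ideal I R" for I
    using left_ideal_zero[OF that] left_ideal_carrier[OF that] z by blast
  show "left_morphic R"
    by (rule left_morphicI) (use z in \<open>auto simp: mem_cgenideal\<close>)
  show "left_artinian R"
    unfolding left_artinian_def
  proof (intro allI impI exI)
    fix K :: "nat \<Rightarrow> 'a set" and n :: nat
    assume "(\<forall>n. left_ideal (K n) R) \<and> (\<forall>n. K (Suc n) \<subseteq> K n)"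
    thus "K n = K 0" using I[of "K n"] I[of "K 0"] by simp
  qed
  have "I = PIdl \<zero>" if "left_ideal I R" for I
    using I[OF that] by (auto simp: mem_cgenideal z)
  thus "left_principal_ring R" unfolding left_principal_ring_def by blast
qed

lemma zero_ring:
  assumes z: "carrier R = {\<zero>}"
  shows "morphic_ring R" "artinian_ring R" "principal_ring R"
  using zero_ring_left[OF z] ring.zero_ring_left[OF ring_opposite] z
  by (simp_all add: morphic_ring_def artinian_ring_def principal_ring_def)

lemma semisimple_left_artinian:
  assumes lss: "left_semisimple_mod {\<zero>} R" and rss: "left_semisimple_mod {\<zero>} (opposite_ring R)"
  shows "left_artinian R"
  unfolding left_artinian_def
proof (intro allI impI)
  fix I :: "nat \<Rightarrow> 'a set"
  assume *: "(\<forall>n. left_ideal (I n) R) \<and> (\<forall>n. I (Suc n) \<subseteq> I n)"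
  obtain P where P: "P \<in> range I" and min: "\<And>K. (K, P) \<in> {(K, I). left_ideal K R \<and> left_ideal I R \<and>
      {\<zero>} \<subseteq> K \<and> K \<subset> I} \<Longrightarrow> K \<notin> range I"
    by (rule wfE_min[OF left_dcc_mod[OF zeroideal lss rss], of _ "range I"]) blast+
  then obtain N where N: "P = I N" by blast
  have "I k = I N" if "k \<ge> N" for k
  proof (rule ccontr)
    assume "I k \<noteq> I N"
    moreover have "I k \<subseteq> I N" using lift_Suc_antimono_le[of I N k] * that by blast
    ultimately have "I k \<subset> P" using N by blast
    hence "I k \<notin> range I" using min[of "I k"] * left_ideal_zero[of "I k" R] N by blast
    thus False by blast
  qed
  thus "\<exists>N. \<forall>n\<ge>N. I n = I N" by blast
qed

end

context bimodule
begin

lemma smult_zeros [simp]: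
  "r \<in> carrier R \<Longrightarrow> r \<odot>\<^bsub>M\<^esub> \<zero>\<^bsub>M\<^esub> = \<zero>\<^bsub>M\<^esub>"
  "x \<in> carrier M \<Longrightarrow> \<zero> \<odot>\<^bsub>M\<^esub> x = \<zero>\<^bsub>M\<^esub>"
  "r \<in> carrier R \<Longrightarrow> \<zero>\<^bsub>M\<^esub> \<odot>\<^sub>r\<^bsub>M\<^esub> r = \<zero>\<^bsub>M\<^esub>"
  "x \<in> carrier M \<Longrightarrow> x \<odot>\<^sub>r\<^bsub>M\<^esub> \<zero> = \<zero>\<^bsub>M\<^esub>"
proof -
  have dbl: "x = \<zero>\<^bsub>M\<^esub>" if "x \<in> carrier M" "x = x \<oplus>\<^bsub>M\<^esub> x" for x
    using that by (metis M.add.l_cancel_one')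
  show "r \<odot>\<^bsub>M\<^esub> \<zero>\<^bsub>M\<^esub> = \<zero>\<^bsub>M\<^esub>" if "r \<in> carrier R"
    using dbl[of "r \<odot>\<^bsub>M\<^esub> \<zero>\<^bsub>M\<^esub>"] lsmult_r_distr[OF that, of "\<zero>\<^bsub>M\<^esub>" "\<zero>\<^bsub>M\<^esub>"] lsmult_closed[OF that] by simp
  show "\<zero> \<odot>\<^bsub>M\<^esub> x = \<zero>\<^bsub>M\<^esub>" if "x \<in> carrier M"
    using dbl[of "\<zero> \<odot>\<^bsub>M\<^esub> x"] lsmult_l_distr[of \<zero> \<zero> x] lsmult_closed[of \<zero> x] that by simp
  show "\<zero>\<^bsub>M\<^esub> \<odot>\<^sub>r\<^bsub>M\<^esub> r = \<zero>\<^bsub>M\<^esub>" if "r \<in> carrier R"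
    using dbl[of "\<zero>\<^bsub>M\<^esub> \<odot>\<^sub>r\<^bsub>M\<^esub> r"] rsmult_l_distr[of "\<zero>\<^bsub>M\<^esub>" "\<zero>\<^bsub>M\<^esub>" r] rsmult_closed[of "\<zero>\<^bsub>M\<^esub>" r] that by simp
  show "x \<odot>\<^sub>r\<^bsub>M\<^esub> \<zero> = \<zero>\<^bsub>M\<^esub>" if "x \<in> carrier M"
    using dbl[of "x \<odot>\<^sub>r\<^bsub>M\<^esub> \<zero>"] rsmult_r_distr[of x \<zero> \<zero>] rsmult_closed[of x \<zero>] that by simp
qed

lemma trivial_extension_simps [simp]:
  "carrier (R \<propto> M) = carrier R \<times> carrier M"
  "(r, m) \<otimes>\<^bsub>R \<propto> M\<^esub> (s, n) = (r \<otimes> s, r \<odot>\<^bsub>M\<^esub> n \<oplus>\<^bsub>M\<^esub> m \<odot>\<^sub>r\<^bsub>M\<^esub> s)"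
  "\<one>\<^bsub>R \<propto> M\<^esub> = (\<one>, \<zero>\<^bsub>M\<^esub>)"
  "\<zero>\<^bsub>R \<propto> M\<^esub> = (\<zero>, \<zero>\<^bsub>M\<^esub>)"
  "(r, m) \<oplus>\<^bsub>R \<propto> M\<^esub> (s, n) = (r \<oplus> s, m \<oplus>\<^bsub>M\<^esub> n)"
  by (simp_all add: trivial_extension_def)

lemmas smult_simps = lsmult_closed rsmult_closed lsmult_l_distr lsmult_r_distr lsmult_assoc lsmult_one
  rsmult_l_distr rsmult_r_distr rsmult_assoc rsmult_one smult_rsmult_assoc

lemma ring_trivial_extension: "ring (R \<propto> M)"
proof (rule ringI)
  show "abelian_group (R \<propto> M)"
  proof (rule abelian_groupI)
    fix x assume "x \<in> carrier (R \<propto> M)"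
    thus "\<exists>y\<in>carrier (R \<propto> M). y \<oplus>\<^bsub>R \<propto> M\<^esub> x = \<zero>\<^bsub>R \<propto> M\<^esub>"
      by (cases x) (auto intro!: bexI[of _ "(\<ominus> fst x, \<ominus>\<^bsub>M\<^esub> snd x)"] simp: R.l_neg M.l_neg)
  qed (auto simp: R.a_ac M.a_ac)
  show "monoid (R \<propto> M)"
    by (rule monoidI) (auto simp: smult_simps R.m_assoc M.a_assoc)
qed (auto simp: smult_simps R.l_distr R.r_distr M.a_ac)

sublocale S: ring "R \<propto> M"
  by (rule ring_trivial_extension)

lemma trivial_extension_minus:
  assumes "r \<in> carrier R" "s \<in> carrier R" "m \<in> carrier M" "n \<in> carrier M"
  shows "(r, m) \<ominus>\<^bsub>R \<propto> M\<^esub> (s, n) = (r \<ominus> s, m \<ominus>\<^bsub>M\<^esub> n)"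
proof -
  have "\<ominus>\<^bsub>R \<propto> M\<^esub> (s, n) = (\<ominus> s, \<ominus>\<^bsub>M\<^esub> n)"
    by (rule S.minus_equality) (use assms in \<open>auto simp: R.l_neg M.l_neg\<close>)
  thus ?thesis by (simp add: a_minus_def)
qed

section \<open>Ideals of the trivial extension above the module part\<close>

lemma left_ideal_times_M:
  assumes I: "left_ideal I R" shows "left_ideal (I \<times> carrier M) (R \<propto> M)"
  by (rule S.left_idealI)
    (use left_ideal_carrier[OF I] left_ideal_zero[OF I] left_ideal_add[OF I] left_ideal_mult[OF I] in
      \<open>auto simp: smult_simps\<close>)

lemma right_ideal_times_M:
  assumes I: "left_ideal I (opposite_ring R)"
  shows "left_ideal (I \<times> carrier M) (opposite_ring (R \<propto> M))"
proof -
  have "x \<oplus> y \<in> I" if "x \<in> I" "y \<in> I" for x y using left_ideal_add[OF I that] by simp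
  moreover have "x \<otimes> r \<in> I" if "x \<in> I" "r \<in> carrier R" for x r using left_ideal_mult[OF I, of r x] that by simp
  moreover have "x \<in> carrier R" if "x \<in> I" for x using left_ideal_carrier[OF I that] by simp
  moreover have "\<zero> \<in> I" using left_ideal_zero[OF I] by simp
  ultimately show ?thesis
    by (intro ring.left_idealI[OF S.ring_opposite]) (auto simp: smult_simps)
qed

lemma ideal_times_M: "ideal I R \<Longrightarrow> ideal (I \<times> carrier M) (R \<propto> M)"
  using left_ideal_times_M right_ideal_times_M
  by (simp add: R.ideal_iff_left_ideal S.ideal_iff_left_ideal)

text \<open>For an ideal that contains \<open>{\<zero>} \<times> carrier M\<close> this is its
  projection to \<open>R\<close>.\<close>

definition base :: "('a \<times> 'c) set \<Rightarrow> 'a set" where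
  "base I = {r \<in> carrier R. (r, \<zero>\<^bsub>M\<^esub>) \<in> I}"

text \<open>Adding elements \<open>(\<zero>, n \<ominus> m)\<close> makes the second component
  arbitrary. So one-sided ideals above the module part correspond to one-sided ideals of
  \<open>R\<close>.\<close>

lemma base_eq:
  assumes I: "left_ideal I (R \<propto> M) \<or> left_ideal I (opposite_ring (R \<propto> M))"
    and sub: "{\<zero>} \<times> carrier M \<subseteq> I"
  shows "I = base I \<times> carrier M"
proof -
  have c: "I \<subseteq> carrier R \<times> carrier M"
    using I left_ideal_carrier[of I "R \<propto> M"] left_ideal_carrier[of I "opposite_ring (R \<propto> M)"] by auto
  have add: "x \<oplus>\<^bsub>R \<propto> M\<^esub> y \<in> I" if "x \<in> I" "y \<in> I" for x y
    using I left_ideal_add[of I "R \<propto> M" x y] left_ideal_add[of I "opposite_ring (R \<propto> M)" x y] that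
    by (elim disjE) (simp_all del: trivial_extension_simps)
  have eq: "(r, n) \<in> I" if "(r, m) \<in> I" "n \<in> carrier M" for r m n
  proof -
    have rm: "r \<in> carrier R" "m \<in> carrier M" using that c by auto
    have "n \<ominus>\<^bsub>M\<^esub> m \<in> carrier M" using that(2) rm(2) by simp
    hence "(\<zero>, n \<ominus>\<^bsub>M\<^esub> m) \<in> I" using sub by blast
    from add[OF that(1) this] have "(r, m \<oplus>\<^bsub>M\<^esub> (n \<ominus>\<^bsub>M\<^esub> m)) \<in> I" using rm by simp
    moreover have "m \<oplus>\<^bsub>M\<^esub> (n \<ominus>\<^bsub>M\<^esub> m) = n"
      using rm that(2) by (simp add: M.minus_eq M.a_comm[of n] M.r_neg2)
    ultimately show ?thesis by simp
  qed
  show ?thesis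
  proof
    show "I \<subseteq> base I \<times> carrier M" using eq c by (auto simp: base_def)
    show "base I \<times> carrier M \<subseteq> I" using eq by (auto simp: base_def)
  qed
qed

lemma left_ideal_base:
  assumes I: "left_ideal I (R \<propto> M)" shows "left_ideal (base I) R"
proof (rule R.left_idealI)
  show "base I \<subseteq> carrier R" by (auto simp: base_def)
  show "\<zero> \<in> base I" using left_ideal_zero[OF I] by (simp add: base_def)
  show "x \<oplus> y \<in> base I" if "x \<in> base I" "y \<in> base I" for x y
    using that left_ideal_add[OF I, of "(x, \<zero>\<^bsub>M\<^esub>)" "(y, \<zero>\<^bsub>M\<^esub>)"] by (simp add: base_def)
  show "r \<otimes> x \<in> base I" if "r \<in> carrier R" "x \<in> base I" for r x
    using that left_ideal_mult[OF I, of "(r, \<zero>\<^bsub>M\<^esub>)" "(x, \<zero>\<^bsub>M\<^esub>)"] by (simp add: base_def)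
qed

lemma right_ideal_base:
  assumes I: "left_ideal I (opposite_ring (R \<propto> M))" shows "left_ideal (base I) (opposite_ring R)"
proof (rule ring.left_idealI[OF R.ring_opposite]; simp?)
  show "base I \<subseteq> carrier R" by (auto simp: base_def)
  show "\<zero> \<in> base I" using left_ideal_zero[OF I] by (simp add: base_def)
  show "x \<oplus> y \<in> base I" if "x \<in> base I" "y \<in> base I" for x y
    using that left_ideal_add[OF I, of "(x, \<zero>\<^bsub>M\<^esub>)" "(y, \<zero>\<^bsub>M\<^esub>)"] by (simp add: base_def)
  show "x \<otimes> r \<in> base I" if "r \<in> carrier R" "x \<in> base I" for r x
    using that left_ideal_mult[OF I, of "(r, \<zero>\<^bsub>M\<^esub>)" "(x, \<zero>\<^bsub>M\<^esub>)"] by (simp add: base_def)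
qed

lemma ideal_base: "ideal I (R \<propto> M) \<Longrightarrow> ideal (base I) R"
  using left_ideal_base right_ideal_base
  by (simp add: R.ideal_iff_left_ideal S.ideal_iff_left_ideal)

text \<open>The quotients of \<open>R \<propto> M\<close> by \<open>J \<times> carrier M\<close> and
  of \<open>R\<close> by \<open>J\<close> agree; concretely, an \<open>e\<close> for
  \<open>base I\<close> gives the element \<open>(e, 0)\<close> for \<open>I\<close>.\<close>

lemma left_semisimple_trivial_extension:
  assumes J: "ideal J R" and lss: "left_semisimple_mod J R"
  shows "left_semisimple_mod (J \<times> carrier M) (R \<propto> M)"
  unfolding left_semisimple_mod_def
proof (intro allI impI)
  fix I assume "left_ideal I (R \<propto> M) \<and> J \<times> carrier M \<subseteq> I"
  hence I: "left_ideal I (R \<propto> M)" and sub: "J \<times> carrier M \<subseteq> I" by auto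
  have J0: "\<zero> \<in> J" using J R.ideal_iff_left_ideal left_ideal_zero[of J R] by blast
  have "{\<zero>} \<times> carrier M \<subseteq> I" using sub J0 by blast
  hence eq: "I = base I \<times> carrier M" using base_eq I by blast
  have bl: "left_ideal (base I) R" by (rule left_ideal_base[OF I])
  have "J \<subseteq> base I" using sub eq M.zero_closed by blast
  then obtain e where e: "e \<in> base I" "\<And>x. x \<in> base I \<Longrightarrow> x \<ominus> x \<otimes> e \<in> J"
    using left_semisimple_modE[OF lss bl] by blast
  have ec: "e \<in> carrier R" using e(1) by (simp add: base_def)
  have "x \<ominus>\<^bsub>R \<propto> M\<^esub> x \<otimes>\<^bsub>R \<propto> M\<^esub> (e, \<zero>\<^bsub>M\<^esub>) \<in> J \<times> carrier M" if xI: "x \<in> I" for x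
  proof -
    obtain r m where x: "x = (r, m)" "r \<in> base I" "m \<in> carrier M" using xI eq by blast
    have "r \<in> carrier R" using x(2) by (simp add: base_def)
    thus ?thesis using x e(2)[OF x(2)] ec by (simp add: trivial_extension_minus smult_simps)
  qed
  moreover have "(e, \<zero>\<^bsub>M\<^esub>) \<in> I" using e(1) by (simp add: base_def)
  ultimately show "\<exists>e\<in>I. \<forall>x\<in>I. x \<ominus>\<^bsub>R \<propto> M\<^esub> x \<otimes>\<^bsub>R \<propto> M\<^esub> e \<in> J \<times> carrier M" by blast
qed

lemma right_semisimple_trivial_extension:
  assumes J: "ideal J R" and rss: "left_semisimple_mod J (opposite_ring R)"
  shows "left_semisimple_mod (J \<times> carrier M) (opposite_ring (R \<propto> M))"
  unfolding left_semisimple_mod_def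
proof (intro allI impI)
  fix I assume "left_ideal I (opposite_ring (R \<propto> M)) \<and> J \<times> carrier M \<subseteq> I"
  hence I: "left_ideal I (opposite_ring (R \<propto> M))" and sub: "J \<times> carrier M \<subseteq> I" by auto
  have J0: "\<zero> \<in> J" using J R.ideal_iff_left_ideal left_ideal_zero[of J R] by blast
  have "{\<zero>} \<times> carrier M \<subseteq> I" using sub J0 by blast
  hence eq: "I = base I \<times> carrier M" using base_eq I by blast
  have bl: "left_ideal (base I) (opposite_ring R)" by (rule right_ideal_base[OF I])
  have "J \<subseteq> base I" using sub eq M.zero_closed by blast
  then obtain e where e: "e \<in> base I" "\<And>x. x \<in> base I \<Longrightarrow> x \<ominus> e \<otimes> x \<in> J"
    using left_semisimple_modE[OF rss bl] by auto
  have ec: "e \<in> carrier R" using e(1) by (simp add: base_def)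
  have "x \<ominus>\<^bsub>R \<propto> M\<^esub> (e, \<zero>\<^bsub>M\<^esub>) \<otimes>\<^bsub>R \<propto> M\<^esub> x \<in> J \<times> carrier M" if xI: "x \<in> I" for x
  proof -
    obtain r m where x: "x = (r, m)" "r \<in> base I" "m \<in> carrier M" using xI eq by blast
    have "r \<in> carrier R" using x(2) by (simp add: base_def)
    thus ?thesis using x e(2)[OF x(2)] ec by (simp add: trivial_extension_minus smult_simps)
  qed
  moreover have "(e, \<zero>\<^bsub>M\<^esub>) \<in> I" using e(1) by (simp add: base_def)
  ultimately show "\<exists>e\<in>I. \<forall>x\<in>I. x \<ominus>\<^bsub>opposite_ring (R \<propto> M)\<^esub>
      x \<otimes>\<^bsub>opposite_ring (R \<propto> M)\<^esub> e \<in> J \<times> carrier M"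
    unfolding opposite_ring_simps a_minus_opposite by blast
qed

text \<open>T-nilpotence of \<open>J\<close> is applied twice, to the sequence and to its tail: each
  block of factors multiplies into the module part, and two elements of that part have product
  zero.\<close>

lemma T_nilpotent_trivial_extension:
  assumes J: "ideal J R" and T: "left_T_nilpotent J R"
  shows "left_T_nilpotent (J \<times> carrier M) (R \<propto> M)"
  unfolding left_T_nilpotent_def
proof (intro allI impI)
  fix r :: "nat \<Rightarrow> 'a \<times> 'c" assume r: "\<forall>i. r i \<in> J \<times> carrier M"
  have Jl: "left_ideal J R" using J R.ideal_iff_left_ideal by blast
  have Jc: "J \<subseteq> carrier R" using left_ideal_carrier[OF Jl] by blast
  have rc: "r i \<in> carrier (R \<propto> M)" for i using r[rule_format, of i] Jc by (auto simp: mem_Times_iff)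
  have fst_foldr: "fst (foldr (mult (R \<propto> M)) (map q [0..<n]) \<one>\<^bsub>R \<propto> M\<^esub>)
      = foldr (\<otimes>) (map (\<lambda>i. fst (q i)) [0..<n]) \<one>" for q :: "nat \<Rightarrow> 'a \<times> 'c" and n
  proof -
    have "fst (foldr (mult (R \<propto> M)) xs \<one>\<^bsub>R \<propto> M\<^esub>) = foldr (\<otimes>) (map fst xs) \<one>" for xs :: "('a \<times> 'c) list"
      by (induction xs) (auto simp: trivial_extension_def case_prod_beta)
    from this[of "map q [0..<n]"] show ?thesis by (simp add: comp_def)
  qed
  have cl: "foldr (mult (R \<propto> M)) (map q [0..<n]) \<one>\<^bsub>R \<propto> M\<^esub> \<in> carrier (R \<propto> M)"
    if "\<And>i. q i \<in> carrier (R \<propto> M)" for q :: "nat \<Rightarrow> 'a \<times> 'c" and n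
    by (rule S.foldr_mult_closed) (use that in \<open>auto simp del: trivial_extension_simps(1)\<close>)
  obtain n where n: "foldr (\<otimes>) (map (\<lambda>i. fst (r i)) [0..<n]) \<one> = \<zero>"
    using T[unfolded left_T_nilpotent_def, rule_format, of "\<lambda>i. fst (r i)"] r by (auto simp: mem_Times_iff)
  define r' where "r' = (\<lambda>i. r (n + i))"
  obtain k where k: "foldr (\<otimes>) (map (\<lambda>i. fst (r' i)) [0..<k]) \<one> = \<zero>"
    using T[unfolded left_T_nilpotent_def, rule_format, of "\<lambda>i. fst (r' i)"] r by (auto simp: mem_Times_iff r'_def)
  have eq: "map r [0..<n + k] = map r [0..<n] @ map r' [0..<k]"
    by (rule nth_equalityI) (auto simp: nth_append r'_def)
  have r'c: "r' i \<in> carrier (R \<propto> M)" for i unfolding r'_def by (rule rc)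
  have sets: "set (map r [0..<n]) \<subseteq> carrier (R \<propto> M)" "set (map r' [0..<k]) \<subseteq> carrier (R \<propto> M)"
    using rc r'c by (auto simp del: trivial_extension_simps(1))
  note split = S.foldr_mult_append[OF sets, folded eq]
  obtain x where x: "foldr (mult (R \<propto> M)) (map r [0..<n]) \<one>\<^bsub>R \<propto> M\<^esub> = (\<zero>, x)" "x \<in> carrier M"
    using fst_foldr[of r n] n cl[of r n, OF rc] trivial_extension_simps(1) by (metis prod.collapse mem_Times_iff)
  obtain y where y: "foldr (mult (R \<propto> M)) (map r' [0..<k]) \<one>\<^bsub>R \<propto> M\<^esub> = (\<zero>, y)" "y \<in> carrier M"
    using fst_foldr[of r' k] k cl[of r' k, OF r'c] trivial_extension_simps(1) by (metis prod.collapse mem_Times_iff)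
  have "foldr (mult (R \<propto> M)) (map r [0..<n + k]) \<one>\<^bsub>R \<propto> M\<^esub> = \<zero>\<^bsub>R \<propto> M\<^esub>"
    unfolding split x(1) y(1) using x(2) y(2) by simp
  thus "\<exists>n. foldr (mult (R \<propto> M)) (map r [0..<n]) \<one>\<^bsub>R \<propto> M\<^esub> = \<zero>\<^bsub>R \<propto> M\<^esub>" by blast
qed

text \<open>Testing against the elements \<open>(x, 0)\<close> shows that the first component is
  central, hence zero or one. Idempotency then makes the second component vanish in either
  case.\<close>

lemma no_nontrivial_central_idempotents_trivial_extension:
  assumes ci: "no_nontrivial_central_idempotents R"
  shows "no_nontrivial_central_idempotents (R \<propto> M)"
  unfolding no_nontrivial_central_idempotents_def
proof (intro ballI impI)
  fix f assume "f \<in> carrier (R \<propto> M)"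
    and f: "f \<otimes>\<^bsub>R \<propto> M\<^esub> f = f \<and> (\<forall>x\<in>carrier (R \<propto> M). f \<otimes>\<^bsub>R \<propto> M\<^esub> x = x \<otimes>\<^bsub>R \<propto> M\<^esub> f)"
  then obtain e m where em: "f = (e, m)" "e \<in> carrier R" "m \<in> carrier M" by auto
  have ee: "e \<otimes> e = e" and mm: "e \<odot>\<^bsub>M\<^esub> m \<oplus>\<^bsub>M\<^esub> m \<odot>\<^sub>r\<^bsub>M\<^esub> e = m" using f unfolding em(1) by auto
  have "e \<otimes> x = x \<otimes> e" if x: "x \<in> carrier R" for x
    using f[THEN conjunct2, rule_format, of "(x, \<zero>\<^bsub>M\<^esub>)"] x unfolding em(1) by simp
  hence "e = \<zero> \<or> e = \<one>" using ci ee em(2) unfolding no_nontrivial_central_idempotents_def by blast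
  thus "f = \<zero>\<^bsub>R \<propto> M\<^esub> \<or> f = \<one>\<^bsub>R \<propto> M\<^esub>"
  proof
    assume "e = \<zero>"
    thus ?thesis using mm em by simp
  next
    assume "e = \<one>"
    hence "m \<oplus>\<^bsub>M\<^esub> m = m" using mm em by (simp add: smult_simps)
    hence "m = \<zero>\<^bsub>M\<^esub>" using em(3) by (metis M.add.l_cancel_one')
    thus ?thesis using \<open>e = \<one>\<close> em by simp
  qed
qed

lemma iso_trivial_extension_zero:
  assumes "carrier M = {\<zero>\<^bsub>M\<^esub>}"
  shows "(\<lambda>r. (r, \<zero>\<^bsub>M\<^esub>)) \<in> ring_iso R (R \<propto> M)"
proof (rule ring_iso_memI)
  show "bij_betw (\<lambda>r. (r, \<zero>\<^bsub>M\<^esub>)) (carrier R) (carrier (R \<propto> M))"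
    using assms by (auto simp: bij_betw_def inj_on_def)
qed (auto simp: smult_simps)

lemma morphic_trivial_extension_zero:
  assumes "carrier M = {\<zero>\<^bsub>M\<^esub>}"
  shows "morphic_ring (R \<propto> M) \<longleftrightarrow> morphic_ring R"
  using R.morphic_ring_iso[OF S.ring_axioms iso_trivial_extension_zero[OF assms]]
    S.morphic_ring_iso[OF R.ring_axioms ring_iso_set_sym[OF R.ring_axioms iso_trivial_extension_zero[OF assms]]]
  by blast

end

section \<open>The radical of a trivial extension\<close>

context bimodule
begin

lemma ideal_zero_times_M: "ideal ({\<zero>} \<times> carrier M) (R \<propto> M)"
  by (rule ideal_times_M[OF R.zeroideal])

text \<open>\<open>H\<close> is the ideal of those \<open>s\<close> with \<open>sp \<in> 0 \<propto> M\<close>.  If it is not contained in the radical, then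
  \<open>p\<close> lies in \<open>0 \<propto> M\<close> up to the square of the radical, so \<open>J\<close> is zero; otherwise \<open>p\<close> can be replaced
  by its first component \<open>p0\<close>, whence \<open>M = M p0\<close>.\<close>

lemma special_trivial_extension_cases:
  assumes J: "ideal J R" and T: "left_T_nilpotent J R"
    and sp: "special_ring (R \<propto> M) (J \<times> carrier M) p"
  shows "J = {\<zero>} \<or> carrier M = {\<zero>\<^bsub>M\<^esub>}"
proof -
  interpret sp: special_ring "R \<propto> M" "J \<times> carrier M" p by (rule sp)
  have Jl: "left_ideal J R" using J R.ideal_iff_left_ideal by blast
  have Jc: "J \<subseteq> carrier R" using left_ideal_carrier[OF Jl] by blast
  define A where "A = {\<zero>} \<times> carrier M"
  have A: "ideal A (R \<propto> M)" unfolding A_def by (rule ideal_zero_times_M)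
  have Al: "left_ideal A (R \<propto> M)" and Ar: "left_ideal A (opposite_ring (R \<propto> M))"
    using A S.ideal_iff_left_ideal by blast+
  obtain p0 m0 where p: "p = (p0, m0)" "p0 \<in> J" "m0 \<in> carrier M" using sp.p_in_J by blast
  have p0c: "p0 \<in> carrier R" using p(2) Jc by blast
  define H where "H = {s \<in> carrier (R \<propto> M). s \<otimes>\<^bsub>R \<propto> M\<^esub> p \<in> A}"
  have H: "ideal H (R \<propto> M)"
  proof (rule S.ideal_intro)
    show "H \<subseteq> carrier (R \<propto> M)" by (auto simp: H_def)
    show "\<zero>\<^bsub>R \<propto> M\<^esub> \<in> H"
      using left_ideal_zero[OF Al] S.l_null[OF sp.p] S.zero_closed by (simp add: H_def del: trivial_extension_simps)
    show "x \<oplus>\<^bsub>R \<propto> M\<^esub> y \<in> H" if "x \<in> H" "y \<in> H" for x y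
      using that left_ideal_add[OF Al] sp.p by (simp add: H_def S.l_distr del: trivial_extension_simps)
    show "r \<otimes>\<^bsub>R \<propto> M\<^esub> x \<in> H" if "r \<in> carrier (R \<propto> M)" "x \<in> H" for r x
      using that left_ideal_mult[OF Al] sp.p by (simp add: H_def S.m_assoc del: trivial_extension_simps)
    fix r x assume r: "r \<in> carrier (R \<propto> M)" and x: "x \<in> H"
    have xc: "x \<in> carrier (R \<propto> M)" and xp: "x \<otimes>\<^bsub>R \<propto> M\<^esub> p \<in> A" using x by (auto simp: H_def)
    obtain t where t: "t \<in> carrier (R \<propto> M)" "r \<otimes>\<^bsub>R \<propto> M\<^esub> p = p \<otimes>\<^bsub>R \<propto> M\<^esub> t"
      using sp.normal_left[OF r, of 1] S.nat_pow_eone[OF sp.p] by (auto simp del: trivial_extension_simps)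
    have "x \<otimes>\<^bsub>R \<propto> M\<^esub> r \<otimes>\<^bsub>R \<propto> M\<^esub> p = x \<otimes>\<^bsub>R \<propto> M\<^esub> (r \<otimes>\<^bsub>R \<propto> M\<^esub> p)"
      by (rule S.m_assoc[OF xc r sp.p])
    also have "\<dots> = x \<otimes>\<^bsub>R \<propto> M\<^esub> p \<otimes>\<^bsub>R \<propto> M\<^esub> t"
      unfolding t(2) by (rule S.m_assoc[OF xc sp.p t(1), symmetric])
    also have "\<dots> \<in> A"
      using left_ideal_mult[OF Ar, of t] t(1) xp by (simp del: trivial_extension_simps)
    finally show "x \<otimes>\<^bsub>R \<propto> M\<^esub> r \<in> H"
      using S.m_closed[OF xc r] by (simp add: H_def del: trivial_extension_simps)
  qed
  show ?thesis
  proof (cases "H \<subseteq> J \<times> carrier M")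
    case False
    then obtain x where x: "x \<in> H" "x \<notin> J \<times> carrier M" by blast
    obtain h j where hj: "h \<in> H" "j \<in> J \<times> carrier M" "\<one>\<^bsub>R \<propto> M\<^esub> = h \<oplus>\<^bsub>R \<propto> M\<^esub> j"
      by (rule sp.ideal_not_le_J[OF H x])
    obtain h0 h1 where h: "h = (h0, h1)" "h0 \<in> carrier R" "h1 \<in> carrier M" "h0 \<otimes> p0 = \<zero>"
      using hj(1) unfolding H_def A_def p(1) by auto
    obtain j0 j1 where j: "j = (j0, j1)" "j0 \<in> J" using hj(2) by blast
    have j0c: "j0 \<in> carrier R" using j(2) Jc by blast
    have one: "h0 \<oplus> j0 = \<one>" using hj(3) unfolding h(1) j(1) by simp
    \<comment> \<open>The radical element \<open>j0\<close> fixes \<open>p0\<close> and is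
      nilpotent, so \<open>p0\<close> is zero. Then every left multiple of \<open>p\<close> has
      first component zero.\<close>
    have "p0 = (h0 \<oplus> j0) \<otimes> p0" unfolding one using p0c by simp
    also have "\<dots> = j0 \<otimes> p0" using h(2,4) j0c p0c by (simp add: R.l_distr)
    finally have "p0 = j0 \<otimes> p0" .
    moreover obtain n :: nat where "j0 [^] n = \<zero>" using R.T_nilpotent_nilpotent[OF Jc T j(2)] by blast
    ultimately have p00: "p0 = \<zero>" using R.nilpotent_fixes_zero[OF j0c _ p0c] by blast
    have "x = \<zero>" if x: "x \<in> J" for x
    proof -
      have "(x, \<zero>\<^bsub>M\<^esub>) \<in> PIdl\<^bsub>R \<propto> M\<^esub> p" using x sp.J_left by blast
      then obtain s where "s \<in> carrier (R \<propto> M)" "(x, \<zero>\<^bsub>M\<^esub>) = s \<otimes>\<^bsub>R \<propto> M\<^esub> p"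
        unfolding mem_cgenideal by blast
      thus ?thesis unfolding p(1) p00 by auto
    qed
    thus ?thesis using left_ideal_zero[OF Jl] by blast
  next
    case True
    have "(\<zero>, m0) \<in> PIdl\<^bsub>R \<propto> M\<^esub> p" using left_ideal_zero[OF Jl] p(3) sp.J_left by blast
    then obtain h where h: "h \<in> carrier (R \<propto> M)" "(\<zero>, m0) = h \<otimes>\<^bsub>R \<propto> M\<^esub> p" unfolding mem_cgenideal by blast
    have "h \<otimes>\<^bsub>R \<propto> M\<^esub> p \<in> A" unfolding h(2)[symmetric] A_def using p(3) by simp
    hence "h \<in> H" unfolding H_def using h(1) by blast
    hence hJ: "h \<in> J \<times> carrier M" using True by blast
    \<comment> \<open>As \<open>h\<close> is radical, \<open>1 - h\<close> is invertible, and
      multiplying \<open>p\<close> by it removes the second component. So \<open>(p0, 0)\<close>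
      generates the same left ideal as \<open>p\<close>.\<close>
    obtain v where v: "v \<in> carrier (R \<propto> M)" "v \<otimes>\<^bsub>R \<propto> M\<^esub> (\<one>\<^bsub>R \<propto> M\<^esub> \<ominus>\<^bsub>R \<propto> M\<^esub> h) = \<one>\<^bsub>R \<propto> M\<^esub>"
      using S.one_minus_nilpotent[OF h(1) sp.J_nilpotent[OF hJ]] by blast
    have "(\<one>\<^bsub>R \<propto> M\<^esub> \<ominus>\<^bsub>R \<propto> M\<^esub> h) \<otimes>\<^bsub>R \<propto> M\<^esub> p = p \<ominus>\<^bsub>R \<propto> M\<^esub> h \<otimes>\<^bsub>R \<propto> M\<^esub> p"
      using h(1) sp.p by (simp add: S.minus_eq S.l_distr S.l_minus del: trivial_extension_simps)
    also have "\<dots> = (p0, \<zero>\<^bsub>M\<^esub>)"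
      unfolding h(2)[symmetric] unfolding p(1) using p0c p(3)
      by (simp add: trivial_extension_minus R.minus_eq M.minus_eq M.r_neg)
    finally have *: "(\<one>\<^bsub>R \<propto> M\<^esub> \<ominus>\<^bsub>R \<propto> M\<^esub> h) \<otimes>\<^bsub>R \<propto> M\<^esub> p = (p0, \<zero>\<^bsub>M\<^esub>)" .
    have "v \<otimes>\<^bsub>R \<propto> M\<^esub> ((\<one>\<^bsub>R \<propto> M\<^esub> \<ominus>\<^bsub>R \<propto> M\<^esub> h) \<otimes>\<^bsub>R \<propto> M\<^esub> p)
      = v \<otimes>\<^bsub>R \<propto> M\<^esub> (\<one>\<^bsub>R \<propto> M\<^esub> \<ominus>\<^bsub>R \<propto> M\<^esub> h) \<otimes>\<^bsub>R \<propto> M\<^esub> p"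
      by (rule S.m_assoc[symmetric, OF v(1) S.minus_closed[OF S.one_closed h(1)] sp.p])
    hence pv: "v \<otimes>\<^bsub>R \<propto> M\<^esub> (p0, \<zero>\<^bsub>M\<^esub>) = p"
      unfolding * v(2) using S.l_one[OF sp.p] by (simp del: trivial_extension_simps)
    have p0c': "(p0, \<zero>\<^bsub>M\<^esub>) \<in> carrier (R \<propto> M)" using p0c by simp
    have step: "\<exists>n\<in>carrier M. m = n \<odot>\<^sub>r\<^bsub>M\<^esub> p0" if m: "m \<in> carrier M" for m
    proof -
      have "(\<zero>, m) \<in> PIdl\<^bsub>R \<propto> M\<^esub> p" using left_ideal_zero[OF Jl] m sp.J_left by blast
      then obtain s where s: "s \<in> carrier (R \<propto> M)" "(\<zero>, m) = s \<otimes>\<^bsub>R \<propto> M\<^esub> p" unfolding mem_cgenideal by blast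
      have "(\<zero>, m) = s \<otimes>\<^bsub>R \<propto> M\<^esub> v \<otimes>\<^bsub>R \<propto> M\<^esub> (p0, \<zero>\<^bsub>M\<^esub>)"
        unfolding s(2) pv[symmetric] by (rule S.m_assoc[symmetric, OF s(1) v(1) p0c'])
      moreover obtain a n where an: "s \<otimes>\<^bsub>R \<propto> M\<^esub> v = (a, n)" by (cases "s \<otimes>\<^bsub>R \<propto> M\<^esub> v")
      moreover have "a \<in> carrier R" "n \<in> carrier M" using S.m_closed[OF s(1) v(1)] unfolding an by auto
      ultimately show ?thesis using p0c rsmult_closed by (intro bexI[of _ n]) simp_all
    qed
    \<comment> \<open>\<open>M = M p0\<close> is iterated until the power of the nilpotent
      \<open>p0\<close> vanishes, which leaves \<open>M = 0\<close>.\<close>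
    have pow: "\<exists>n\<in>carrier M. m = n \<odot>\<^sub>r\<^bsub>M\<^esub> (p0 [^] k)" if "m \<in> carrier M" for m and k :: nat
      using that
    proof (induction k arbitrary: m)
      case 0
      thus ?case by (intro bexI[of _ m]) (simp_all add: rsmult_one)
    next
      case (Suc k)
      obtain n where n: "n \<in> carrier M" "m = n \<odot>\<^sub>r\<^bsub>M\<^esub> p0" using step[OF Suc.prems] by blast
      obtain n' where n': "n' \<in> carrier M" "n = n' \<odot>\<^sub>r\<^bsub>M\<^esub> (p0 [^] k)" using Suc.IH[OF n(1)] by blast
      have "m = n' \<odot>\<^sub>r\<^bsub>M\<^esub> (p0 [^] Suc k)"
        unfolding n(2) n'(2) using rsmult_assoc[OF n'(1) R.nat_pow_closed[OF p0c] p0c, of k] by simp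
      thus ?case using n'(1) by blast
    qed
    obtain k :: nat where k: "p0 [^] k = \<zero>" using R.T_nilpotent_nilpotent[OF Jc T p(2)] by blast
    have "m = \<zero>\<^bsub>M\<^esub>" if "m \<in> carrier M" for m
      using pow[OF that, of k] unfolding k by auto
    thus ?thesis by auto
  qed
qed

text \<open>For \<open>J = 0\<close> the quotient by the radical of the extension is
  \<open>R\<close> itself. The main proof uses the contrapositive: if \<open>R\<close> is not simple
  artinian, its radical is nonzero.\<close>

lemma special_zero_radical_simple:
  assumes J: "{\<zero>} = J" and sp: "special_ring (R \<propto> M) (J \<times> carrier M) p"
    and lss: "left_semisimple_mod J R" and rss: "left_semisimple_mod J (opposite_ring R)"
  shows "simple_artinian R"
proof -
  interpret sp: special_ring "R \<propto> M" "J \<times> carrier M" p by (rule sp)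
  have "\<one> \<noteq> \<zero>" using sp.one J by auto
  hence "carrier R \<noteq> {\<zero>}" using R.carrier_one_not_zero by simp
  moreover have "I = {\<zero>} \<or> I = carrier R" if I: "ideal I R" for I
  proof -
    have Il: "left_ideal I R" using I R.ideal_iff_left_ideal by blast
    have "J \<times> carrier M \<subseteq> I \<times> carrier M" using left_ideal_zero[OF Il] J by blast
    hence "I \<times> carrier M = J \<times> carrier M \<or> I \<times> carrier M = carrier (R \<propto> M)"
      by (rule sp.simple[OF ideal_times_M[OF I]])
    thus ?thesis using M.zero_closed J by (auto simp: times_eq_iff)
  qed
  moreover have "left_artinian R" "left_artinian (opposite_ring R)"
    using R.semisimple_left_artinian ring.semisimple_left_artinian[OF R.ring_opposite] lss rss J by auto
  ultimately show ?thesis by (simp add: simple_artinian_def simple_ring_def artinian_ring_def)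
qed

text \<open>Because \<open>Rc = cR\<close>, the left annihilator of \<open>c\<close> is a two-sided
  ideal. It does not contain one, so simplicity makes it zero; the same holds on the right. Hence
  \<open>r \<mapsto> rc\<close> and \<open>r \<mapsto> cr\<close> are bijections from
  \<open>R\<close> to \<open>M\<close>, and \<open>\<sigma>\<close> compares them.\<close>

lemma special_zero_radical_twisted:
  assumes simple: "simple_ring R" and sp: "special_ring (R \<propto> M) ({\<zero>} \<times> carrier M) p"
    and M: "carrier M \<noteq> {\<zero>\<^bsub>M\<^esub>}"
  shows "\<exists>\<sigma>\<in>ring_iso R R. bimodule_iso R M (twisted_bimodule R \<sigma>) \<noteq> {}"
proof -
  interpret sp: special_ring "R \<propto> M" "{\<zero>} \<times> carrier M" p by (rule sp)
  obtain c where c: "p = (\<zero>, c)" "c \<in> carrier M" using sp.p_in_J by blast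
  have left: "\<exists>r\<in>carrier R. m = r \<odot>\<^bsub>M\<^esub> c" if m: "m \<in> carrier M" for m
  proof -
    have "(\<zero>, m) \<in> PIdl\<^bsub>R \<propto> M\<^esub> p" using m sp.J_left by blast
    then obtain s where "s \<in> carrier (R \<propto> M)" "(\<zero>, m) = s \<otimes>\<^bsub>R \<propto> M\<^esub> p" unfolding mem_cgenideal by blast
    thus ?thesis unfolding c(1) using c(2) lsmult_closed by auto
  qed
  have right: "\<exists>r\<in>carrier R. m = c \<odot>\<^sub>r\<^bsub>M\<^esub> r" if m: "m \<in> carrier M" for m
  proof -
    have "(\<zero>, m) \<in> PIdl\<^bsub>opposite_ring (R \<propto> M)\<^esub> p" using m sp.J_right by blast
    then obtain s where "s \<in> carrier (R \<propto> M)" "(\<zero>, m) = p \<otimes>\<^bsub>R \<propto> M\<^esub> s"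
      unfolding mem_cgenideal opposite_ring_simps by blast
    thus ?thesis unfolding c(1) using c(2) rsmult_closed by auto
  qed
  have c0: "c \<noteq> \<zero>\<^bsub>M\<^esub>"
  proof
    assume "c = \<zero>\<^bsub>M\<^esub>"
    hence "carrier M \<subseteq> {\<zero>\<^bsub>M\<^esub>}" using left by auto
    thus False using M by auto
  qed
  have triv: "I = {\<zero>}" if I: "ideal I R" "\<one> \<notin> I" for I
    using simple I R.one_closed unfolding simple_ring_def by blast
  have annl: "r = \<zero>" if r: "r \<in> carrier R" "r \<odot>\<^bsub>M\<^esub> c = \<zero>\<^bsub>M\<^esub>" for r
  proof -
    define I where "I = {r \<in> carrier R. r \<odot>\<^bsub>M\<^esub> c = \<zero>\<^bsub>M\<^esub>}"
    have "ideal I R"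
      unfolding R.ideal_iff_left_ideal
    proof
      show "left_ideal I R"
        by (rule R.left_idealI) (use c in \<open>auto simp: I_def smult_simps\<close>)
      show "left_ideal I (opposite_ring R)"
      proof (rule ring.left_idealI[OF R.ring_opposite]; simp?)
        show "I \<subseteq> carrier R" "\<zero> \<in> I" using c by (auto simp: I_def)
        show "x \<oplus> y \<in> I" if "x \<in> I" "y \<in> I" for x y using that c by (simp add: I_def smult_simps)
        fix s x assume s: "s \<in> carrier R" and x: "x \<in> I"
        obtain t where t: "t \<in> carrier R" "s \<odot>\<^bsub>M\<^esub> c = c \<odot>\<^sub>r\<^bsub>M\<^esub> t" using right[OF lsmult_closed[OF s c(2)]] by blast
        have xc: "x \<in> carrier R" "x \<odot>\<^bsub>M\<^esub> c = \<zero>\<^bsub>M\<^esub>" using x by (auto simp: I_def)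
        have "(x \<otimes> s) \<odot>\<^bsub>M\<^esub> c = x \<odot>\<^bsub>M\<^esub> (c \<odot>\<^sub>r\<^bsub>M\<^esub> t)"
          unfolding lsmult_assoc[OF xc(1) s c(2)] t(2) ..
        also have "\<dots> = (x \<odot>\<^bsub>M\<^esub> c) \<odot>\<^sub>r\<^bsub>M\<^esub> t" by (rule smult_rsmult_assoc[OF xc(1) c(2) t(1), symmetric])
        finally show "x \<otimes> s \<in> I" using xc s t(1) by (simp add: I_def)
      qed
    qed
    moreover have "\<one> \<notin> I" using c c0 by (simp add: I_def smult_simps)
    ultimately have "I = {\<zero>}" by (rule triv)
    thus ?thesis using r by (auto simp: I_def)
  qed
  have annr: "r = \<zero>" if r: "r \<in> carrier R" "c \<odot>\<^sub>r\<^bsub>M\<^esub> r = \<zero>\<^bsub>M\<^esub>" for r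
  proof -
    define I where "I = {r \<in> carrier R. c \<odot>\<^sub>r\<^bsub>M\<^esub> r = \<zero>\<^bsub>M\<^esub>}"
    have "ideal I R"
      unfolding R.ideal_iff_left_ideal
    proof
      show "left_ideal I (opposite_ring R)"
        by (rule ring.left_idealI[OF R.ring_opposite]) (use c in \<open>auto simp: I_def smult_simps\<close>)
      show "left_ideal I R"
      proof (rule R.left_idealI)
        show "I \<subseteq> carrier R" "\<zero> \<in> I" using c by (auto simp: I_def)
        show "x \<oplus> y \<in> I" if "x \<in> I" "y \<in> I" for x y using that c by (simp add: I_def smult_simps)
        fix s x assume s: "s \<in> carrier R" and x: "x \<in> I"
        obtain t where t: "t \<in> carrier R" "c \<odot>\<^sub>r\<^bsub>M\<^esub> s = t \<odot>\<^bsub>M\<^esub> c" using left[OF rsmult_closed[OF c(2) s]] by blast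
        have xc: "x \<in> carrier R" "c \<odot>\<^sub>r\<^bsub>M\<^esub> x = \<zero>\<^bsub>M\<^esub>" using x by (auto simp: I_def)
        have "c \<odot>\<^sub>r\<^bsub>M\<^esub> (s \<otimes> x) = (t \<odot>\<^bsub>M\<^esub> c) \<odot>\<^sub>r\<^bsub>M\<^esub> x"
          unfolding rsmult_assoc[OF c(2) s xc(1)] t(2) ..
        also have "\<dots> = t \<odot>\<^bsub>M\<^esub> (c \<odot>\<^sub>r\<^bsub>M\<^esub> x)" by (rule smult_rsmult_assoc[OF t(1) c(2) xc(1)])
        finally show "s \<otimes> x \<in> I" using xc s t(1) by (simp add: I_def)
      qed
    qed
    moreover have "\<one> \<notin> I" using c c0 by (simp add: I_def smult_simps)
    ultimately have "I = {\<zero>}" by (rule triv)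
    thus ?thesis using r by (auto simp: I_def)
  qed
  have injl: "r = s" if rs: "r \<in> carrier R" "s \<in> carrier R" "r \<odot>\<^bsub>M\<^esub> c = s \<odot>\<^bsub>M\<^esub> c" for r s
  proof -
    have "(r \<ominus> s) \<odot>\<^bsub>M\<^esub> c \<oplus>\<^bsub>M\<^esub> s \<odot>\<^bsub>M\<^esub> c = ((r \<ominus> s) \<oplus> s) \<odot>\<^bsub>M\<^esub> c"
      using rs c(2) by (simp add: smult_simps)
    also have "(r \<ominus> s) \<oplus> s = r" using rs(1,2) by algebra
    finally have "(r \<ominus> s) \<odot>\<^bsub>M\<^esub> c \<oplus>\<^bsub>M\<^esub> s \<odot>\<^bsub>M\<^esub> c = s \<odot>\<^bsub>M\<^esub> c" using rs(3) by simp
    hence "(r \<ominus> s) \<odot>\<^bsub>M\<^esub> c = \<zero>\<^bsub>M\<^esub>" using rs c(2) by (simp add: lsmult_closed)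
    thus ?thesis using annl[of "r \<ominus> s"] rs by simp
  qed
  have injr: "r = s" if rs: "r \<in> carrier R" "s \<in> carrier R" "c \<odot>\<^sub>r\<^bsub>M\<^esub> r = c \<odot>\<^sub>r\<^bsub>M\<^esub> s" for r s
  proof -
    have "c \<odot>\<^sub>r\<^bsub>M\<^esub> (r \<ominus> s) \<oplus>\<^bsub>M\<^esub> c \<odot>\<^sub>r\<^bsub>M\<^esub> s = c \<odot>\<^sub>r\<^bsub>M\<^esub> ((r \<ominus> s) \<oplus> s)"
      using rs c(2) by (simp add: smult_simps)
    also have "(r \<ominus> s) \<oplus> s = r" using rs(1,2) by algebra
    finally have "c \<odot>\<^sub>r\<^bsub>M\<^esub> (r \<ominus> s) \<oplus>\<^bsub>M\<^esub> c \<odot>\<^sub>r\<^bsub>M\<^esub> s = c \<odot>\<^sub>r\<^bsub>M\<^esub> s" using rs(3) by simp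
    hence "c \<odot>\<^sub>r\<^bsub>M\<^esub> (r \<ominus> s) = \<zero>\<^bsub>M\<^esub>" using rs c(2) by (simp add: rsmult_closed)
    thus ?thesis using annr[of "r \<ominus> s"] rs by simp
  qed
  have "\<forall>r. r \<in> carrier R \<longrightarrow> (\<exists>s. s \<in> carrier R \<and> c \<odot>\<^sub>r\<^bsub>M\<^esub> r = s \<odot>\<^bsub>M\<^esub> c)"
    using left rsmult_closed[OF c(2)] by blast
  then obtain \<sigma> where \<sigma>: "\<And>r. r \<in> carrier R \<Longrightarrow> \<sigma> r \<in> carrier R \<and> c \<odot>\<^sub>r\<^bsub>M\<^esub> r = \<sigma> r \<odot>\<^bsub>M\<^esub> c" by metis
  have \<sigma>_iso: "\<sigma> \<in> ring_iso R R"
  proof (rule ring_iso_memI)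
    fix r s assume rs: "r \<in> carrier R" "s \<in> carrier R"
    show "\<sigma> r \<in> carrier R" using \<sigma> rs by blast
    have "\<sigma> (r \<otimes> s) \<odot>\<^bsub>M\<^esub> c = (c \<odot>\<^sub>r\<^bsub>M\<^esub> r) \<odot>\<^sub>r\<^bsub>M\<^esub> s"
      using \<sigma>[of "r \<otimes> s"] rs c(2) by (simp add: rsmult_assoc)
    also have "\<dots> = \<sigma> r \<odot>\<^bsub>M\<^esub> (c \<odot>\<^sub>r\<^bsub>M\<^esub> s)" using \<sigma>[OF rs(1)] rs c(2) by (simp add: smult_rsmult_assoc)
    also have "\<dots> = (\<sigma> r \<otimes> \<sigma> s) \<odot>\<^bsub>M\<^esub> c" using \<sigma>[OF rs(1)] \<sigma>[OF rs(2)] rs c(2) by (simp add: lsmult_assoc)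
    finally show "\<sigma> (r \<otimes> s) = \<sigma> r \<otimes> \<sigma> s" using injl \<sigma> rs by simp
    have "\<sigma> (r \<oplus> s) \<odot>\<^bsub>M\<^esub> c = (\<sigma> r \<oplus> \<sigma> s) \<odot>\<^bsub>M\<^esub> c"
      using \<sigma>[of "r \<oplus> s"] \<sigma>[OF rs(1)] \<sigma>[OF rs(2)] rs c(2) by (simp add: rsmult_r_distr lsmult_l_distr)
    thus "\<sigma> (r \<oplus> s) = \<sigma> r \<oplus> \<sigma> s" using injl \<sigma> rs by simp
  next
    have "\<sigma> \<one> \<odot>\<^bsub>M\<^esub> c = \<one> \<odot>\<^bsub>M\<^esub> c" using \<sigma>[of \<one>] c(2) by (simp add: smult_simps)
    thus "\<sigma> \<one> = \<one>" using injl[of "\<sigma> \<one>" \<one>] \<sigma>[of \<one>] by simp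
    show "bij_betw \<sigma> (carrier R) (carrier R)"
    proof (rule bij_betw_imageI)
      show "inj_on \<sigma> (carrier R)"
      proof (rule inj_onI)
        fix r s assume rs: "r \<in> carrier R" "s \<in> carrier R" "\<sigma> r = \<sigma> s"
        thus "r = s" using injr[OF rs(1,2)] \<sigma>[OF rs(1)] \<sigma>[OF rs(2)] by simp
      qed
      show "\<sigma> ` carrier R = carrier R"
      proof
        show "\<sigma> ` carrier R \<subseteq> carrier R" using \<sigma> by blast
        show "carrier R \<subseteq> \<sigma> ` carrier R"
        proof
          fix s assume s: "s \<in> carrier R"
          obtain r where r: "r \<in> carrier R" "s \<odot>\<^bsub>M\<^esub> c = c \<odot>\<^sub>r\<^bsub>M\<^esub> r" using right[OF lsmult_closed[OF s c(2)]] by blast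
          have "s = \<sigma> r" using injl[OF s] \<sigma>[OF r(1)] r(2) by simp
          thus "s \<in> \<sigma> ` carrier R" using r(1) by blast
        qed
      qed
    qed
  qed
  have "\<forall>m. m \<in> carrier M \<longrightarrow> (\<exists>r. r \<in> carrier R \<and> r \<odot>\<^bsub>M\<^esub> c = m)" using left by metis
  \<comment> \<open>The inverse of \<open>r \<mapsto> rc\<close>. Identities for \<open>f\<close>
    are checked after multiplication with \<open>c\<close>, which \<open>injl\<close> allows to be
    cancelled.\<close>
  then obtain f where f: "\<And>m. m \<in> carrier M \<Longrightarrow> f m \<in> carrier R" "\<And>m. m \<in> carrier M \<Longrightarrow> f m \<odot>\<^bsub>M\<^esub> c = m"
    by metis
  have "f \<in> bimodule_iso R M (twisted_bimodule R \<sigma>)"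
    unfolding bimodule_iso_def left_module_iso_def iso_def
  proof (intro CollectI conjI ballI)
    show "f \<in> hom (add_monoid M) (add_monoid (twisted_bimodule R \<sigma>))"
    proof (rule homI)
      show "f x \<in> carrier (add_monoid (twisted_bimodule R \<sigma>))" if "x \<in> carrier (add_monoid M)" for x
        using f that by (simp add: twisted_bimodule_def)
      fix x y assume "x \<in> carrier (add_monoid M)" "y \<in> carrier (add_monoid M)"
      hence xy: "x \<in> carrier M" "y \<in> carrier M" by auto
      have "f (x \<oplus>\<^bsub>M\<^esub> y) = f x \<oplus> f y"
        by (rule injl) (use xy f c(2) in \<open>simp_all add: lsmult_l_distr\<close>)
      thus "f (x \<otimes>\<^bsub>add_monoid M\<^esub> y) = f x \<otimes>\<^bsub>add_monoid (twisted_bimodule R \<sigma>)\<^esub> f y"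
        by (simp add: twisted_bimodule_def)
    qed
    show "bij_betw f (carrier (add_monoid M)) (carrier (add_monoid (twisted_bimodule R \<sigma>)))"
    proof (rule bij_betw_imageI)
      show "inj_on f (carrier (add_monoid M))"
        by (rule inj_onI) (use f(2) in \<open>simp, metis\<close>)
      have "r \<in> f ` carrier M" if r: "r \<in> carrier R" for r
      proof -
        have m: "r \<odot>\<^bsub>M\<^esub> c \<in> carrier M" by (rule lsmult_closed[OF r c(2)])
        have "r = f (r \<odot>\<^bsub>M\<^esub> c)" by (rule injl[OF r f(1)[OF m]]) (use f(2)[OF m] in simp)
        thus ?thesis using m by blast
      qed
      thus "f ` carrier (add_monoid M) = carrier (add_monoid (twisted_bimodule R \<sigma>))"
        using f(1) by (auto simp: twisted_bimodule_def)
    qed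
    fix r m assume r: "r \<in> carrier R" and m: "m \<in> carrier M"
    have "f (r \<odot>\<^bsub>M\<^esub> m) = r \<otimes> f m"
      by (rule injl) (use r m f c(2) lsmult_closed in \<open>simp_all add: lsmult_assoc\<close>)
    thus "f (r \<odot>\<^bsub>M\<^esub> m) = r \<odot>\<^bsub>twisted_bimodule R \<sigma>\<^esub> f m" by (simp add: twisted_bimodule_def)
  next
    fix m r assume r: "r \<in> carrier R" and m: "m \<in> carrier M"
    have mr: "m \<odot>\<^sub>r\<^bsub>M\<^esub> r \<in> carrier M" by (rule rsmult_closed[OF m r])
    have "(f m \<otimes> \<sigma> r) \<odot>\<^bsub>M\<^esub> c = f m \<odot>\<^bsub>M\<^esub> (c \<odot>\<^sub>r\<^bsub>M\<^esub> r)"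
      using f(1)[OF m] \<sigma>[OF r] c(2) by (simp add: lsmult_assoc)
    also have "\<dots> = (f m \<odot>\<^bsub>M\<^esub> c) \<odot>\<^sub>r\<^bsub>M\<^esub> r"
      by (rule smult_rsmult_assoc[OF f(1)[OF m] c(2) r, symmetric])
    also have "\<dots> = f (m \<odot>\<^sub>r\<^bsub>M\<^esub> r) \<odot>\<^bsub>M\<^esub> c" using f(2)[OF m] f(2)[OF mr] by simp
    finally have eq: "(f m \<otimes> \<sigma> r) \<odot>\<^bsub>M\<^esub> c = f (m \<odot>\<^sub>r\<^bsub>M\<^esub> r) \<odot>\<^bsub>M\<^esub> c" .
    have "f m \<otimes> \<sigma> r = f (m \<odot>\<^sub>r\<^bsub>M\<^esub> r)"
      by (rule injl[OF _ f(1)[OF mr] eq]) (use f(1)[OF m] \<sigma>[OF r] in simp)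
    thus "f (m \<odot>\<^sub>r\<^bsub>M\<^esub> r) = f m \<odot>\<^sub>r\<^bsub>twisted_bimodule R \<sigma>\<^esub> r" by (simp add: twisted_bimodule_def)
  qed
  thus ?thesis using \<sigma>_iso by blast
qed

text \<open>Let \<open>c\<close> be the element that \<open>f\<close> sends to one. Left linearity
  gives \<open>M = Rc\<close>, and surjectivity of \<open>\<sigma>\<close> gives
  \<open>M = cR\<close>. So \<open>(0, c)\<close>, whose square is zero, generates the radical from
  both sides.\<close>

lemma twisted_special:
  assumes simple: "simple_ring R"
    and lss: "left_semisimple_mod {\<zero>} R" and rss: "left_semisimple_mod {\<zero>} (opposite_ring R)"
    and \<sigma>: "\<sigma> \<in> ring_iso R R" and f: "f \<in> bimodule_iso R M (twisted_bimodule R \<sigma>)"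
  obtains p where "special_ring (R \<propto> M) ({\<zero>} \<times> carrier M) p"
proof -
  have bij: "bij_betw f (carrier M) (carrier R)"
    using f by (simp add: bimodule_iso_def left_module_iso_def iso_def twisted_bimodule_def)
  have fl: "f (r \<odot>\<^bsub>M\<^esub> m) = r \<otimes> f m" if "r \<in> carrier R" "m \<in> carrier M" for r m
    using f that by (simp add: bimodule_iso_def left_module_iso_def twisted_bimodule_def)
  have fr: "f (m \<odot>\<^sub>r\<^bsub>M\<^esub> r) = f m \<otimes> \<sigma> r" if "r \<in> carrier R" "m \<in> carrier M" for r m
    using f that by (simp add: bimodule_iso_def left_module_iso_def twisted_bimodule_def)
  have fc: "f m \<in> carrier R" if "m \<in> carrier M" for m using bij that by (auto simp: bij_betw_def)
  have inj: "m = n" if "m \<in> carrier M" "n \<in> carrier M" "f m = f n" for m n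
    using bij that by (auto simp: bij_betw_def dest: inj_onD)
  have "\<one> \<in> f ` carrier M" using bij by (simp add: bij_betw_def)
  then obtain c where c: "c \<in> carrier M" "f c = \<one>" by auto
  have bij\<sigma>: "bij_betw \<sigma> (carrier R) (carrier R)" by (rule ring_iso_memE(5)[OF \<sigma>])
  have \<sigma>c: "\<sigma> r \<in> carrier R" if "r \<in> carrier R" for r using bij\<sigma> that by (auto simp: bij_betw_def)
  have left: "\<exists>r\<in>carrier R. m = r \<odot>\<^bsub>M\<^esub> c" if m: "m \<in> carrier M" for m
  proof -
    have "m = f m \<odot>\<^bsub>M\<^esub> c"
      by (rule inj[OF m lsmult_closed[OF fc[OF m] c(1)]]) (use fl[OF fc[OF m] c(1)] c(2) fc[OF m] in simp)
    thus ?thesis using fc[OF m] by blast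
  qed
  have right: "\<exists>r\<in>carrier R. m = c \<odot>\<^sub>r\<^bsub>M\<^esub> r" if m: "m \<in> carrier M" for m
  proof -
    have "f m \<in> \<sigma> ` carrier R" using bij\<sigma> fc[OF m] by (simp add: bij_betw_def)
    then obtain r where r: "r \<in> carrier R" "f m = \<sigma> r" by blast
    have "m = c \<odot>\<^sub>r\<^bsub>M\<^esub> r"
      by (rule inj[OF m rsmult_closed[OF c(1) r(1)]]) (use fr[OF r(1) c(1)] c(2) r \<sigma>c in simp)
    thus ?thesis using r(1) by blast
  qed
  have one: "\<one> \<noteq> \<zero>" using simple R.carrier_one_not_zero by (simp add: simple_ring_def)
  define p where "p = (\<zero>, c)"
  have pc: "p \<in> carrier (R \<propto> M)" using c by (simp add: p_def)
  have "special_ring (R \<propto> M) ({\<zero>} \<times> carrier M) p"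
  proof (intro special_ring.intro special_ring_axioms.intro S.ring_axioms ideal_zero_times_M pc)
    show "{\<zero>} \<times> carrier M = PIdl\<^bsub>R \<propto> M\<^esub> p"
    proof
      show "{\<zero>} \<times> carrier M \<subseteq> PIdl\<^bsub>R \<propto> M\<^esub> p"
      proof
        fix x assume "x \<in> {\<zero>} \<times> carrier M"
        then obtain m where x: "x = (\<zero>, m)" "m \<in> carrier M" by blast
        obtain r where r: "r \<in> carrier R" "m = r \<odot>\<^bsub>M\<^esub> c" using left[OF x(2)] by blast
        have "x = (r, \<zero>\<^bsub>M\<^esub>) \<otimes>\<^bsub>R \<propto> M\<^esub> p" unfolding x(1) p_def using r lsmult_closed[OF r(1) c(1)] by simp
        thus "x \<in> PIdl\<^bsub>R \<propto> M\<^esub> p" unfolding mem_cgenideal using r(1) by auto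
      qed
      show "PIdl\<^bsub>R \<propto> M\<^esub> p \<subseteq> {\<zero>} \<times> carrier M"
        using c(1) lsmult_closed by (auto simp: mem_cgenideal p_def)
    qed
    show "{\<zero>} \<times> carrier M = PIdl\<^bsub>opposite_ring (R \<propto> M)\<^esub> p"
    proof
      show "{\<zero>} \<times> carrier M \<subseteq> PIdl\<^bsub>opposite_ring (R \<propto> M)\<^esub> p"
      proof
        fix x assume "x \<in> {\<zero>} \<times> carrier M"
        then obtain m where x: "x = (\<zero>, m)" "m \<in> carrier M" by blast
        obtain r where r: "r \<in> carrier R" "m = c \<odot>\<^sub>r\<^bsub>M\<^esub> r" using right[OF x(2)] by blast
        have "x = p \<otimes>\<^bsub>R \<propto> M\<^esub> (r, \<zero>\<^bsub>M\<^esub>)" unfolding x(1) p_def using r rsmult_closed[OF c(1) r(1)] by simp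
        thus "x \<in> PIdl\<^bsub>opposite_ring (R \<propto> M)\<^esub> p" unfolding mem_cgenideal using r(1) by auto
      qed
      show "PIdl\<^bsub>opposite_ring (R \<propto> M)\<^esub> p \<subseteq> {\<zero>} \<times> carrier M"
        using c(1) rsmult_closed by (auto simp: mem_cgenideal p_def)
    qed
    have "p \<otimes>\<^bsub>R \<propto> M\<^esub> p = \<zero>\<^bsub>R \<propto> M\<^esub>" unfolding p_def using c(1) by simp
    hence "p [^]\<^bsub>R \<propto> M\<^esub> (2::nat) = \<zero>\<^bsub>R \<propto> M\<^esub>"
      using pc by (simp add: numeral_2_eq_2 del: trivial_extension_simps)
    thus "\<exists>n::nat. p [^]\<^bsub>R \<propto> M\<^esub> n = \<zero>\<^bsub>R \<propto> M\<^esub>" by blast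
    show "\<one>\<^bsub>R \<propto> M\<^esub> \<notin> {\<zero>} \<times> carrier M" using one by simp
    show "I = {\<zero>} \<times> carrier M \<or> I = carrier (R \<propto> M)"
      if I: "ideal I (R \<propto> M)" "{\<zero>} \<times> carrier M \<subseteq> I" for I
    proof -
      have "left_ideal I (R \<propto> M)" using I(1) S.ideal_iff_left_ideal by blast
      hence "I = base I \<times> carrier M" using base_eq I(2) by blast
      moreover have "base I = {\<zero>} \<or> base I = carrier R"
        using simple ideal_base[OF I(1)] by (simp add: simple_ring_def)
      ultimately show ?thesis by auto
    qed
    show "left_semisimple_mod ({\<zero>} \<times> carrier M) (R \<propto> M)"
      by (rule left_semisimple_trivial_extension[OF R.zeroideal lss])
    show "left_semisimple_mod ({\<zero>} \<times> carrier M) (opposite_ring (R \<propto> M))"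
      by (rule right_semisimple_trivial_extension[OF R.zeroideal rss])
  qed
  thus thesis by (rule that)
qed

end

text \<open>Covers the case \<open>M = 0\<close> over a simple ring: the radical is zero, and
  diagonalisation becomes the usual one over a simple artinian ring.\<close>

lemma (in ring) simple_semisimple_special:
  assumes simple: "simple_ring R"
    and lss: "left_semisimple_mod {\<zero>} R" and rss: "left_semisimple_mod {\<zero>} (opposite_ring R)"
  shows "special_ring R {\<zero>} \<zero>"
proof (intro special_ring.intro special_ring_axioms.intro ring_axioms zeroideal zero_closed lss rss)
  show "{\<zero>} = PIdl \<zero>" "{\<zero>} = PIdl\<^bsub>opposite_ring R\<^esub> \<zero>" by (auto simp: mem_cgenideal intro!: exI[of _ \<zero>])
  show "\<exists>n::nat. \<zero> [^] n = \<zero>" by (intro exI[of _ "Suc 0"]) simp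
  show "\<one> \<notin> {\<zero>}" using simple carrier_one_not_zero by (simp add: simple_ring_def)
  show "I = {\<zero>} \<or> I = carrier R" if "ideal I R" for I using simple that by (simp add: simple_ring_def)
qed

theorem theorem3p6:
  fixes R :: "('a, 'r) ring_scheme" and M :: "('a, 'b, 'm) bimodule_scheme"
  assumes "ring R" and "left_perfect R" and "no_nontrivial_central_idempotents R"
    and "bimodule R M"
  shows "(simple_artinian R \<longrightarrow>
            (morphic_ring (R \<propto> M) \<longleftrightarrow>
              carrier M = {\<zero>\<^bsub>M\<^esub>} \<or>
              (\<exists>\<sigma>\<in>ring_iso R R. bimodule_iso R M (twisted_bimodule R \<sigma>) \<noteq> {}))) \<and>
         (\<not> simple_artinian R \<longrightarrow>
            (morphic_ring (R \<propto> M) \<longleftrightarrow>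
              artinian_ring R \<and> principal_ring R \<and> carrier M = {\<zero>\<^bsub>M\<^esub>}))"
proof -
  interpret bimodule R M by (rule assms(4))
  define J where "J = jacobson_radical R"
  have J: "ideal J R" unfolding J_def by (rule R.ideal_jacobson_radical)
  have Jl: "left_ideal J R" using J R.ideal_iff_left_ideal by blast
  have T: "left_T_nilpotent J R" and ss: "semisimple_ring (R Quot J)"
    using assms(2) by (auto simp: left_perfect_def J_def)
  have Q: "ring (R Quot J)" by (rule ideal.quotient_is_ring[OF J])
  note ssQ = ring.semisimple_ring_imp_mod_zero[OF Q ss]
  have lss: "left_semisimple_mod J R" by (rule R.left_semisimple_mod_quotient[OF J ssQ])
  \<comment> \<open>Perfectness supplies semisimplicity from the left only. The passage to the right
    takes place in \<open>R Quot J\<close>, and its result is pulled back to the opposite of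
    \<open>R\<close>.\<close>
  have rss: "left_semisimple_mod J (opposite_ring R)"
  proof (rule ring.left_semisimple_mod_quotient[OF R.ring_opposite R.ideal_opposite[OF J]])
    show "left_semisimple_mod {\<zero>\<^bsub>opposite_ring R Quot J\<^esub>} (opposite_ring R Quot J)"
      using ring.left_semisimple_zero_opposite[OF Q ssQ] by (simp add: opposite_FactRing flip: opposite_FactRing)
  qed
  \<comment> \<open>The forward analysis is carried out for the extension, with
    \<open>J \<times> carrier M\<close> as its radical; facts about \<open>R\<close> and
    \<open>M\<close> are read off afterwards.\<close>
  have morphic_imp_special: "\<exists>p. special_ring (R \<propto> M) (J \<times> carrier M) p"
    if "\<one>\<^bsub>R\<^esub> \<noteq> \<zero>\<^bsub>R\<^esub>" "morphic_ring (R \<propto> M)"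
  proof -
    note S = ideal_times_M[OF J] left_semisimple_trivial_extension[OF J lss]
      right_semisimple_trivial_extension[OF J rss]
    note TS = T_nilpotent_trivial_extension[OF J T]
    show ?thesis
      by (rule S.principal_imp_special[OF S.morphic_artinian_principal(2)[OF S TS that(2)] S TS
            no_nontrivial_central_idempotents_trivial_extension[OF assms(3)]])
        (use that(1) in auto)
  qed
  \<comment> \<open>Elements of \<open>J\<close> are nilpotent, so \<open>J\<close> does not contain
    one, and simplicity leaves only the zero ideal.\<close>
  have J0: "J = {\<zero>\<^bsub>R\<^esub>}" if "simple_ring R"
  proof -
    have one: "\<one>\<^bsub>R\<^esub> \<noteq> \<zero>\<^bsub>R\<^esub>" using that R.carrier_one_not_zero by (simp add: simple_ring_def)
    have "J \<subseteq> carrier R" using left_ideal_carrier[OF Jl] by blast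
    hence "\<one>\<^bsub>R\<^esub> \<notin> J" using R.T_nilpotent_nilpotent[OF _ T, of "\<one>\<^bsub>R\<^esub>"] one by auto
    thus ?thesis using that J R.one_closed unfolding simple_ring_def by blast
  qed
  have "morphic_ring (R \<propto> M) \<longleftrightarrow> carrier M = {\<zero>\<^bsub>M\<^esub>} \<or>
      (\<exists>\<sigma>\<in>ring_iso R R. bimodule_iso R M (twisted_bimodule R \<sigma>) \<noteq> {})" if "simple_artinian R"
  proof -
    have simple: "simple_ring R" using that by (simp add: simple_artinian_def)
    have one: "\<one>\<^bsub>R\<^esub> \<noteq> \<zero>\<^bsub>R\<^esub>" using simple R.carrier_one_not_zero by (simp add: simple_ring_def)
    note lss0 = lss[unfolded J0[OF simple]] and rss0 = rss[unfolded J0[OF simple]]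
    show ?thesis
    proof
      assume "morphic_ring (R \<propto> M)"
      then obtain p where "special_ring (R \<propto> M) ({\<zero>\<^bsub>R\<^esub>} \<times> carrier M) p"
        using morphic_imp_special[OF one] J0[OF simple] by auto
      thus "carrier M = {\<zero>\<^bsub>M\<^esub>} \<or> (\<exists>\<sigma>\<in>ring_iso R R. bimodule_iso R M (twisted_bimodule R \<sigma>) \<noteq> {})"
        using special_zero_radical_twisted[OF simple] by blast
    next
      assume "carrier M = {\<zero>\<^bsub>M\<^esub>} \<or> (\<exists>\<sigma>\<in>ring_iso R R. bimodule_iso R M (twisted_bimodule R \<sigma>) \<noteq> {})"
      thus "morphic_ring (R \<propto> M)"
      proof
        assume M0: "carrier M = {\<zero>\<^bsub>M\<^esub>}"
        show ?thesis
          unfolding morphic_trivial_extension_zero[OF M0]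
          by (rule special_ring.morphic_special[OF R.simple_semisimple_special[OF simple lss0 rss0]])
      next
        assume "\<exists>\<sigma>\<in>ring_iso R R. bimodule_iso R M (twisted_bimodule R \<sigma>) \<noteq> {}"
        then obtain \<sigma> f where "\<sigma> \<in> ring_iso R R" "f \<in> bimodule_iso R M (twisted_bimodule R \<sigma>)" by blast
        then obtain p where "special_ring (R \<propto> M) ({\<zero>\<^bsub>R\<^esub>} \<times> carrier M) p"
          using twisted_special[OF simple lss0 rss0] by blast
        thus ?thesis by (rule special_ring.morphic_special)
      qed
    qed
  qed
  moreover have "morphic_ring (R \<propto> M) \<longleftrightarrow> artinian_ring R \<and> principal_ring R \<and> carrier M = {\<zero>\<^bsub>M\<^esub>}"
    if not_simple: "\<not> simple_artinian R"
  proof (cases "\<one>\<^bsub>R\<^esub> = \<zero>\<^bsub>R\<^esub>")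
    \<comment> \<open>A unital module over the zero ring is zero, and both sides of the equivalence
      hold.\<close>
    case True
    hence R0: "carrier R = {\<zero>\<^bsub>R\<^esub>}" using R.carrier_one_zero by simp
    have "m = \<zero>\<^bsub>M\<^esub>" if "m \<in> carrier M" for m
      using lsmult_one[OF that] smult_zeros(2)[OF that] True by simp
    hence M0: "carrier M = {\<zero>\<^bsub>M\<^esub>}" by auto
    show ?thesis
      unfolding morphic_trivial_extension_zero[OF M0] using R.zero_ring[OF R0] M0 by simp
  next
    case False
    show ?thesis
    proof
      assume m: "morphic_ring (R \<propto> M)"
      obtain p where p: "special_ring (R \<propto> M) (J \<times> carrier M) p"
        using morphic_imp_special[OF False m] by blast
      \<comment> \<open>A zero radical would make \<open>R\<close> simple artinian, so the dichotomy
        leaves \<open>M = 0\<close>, and then \<open>R\<close> inherits morphicity from the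
        extension.\<close>
      have "J \<noteq> {\<zero>\<^bsub>R\<^esub>}" using special_zero_radical_simple[OF _ p lss rss] not_simple by blast
      hence M0: "carrier M = {\<zero>\<^bsub>M\<^esub>}" using special_trivial_extension_cases[OF J T p] by blast
      hence "morphic_ring R" using m morphic_trivial_extension_zero by simp
      thus "artinian_ring R \<and> principal_ring R \<and> carrier M = {\<zero>\<^bsub>M\<^esub>}"
        using R.morphic_artinian_principal[OF J lss rss T] M0 by blast
    next
      assume R: "artinian_ring R \<and> principal_ring R \<and> carrier M = {\<zero>\<^bsub>M\<^esub>}"
      hence M0: "carrier M = {\<zero>\<^bsub>M\<^esub>}" by simp
      obtain p where "special_ring R J p"
        using R.principal_imp_special[OF _ J lss rss T assms(3) False] R by blast
      thus "morphic_ring (R \<propto> M)"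
        unfolding morphic_trivial_extension_zero[OF M0] by (rule special_ring.morphic_special)
    qed
  qed
  ultimately show ?thesis by blast
qed

end
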